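(* Let $(M,\nabla)$ be a real analytic affine surface, let $P\in M$, and let $(x^1,x^2)$ be real analytic local coordinates centered at $P$. Let $\xi_0(x^2)$ be a real analytic function defined near $x^2=0$. Then there is a unique local (near $P$) real analytic solution $\xi$ to the equation $\mathcal{P}_1(\xi)=0$ with $\xi(0,x^2)=\xi_0(x^2)$. Furthermore, given real analytic functions $\alpha_0(x^2)$ and $\alpha_1(x^2)$ defined near $x^2=0$ with $\alpha_0(0)\neq0$, there is a unique local (near $P$) real analytic solution $\alpha$ to the equation $\mathcal{P}_2(\xi,\alpha)=0$ with $\alpha(0,x^2)=\alpha_0(x^2)$ and $\alpha^{(1,0)}(0,x^2)=\alpha_1(x^2)$. With these $\xi,\alpha$, the nilpotent tensor field $$T=\begin{pmatrix} T^1{}_1 & T^1{}_2 \\ T^2{}_1 & T^2{}_2 \end{pmatrix}=\alpha\begin{pmatrix} \xi & 1 \\ -\xi^2 & -\xi \end{pmatrix}$$ is such that, on a neighborhood $U$ of $P$, the modified Riemannian extension $(T^*U,g_{T,\nabla,\Phi})$ is Bach flat for every symmetric $2$-tensor $\Phi$ on $U$. In particular, every real analytic affine surface locally gives rise to a Bach flat modified Riemannian extension defined by a non-zero nilpotent $T$. The operators $\mathcal{P}_1,\mathcal{P}_2$ are those written out in the context.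
   Context: An affine surface $(M,\nabla)$ is a $2$-dimensional manifold $M$ with a torsion-free connection $\nabla$ on $TM$; in local coordinates $(x^1,x^2)$, $\nabla_{\partial_{x^i}}\partial_{x^j}=\Gamma_{ij}{}^k\partial_{x^k}$ (repeated indices are summed). It is real analytic if $M$ and $\nabla$ are real analytic. Let $(y_1,y_2)$ be the dual fiber coordinates on $T^*M$, where a $1$-form is written $\omega=y_1dx^1+y_2dx^2$. For a type $(1,1)$ tensor field $T=T^r{}_i\,\partial_{x^r}\otimes dx^i$ and a symmetric $2$-tensor $\Phi$, the modified Riemannian extension is the neutral signature $(2,2)$ metric on $T^*M$ $$g_{T,\nabla,\Phi}=2\,dx^i\circ dy_i+\left\{\tfrac12 y_ry_s(T^r{}_iT^s{}_j+T^r{}_jT^s{}_i)-2y_k\Gamma_{ij}{}^k+\Phi_{ij}\right\}dx^i\circ dx^j,$$ where $\circ$ is the symmetric product (so $g(\partial_{x^i},\partial_{y_j})=\delta_{ij}$, $g(\partial_{y_i},\partial_{y_j})=0$, and $g(\partial_{x^i},\partial_{x^j})$ is the expression in braces). For a four-dimensional pseudo-Riemannian manifold $(N,g)$ with Levi-Civita connection ${}^g\nabla$, curvature operator $R(X,Y)={}^g\nabla_X{}^g\nabla_Y-{}^g\nabla_Y{}^g\nabla_X-{}^g\nabla_{[X,Y]}$, Weyl tensor $W$ and Ricci tensor $\rho$, the Bach tensor is $\mathfrak{B}_{ij}={}^g\nabla^k\,{}^g\nabla^\ell W_{kij\ell}+\tfrac12\rho^{k\ell}W_{kij\ell}$; $(N,g)$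 is Bach flat if $\mathfrak{B}=0$. For a function $\phi(x^1,x^2)$ write $\phi^{(a,b)}=\partial_{x^1}^a\partial_{x^2}^b\phi$. The operators are $$\mathcal{P}_1(\xi):=-\xi^{(1,0)}+\xi\,\xi^{(0,1)}+\Gamma_{22}{}^1\xi^3-(2\Gamma_{12}{}^1-\Gamma_{22}{}^2)\xi^2+(\Gamma_{11}{}^1-2\Gamma_{12}{}^2)\xi+\Gamma_{11}{}^2,$$ $$\begin{aligned} \mathcal{P}_2(\xi,\alpha):=\ &\alpha\alpha^{(2,0)}+\xi^2\alpha\alpha^{(0,2)}-2\xi\alpha\alpha^{(1,1)}+(\alpha^{(1,0)})^2+\xi^2(\alpha^{(0,1)})^2-2\xi\alpha^{(1,0)}\alpha^{(0,1)}\\ &-\alpha\alpha^{(1,0)}\left(2\xi^{(0,1)}-5\Gamma_{22}{}^1\xi^2+2(4\Gamma_{12}{}^1-\Gamma_{22}{}^2)\xi-3\Gamma_{11}{}^1+2\Gamma_{12}{}^2\right)\\ &+\alpha\alpha^{(0,1)}\left(2\xi\xi^{(0,1)}-6\Gamma_{22}{}^1\xi^3+(10\Gamma_{12}{}^1-3\Gamma_{22}{}^2)\xi^2-4(\Gamma_{11}{}^1-\Gamma_{12}{}^2)\xi-\Gamma_{11}{}^2\right)\\ &+6\xi^4\alpha^2(\Gamma_{22}{}^1)^2-2\xi^3\alpha^2\left((\Gamma_{22}{}^1)^{(0,1)}+9\Gamma_{12}{}^1\Gamma_{22}{}^1-3\Gamma_{22}{}^1\Gamma_{22}{}^2\right)\\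 &-\xi^2\alpha^2\Big(4\Gamma_{22}{}^1\xi^{(0,1)}-3(\Gamma_{12}{}^1)^{(0,1)}-2(\Gamma_{22}{}^1)^{(1,0)}+(\Gamma_{22}{}^2)^{(0,1)}\\ &\qquad-12(\Gamma_{12}{}^1)^2-(\Gamma_{22}{}^2)^2-7\Gamma_{11}{}^1\Gamma_{22}{}^1+7\Gamma_{12}{}^1\Gamma_{22}{}^2+9\Gamma_{12}{}^2\Gamma_{22}{}^1\Big)\\ &+\xi\alpha^2\Big(2(3\Gamma_{12}{}^1-\Gamma_{22}{}^2)\xi^{(0,1)}-(\Gamma_{11}{}^1)^{(0,1)}-3(\Gamma_{12}{}^1)^{(1,0)}+(\Gamma_{12}{}^2)^{(0,1)}\\ &\qquad+(\Gamma_{22}{}^2)^{(1,0)}-2(\Gamma_{11}{}^1-\Gamma_{12}{}^2)(4\Gamma_{12}{}^1-\Gamma_{22}{}^2)+4\Gamma_{11}{}^2\Gamma_{22}{}^1\Big)\\ &-\alpha^2\Big(2(\Gamma_{11}{}^1-\Gamma_{12}{}^2)\xi^{(0,1)}-(\Gamma_{11}{}^1)^{(1,0)}+(\Gamma_{12}{}^2)^{(1,0)}\\ &\qquad-(\Gamma_{11}{}^1)^2+\Gamma_{11}{}^1\Gamma_{12}{}^2+3\Gamma_{11}{}^2\Gamma_{12}{}^1-\Gamma_{11}{}^2\Gamma_{22}{}^2\Big). \end{aligned}$$ *)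

theory Defs
  imports "HOL-Analysis.Analysis"
begin

section \<open>Real analytic and smooth functions\<close>

text \<open>Multi-indices are functions from the basis to the naturals; convergence of
  the multi-indexed power series is unconditional (\<open>has_sum\<close>).\<close>

definition real_analytic_at :: "('a::euclidean_space \<Rightarrow> 'b::real_normed_vector) \<Rightarrow> 'a \<Rightarrow> bool" where
  "real_analytic_at f a \<longleftrightarrow>
     (\<exists>r>0. \<exists>coef. \<forall>x\<in>ball a r.
        ((\<lambda>m. (\<Prod>b\<in>Basis. ((x - a) \<bullet> b) ^ m b) *\<^sub>R coef m) has_sum f x)
          (Basis \<rightarrow>\<^sub>E (UNIV :: nat set)))"

definition real_analytic_on :: "('a::euclidean_space \<Rightarrow> 'b::real_normed_vector) \<Rightarrow> 'a set \<Rightarrow> bool" where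
  "real_analytic_on f S \<longleftrightarrow> (\<forall>x\<in>S. real_analytic_at f x)"

definition partial :: "'n::finite \<Rightarrow> (real ^ 'n \<Rightarrow> real) \<Rightarrow> real ^ 'n \<Rightarrow> real" where
  "partial i f x = deriv (\<lambda>t. f (x + t *\<^sub>R axis i 1)) 0"

primrec Ck_on :: "nat \<Rightarrow> (real ^ 'n::finite) set \<Rightarrow> (real ^ 'n \<Rightarrow> real) \<Rightarrow> bool" where
  "Ck_on 0 S f \<longleftrightarrow> continuous_on S f"
| "Ck_on (Suc k) S f \<longleftrightarrow> (\<forall>x\<in>S. f differentiable (at x)) \<and> (\<forall>i. Ck_on k S (partial i f))"

text \<open>Used for open sets only.\<close>

definition smooth_on :: "(real ^ 'n::finite) set \<Rightarrow> (real ^ 'n \<Rightarrow> real) \<Rightarrow> bool" where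
  "smooth_on S f \<longleftrightarrow> (\<forall>k. Ck_on k S f)"


section \<open>Vector fields in coordinates\<close>

definition vf_apply :: "(real ^ 'n::finite \<Rightarrow> real ^ 'n) \<Rightarrow> (real ^ 'n \<Rightarrow> real) \<Rightarrow> real ^ 'n \<Rightarrow> real" where
  "vf_apply V f x = (\<Sum>i\<in>UNIV. V x $ i * partial i f x)"

definition lie_bracket ::
  "(real ^ 'n::finite \<Rightarrow> real ^ 'n) \<Rightarrow> (real ^ 'n \<Rightarrow> real ^ 'n) \<Rightarrow> real ^ 'n \<Rightarrow> real ^ 'n" where
  "lie_bracket V W x =
     (\<chi> k. vf_apply V (\<lambda>y. W y $ k) x - vf_apply W (\<lambda>y. V y $ k) x)"


section \<open>Real analytic affine surfaces\<close>

text \<open>A chart is a pair \<open>(D, \<phi>)\<close> of its domain and its coordinate map; the values of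
  \<open>\<phi>\<close> outside \<open>D\<close> are irrelevant.\<close>

type_synonym 'p chart = "'p set \<times> ('p \<Rightarrow> real ^ 2)"

definition is_chart :: "'p topology \<Rightarrow> 'p chart \<Rightarrow> bool" where
  "is_chart X c \<longleftrightarrow> openin X (fst c) \<and> open (snd c ` fst c) \<and>
     homeomorphic_map (subtopology X (fst c)) (top_of_set (snd c ` fst c)) (snd c)"

definition chart_inv :: "'p chart \<Rightarrow> real ^ 2 \<Rightarrow> 'p" where
  "chart_inv c = the_inv_into (fst c) (snd c)"

definition coord_change :: "'p chart \<Rightarrow> 'p chart \<Rightarrow> real ^ 2 \<Rightarrow> real ^ 2" where
  "coord_change c c' = snd c' \<circ> chart_inv c"

definition analytically_compatible :: "'p chart \<Rightarrow> 'p chart \<Rightarrow> bool" where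
  "analytically_compatible c c' \<longleftrightarrow>
     real_analytic_on (coord_change c c') (snd c ` (fst c \<inter> fst c')) \<and>
     real_analytic_on (coord_change c' c) (snd c' ` (fst c \<inter> fst c'))"

text \<open>The atlas is maximal, so that its members are exactly the real analytic local
  coordinate systems.\<close>

definition real_analytic_surface :: "'p topology \<Rightarrow> 'p chart set \<Rightarrow> bool" where
  "real_analytic_surface X A \<longleftrightarrow>
     Hausdorff_space X \<and> second_countable X \<and>
     (\<forall>c\<in>A. is_chart X c) \<and> (\<Union>c\<in>A. fst c) = topspace X \<and>
     (\<forall>c\<in>A. \<forall>c'\<in>A. analytically_compatible c c') \<and>
     (\<forall>c. is_chart X c \<and> (\<forall>c'\<in>A. analytically_compatible c c') \<longrightarrow> c \<in> A)"

text \<open>A vector field is given by its component functions \<open>V c\<close> in every chart \<open>c\<close>, as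
  functions of the coordinates, related by the Jacobians of the coordinate changes.\<close>

type_synonym 'p vfield = "'p chart \<Rightarrow> real ^ 2 \<Rightarrow> real ^ 2"

definition smooth_vfield_on :: "'p chart set \<Rightarrow> 'p set \<Rightarrow> 'p vfield \<Rightarrow> bool" where
  "smooth_vfield_on A W V \<longleftrightarrow>
     (\<forall>c\<in>A. \<forall>k. smooth_on (snd c ` (fst c \<inter> W)) (\<lambda>x. V c x $ k)) \<and>
     (\<forall>c\<in>A. \<forall>c'\<in>A. \<forall>x\<in>snd c ` (fst c \<inter> fst c' \<inter> W).
        V c' (coord_change c c' x) = frechet_derivative (coord_change c c') (at x) (V c x))"

definition vfield_eq_on :: "'p chart set \<Rightarrow> 'p set \<Rightarrow> 'p vfield \<Rightarrow> 'p vfield \<Rightarrow> bool" where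
  "vfield_eq_on A W V V' \<longleftrightarrow> (\<forall>c\<in>A. \<forall>x\<in>snd c ` (fst c \<inter> W). V c x = V' c x)"

definition smooth_fun_on :: "'p chart set \<Rightarrow> 'p set \<Rightarrow> ('p \<Rightarrow> real) \<Rightarrow> bool" where
  "smooth_fun_on A W f \<longleftrightarrow> (\<forall>c\<in>A. smooth_on (snd c ` (fst c \<inter> W)) (f \<circ> chart_inv c))"

text \<open>\<open>nabla W U V\<close> is the covariant derivative of \<open>V\<close> along \<open>U\<close>, for vector
  fields on the open set \<open>W\<close>.  The second clause says that it depends only on the
  restrictions to \<open>W\<close> and commutes with further restriction.\<close>

definition affine_connection ::
  "'p topology \<Rightarrow> 'p chart set \<Rightarrow> ('p set \<Rightarrow> 'p vfield \<Rightarrow> 'p vfield \<Rightarrow> 'p vfield) \<Rightarrow> bool" where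
  "affine_connection X A nabla \<longleftrightarrow>
     (\<forall>W U V. openin X W \<and> smooth_vfield_on A W U \<and> smooth_vfield_on A W V \<longrightarrow>
        smooth_vfield_on A W (nabla W U V)) \<and>
     (\<forall>W W' U V U' V'. openin X W \<and> openin X W' \<and> W' \<subseteq> W \<and>
        smooth_vfield_on A W U \<and> smooth_vfield_on A W V \<and>
        smooth_vfield_on A W' U' \<and> smooth_vfield_on A W' V' \<and>
        vfield_eq_on A W' U U' \<and> vfield_eq_on A W' V V' \<longrightarrow>
        vfield_eq_on A W' (nabla W U V) (nabla W' U' V')) \<and>
     (\<forall>W U U' V. openin X W \<and> smooth_vfield_on A W U \<and> smooth_vfield_on A W U' \<and>
        smooth_vfield_on A W V \<longrightarrow>
        vfield_eq_on A W (nabla W (\<lambda>c x. U c x + U' c x) V)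
          (\<lambda>c x. nabla W U V c x + nabla W U' V c x) \<and>
        vfield_eq_on A W (nabla W V (\<lambda>c x. U c x + U' c x))
          (\<lambda>c x. nabla W V U c x + nabla W V U' c x)) \<and>
     (\<forall>W U V f. openin X W \<and> smooth_vfield_on A W U \<and> smooth_vfield_on A W V \<and>
        smooth_fun_on A W f \<longrightarrow>
        vfield_eq_on A W (nabla W (\<lambda>c x. f (chart_inv c x) *\<^sub>R U c x) V)
          (\<lambda>c x. f (chart_inv c x) *\<^sub>R nabla W U V c x) \<and>
        vfield_eq_on A W (nabla W U (\<lambda>c x. f (chart_inv c x) *\<^sub>R V c x))
          (\<lambda>c x. vf_apply (U c) (f \<circ> chart_inv c) x *\<^sub>R V c x
                 + f (chart_inv c x) *\<^sub>R nabla W U V c x))"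

definition torsion_free ::
  "'p topology \<Rightarrow> 'p chart set \<Rightarrow> ('p set \<Rightarrow> 'p vfield \<Rightarrow> 'p vfield \<Rightarrow> 'p vfield) \<Rightarrow> bool" where
  "torsion_free X A nabla \<longleftrightarrow>
     (\<forall>W U V. openin X W \<and> smooth_vfield_on A W U \<and> smooth_vfield_on A W V \<longrightarrow>
        vfield_eq_on A W (\<lambda>c x. nabla W U V c x - nabla W V U c x)
          (\<lambda>c. lie_bracket (U c) (V c)))"

text \<open>The coordinate vector field of \<open>x\<^sup>i\<close> on the domain of \<open>c\<close>, expressed in a chart \<open>c'\<close>.\<close>

definition coord_vfield :: "'p chart \<Rightarrow> 2 \<Rightarrow> 'p vfield" where
  "coord_vfield c i = (\<lambda>c' x'.
     frechet_derivative (coord_change c c') (at (coord_change c' c x')) (axis i 1))"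

text \<open>\<open>christoffel nabla c i j k\<close> is \<open>\<Gamma>\<^sub>i\<^sub>j\<^sup>k\<close> as a function of the coordinates of \<open>c\<close>.\<close>

definition christoffel ::
  "('p set \<Rightarrow> 'p vfield \<Rightarrow> 'p vfield \<Rightarrow> 'p vfield) \<Rightarrow> 'p chart \<Rightarrow> 2 \<Rightarrow> 2 \<Rightarrow> 2 \<Rightarrow> real ^ 2 \<Rightarrow> real" where
  "christoffel nabla c i j k x = nabla (fst c) (coord_vfield c i) (coord_vfield c j) c x $ k"

definition real_analytic_affine_surface ::
  "'p topology \<Rightarrow> 'p chart set \<Rightarrow> ('p set \<Rightarrow> 'p vfield \<Rightarrow> 'p vfield \<Rightarrow> 'p vfield) \<Rightarrow> bool" where
  "real_analytic_affine_surface X A nabla \<longleftrightarrow>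
     real_analytic_surface X A \<and> affine_connection X A nabla \<and> torsion_free X A nabla \<and>
     (\<forall>c\<in>A. \<forall>i j k. real_analytic_on (christoffel nabla c i j k) (snd c ` fst c))"


section \<open>Pseudo-Riemannian metrics on open subsets of coordinate space\<close>

text \<open>\<open>g z $ i $ j\<close> is the component \<open>g(\<partial>\<^sub>i, \<partial>\<^sub>j)\<close> at \<open>z\<close>.\<close>

definition pseudo_riemannian_on ::
  "(real ^ 'n::finite) set \<Rightarrow> (real ^ 'n \<Rightarrow> real ^ 'n ^ 'n) \<Rightarrow> bool" where
  "pseudo_riemannian_on N g \<longleftrightarrow> open N \<and>
     (\<forall>i j. smooth_on N (\<lambda>z. g z $ i $ j)) \<and>
     (\<forall>z\<in>N. transpose (g z) = g z \<and> invertible (g z))"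

definition g_up :: "(real ^ 'n::finite \<Rightarrow> real ^ 'n ^ 'n) \<Rightarrow> 'n \<Rightarrow> 'n \<Rightarrow> real ^ 'n \<Rightarrow> real" where
  "g_up g i j z = matrix_inv (g z) $ i $ j"

text \<open>Components of the Levi-Civita connection, from the Koszul formula for coordinate fields.\<close>

definition levi_civita ::
  "(real ^ 'n::finite \<Rightarrow> real ^ 'n ^ 'n) \<Rightarrow> 'n \<Rightarrow> 'n \<Rightarrow> 'n \<Rightarrow> real ^ 'n \<Rightarrow> real" where
  "levi_civita g i j k z = 1/2 * (\<Sum>l\<in>UNIV. g_up g k l z *
     (partial i (\<lambda>w. g w $ j $ l) z + partial j (\<lambda>w. g w $ i $ l) z
      - partial l (\<lambda>w. g w $ i $ j) z))"

definition cov_deriv ::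
  "('n \<Rightarrow> 'n \<Rightarrow> 'n \<Rightarrow> real ^ 'n \<Rightarrow> real) \<Rightarrow> (real ^ 'n::finite \<Rightarrow> real ^ 'n) \<Rightarrow>
     (real ^ 'n \<Rightarrow> real ^ 'n) \<Rightarrow> real ^ 'n \<Rightarrow> real ^ 'n" where
  "cov_deriv \<Gamma> V W z = (\<chi> k. vf_apply V (\<lambda>w. W w $ k) z +
     (\<Sum>i\<in>UNIV. \<Sum>j\<in>UNIV. \<Gamma> i j k z * V z $ i * W z $ j))"

definition curv_op ::
  "('n \<Rightarrow> 'n \<Rightarrow> 'n \<Rightarrow> real ^ 'n \<Rightarrow> real) \<Rightarrow> (real ^ 'n::finite \<Rightarrow> real ^ 'n) \<Rightarrow>
     (real ^ 'n \<Rightarrow> real ^ 'n) \<Rightarrow> (real ^ 'n \<Rightarrow> real ^ 'n) \<Rightarrow> real ^ 'n \<Rightarrow> real ^ 'n" where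
  "curv_op \<Gamma> X Y Z z = cov_deriv \<Gamma> X (cov_deriv \<Gamma> Y Z) z
     - cov_deriv \<Gamma> Y (cov_deriv \<Gamma> X Z) z - cov_deriv \<Gamma> (lie_bracket X Y) Z z"

definition coord_field :: "'n::finite \<Rightarrow> real ^ 'n \<Rightarrow> real ^ 'n" where
  "coord_field i = (\<lambda>_. axis i 1)"

text \<open>\<open>R\<^sub>i\<^sub>j\<^sub>k\<^sub>l = g(R(\<partial>\<^sub>i, \<partial>\<^sub>j)\<partial>\<^sub>k, \<partial>\<^sub>l)\<close>, and
  \<open>\<rho>\<^sub>j\<^sub>k = trace (Z \<mapsto> R(Z, \<partial>\<^sub>j)\<partial>\<^sub>k)\<close>, which is positive on round spheres.\<close>

definition riem ::
  "(real ^ 'n::finite \<Rightarrow> real ^ 'n ^ 'n) \<Rightarrow> 'n \<Rightarrow> 'n \<Rightarrow> 'n \<Rightarrow> 'n \<Rightarrow> real ^ 'n \<Rightarrow> real" where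
  "riem g i j k l z = (\<Sum>m\<in>UNIV.
     curv_op (levi_civita g) (coord_field i) (coord_field j) (coord_field k) z $ m * g z $ m $ l)"

definition ricci ::
  "(real ^ 'n::finite \<Rightarrow> real ^ 'n ^ 'n) \<Rightarrow> 'n \<Rightarrow> 'n \<Rightarrow> real ^ 'n \<Rightarrow> real" where
  "ricci g j k z = (\<Sum>i\<in>UNIV.
     curv_op (levi_civita g) (coord_field i) (coord_field j) (coord_field k) z $ i)"

definition scal :: "(real ^ 'n::finite \<Rightarrow> real ^ 'n ^ 'n) \<Rightarrow> real ^ 'n \<Rightarrow> real" where
  "scal g z = (\<Sum>i\<in>UNIV. \<Sum>j\<in>UNIV. g_up g i j z * ricci g i j z)"

text \<open>The trace-free part of the curvature in dimension \<open>CARD('n) \<ge> 3\<close>, the signs being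
  those of \<open>R\<^sub>i\<^sub>j\<^sub>k\<^sub>l = g\<^sub>i\<^sub>l g\<^sub>j\<^sub>k - g\<^sub>i\<^sub>k g\<^sub>j\<^sub>l\<close> on the unit sphere.\<close>

definition weyl ::
  "(real ^ 'n::finite \<Rightarrow> real ^ 'n ^ 'n) \<Rightarrow> 'n \<Rightarrow> 'n \<Rightarrow> 'n \<Rightarrow> 'n \<Rightarrow> real ^ 'n \<Rightarrow> real" where
  "weyl g i j k l z = (let n = real CARD('n) in riem g i j k l z
     - 1 / (n - 2) * (ricci g j k z * g z $ i $ l - ricci g i k z * g z $ j $ l
                      + ricci g i l z * g z $ j $ k - ricci g j l z * g z $ i $ k)
     + scal g z / ((n - 1) * (n - 2)) * (g z $ i $ l * g z $ j $ k - g z $ i $ k * g z $ j $ l))"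

text \<open>Covariant tensors are indexed by lists; the differentiation index comes first:
  \<open>cov_tensor \<Gamma> t (a # is) = \<nabla>\<^sub>a t\<^bsub>is\<^esub>\<close>.\<close>

definition cov_tensor ::
  "('n \<Rightarrow> 'n \<Rightarrow> 'n \<Rightarrow> real ^ 'n \<Rightarrow> real) \<Rightarrow> ('n list \<Rightarrow> real ^ 'n::finite \<Rightarrow> real) \<Rightarrow>
     'n list \<Rightarrow> real ^ 'n \<Rightarrow> real" where
  "cov_tensor \<Gamma> t js z = (let a = hd js; is = tl js in
     partial a (t is) z
     - (\<Sum>p<length is. \<Sum>m\<in>UNIV. \<Gamma> a (is ! p) m z * t (is[p := m]) z))"

definition weyl_tensor ::
  "(real ^ 'n::finite \<Rightarrow> real ^ 'n ^ 'n) \<Rightarrow> 'n list \<Rightarrow> real ^ 'n \<Rightarrow> real" where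
  "weyl_tensor g is = weyl g (is ! 0) (is ! 1) (is ! 2) (is ! 3)"

text \<open>\<open>\<BB>\<^sub>i\<^sub>j = \<nabla>\<^sup>k\<nabla>\<^sup>l W\<^sub>k\<^sub>i\<^sub>j\<^sub>l + 1/2 \<rho>\<^sup>k\<^sup>l W\<^sub>k\<^sub>i\<^sub>j\<^sub>l\<close>, with \<open>k\<close>, \<open>l\<close> raised from \<open>a\<close>, \<open>b\<close>.\<close>

definition bach ::
  "(real ^ 'n::finite \<Rightarrow> real ^ 'n ^ 'n) \<Rightarrow> 'n \<Rightarrow> 'n \<Rightarrow> real ^ 'n \<Rightarrow> real" where
  "bach g i j z = (\<Sum>k\<in>UNIV. \<Sum>l\<in>UNIV. \<Sum>a\<in>UNIV. \<Sum>b\<in>UNIV.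
     g_up g k a z * g_up g l b z *
       (cov_tensor (levi_civita g) (cov_tensor (levi_civita g) (weyl_tensor g)) [a, b, k, i, j, l] z
        + 1/2 * ricci g a b z * weyl g k i j l z))"

definition bach_flat_on ::
  "(real ^ 'n::finite) set \<Rightarrow> (real ^ 'n \<Rightarrow> real ^ 'n ^ 'n) \<Rightarrow> bool" where
  "bach_flat_on N g \<longleftrightarrow> pseudo_riemannian_on N g \<and> (\<forall>z\<in>N. \<forall>i j. bach g i j z = 0)"


section \<open>Modified Riemannian extensions\<close>

text \<open>Coordinates on the cotangent bundle are indexed by the sum type \<open>2 + 2\<close>:
  \<open>Inl i\<close> is \<open>x\<^sup>i\<close> and \<open>Inr i\<close> is \<open>y\<^sub>i\<close>.\<close>

definition base_pt :: "real ^ (2 + 2) \<Rightarrow> real ^ 2" where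
  "base_pt z = (\<chi> i. z $ Inl i)"

definition cotangent :: "(real ^ 2) set \<Rightarrow> (real ^ (2 + 2)) set" where
  "cotangent U = {z. base_pt z \<in> U}"

text \<open>\<open>T x $ r $ i\<close> is \<open>T\<^sup>r\<^sub>i\<close>.\<close>

definition mod_riem_ext ::
  "(real ^ 2 \<Rightarrow> real ^ 2 ^ 2) \<Rightarrow> (2 \<Rightarrow> 2 \<Rightarrow> 2 \<Rightarrow> real ^ 2 \<Rightarrow> real) \<Rightarrow> (real ^ 2 \<Rightarrow> real ^ 2 ^ 2) \<Rightarrow>
     real ^ (2 + 2) \<Rightarrow> real ^ (2 + 2) ^ (2 + 2)" where
  "mod_riem_ext T \<Gamma> \<Phi> z = (let x = base_pt z; y = (\<lambda>i. z $ Inr i) in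
     \<chi> a b. case (a, b) of
       (Inl i, Inl j) \<Rightarrow>
         (\<Sum>r\<in>UNIV. \<Sum>s\<in>UNIV. 1/2 * y r * y s *
            (T x $ r $ i * T x $ s $ j + T x $ r $ j * T x $ s $ i))
         - 2 * (\<Sum>k\<in>UNIV. y k * \<Gamma> i j k x) + \<Phi> x $ i $ j
     | (Inl i, Inr j) \<Rightarrow> (if i = j then 1 else 0)
     | (Inr i, Inl j) \<Rightarrow> (if i = j then 1 else 0)
     | (Inr i, Inr j) \<Rightarrow> 0)"

definition smooth_sym2_on :: "(real ^ 2) set \<Rightarrow> (real ^ 2 \<Rightarrow> real ^ 2 ^ 2) \<Rightarrow> bool" where
  "smooth_sym2_on U \<Phi> \<longleftrightarrow> (\<forall>i j. smooth_on U (\<lambda>x. \<Phi> x $ i $ j)) \<and>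
     (\<forall>x\<in>U. transpose (\<Phi> x) = \<Phi> x)"

definition nilpotent :: "real ^ 'n ^ 'n \<Rightarrow> bool" where
  "nilpotent M \<longleftrightarrow> (\<exists>k::nat. (((**) M) ^^ k) (mat 1) = 0)"


section \<open>The operators and their local solutions\<close>

text \<open>\<open>D a b f\<close> is \<open>f\<^bsup>(a,b)\<^esup>\<close>.\<close>

definition D :: "nat \<Rightarrow> nat \<Rightarrow> (real ^ 2 \<Rightarrow> real) \<Rightarrow> real ^ 2 \<Rightarrow> real" where
  "D a b f = (partial 1 ^^ a) ((partial 2 ^^ b) f)"

definition P1 :: "(2 \<Rightarrow> 2 \<Rightarrow> 2 \<Rightarrow> real ^ 2 \<Rightarrow> real) \<Rightarrow> (real ^ 2 \<Rightarrow> real) \<Rightarrow> real ^ 2 \<Rightarrow> real" where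
  "P1 \<Gamma> \<xi> x = (let X = \<xi> x; DX = (\<lambda>a b. D a b \<xi> x); G = (\<lambda>i j k. \<Gamma> i j k x) in
     - DX 1 0 + X * DX 0 1 + G 2 2 1 * X ^ 3 - (2 * G 1 2 1 - G 2 2 2) * X ^ 2
     + (G 1 1 1 - 2 * G 1 2 2) * X + G 1 1 2)"

definition P2 ::
  "(2 \<Rightarrow> 2 \<Rightarrow> 2 \<Rightarrow> real ^ 2 \<Rightarrow> real) \<Rightarrow> (real ^ 2 \<Rightarrow> real) \<Rightarrow> (real ^ 2 \<Rightarrow> real) \<Rightarrow> real ^ 2 \<Rightarrow> real" where
  "P2 \<Gamma> \<xi> \<alpha> x = (let X = \<xi> x; A = \<alpha> x; DX = (\<lambda>a b. D a b \<xi> x); DA = (\<lambda>a b. D a b \<alpha> x);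
       G = (\<lambda>i j k. \<Gamma> i j k x); DG = (\<lambda>a b i j k. D a b (\<Gamma> i j k) x) in
     A * DA 2 0 + X ^ 2 * A * DA 0 2 - 2 * X * A * DA 1 1
     + (DA 1 0) ^ 2 + X ^ 2 * (DA 0 1) ^ 2 - 2 * X * DA 1 0 * DA 0 1
     - A * DA 1 0 * (2 * DX 0 1 - 5 * G 2 2 1 * X ^ 2 + 2 * (4 * G 1 2 1 - G 2 2 2) * X
                     - 3 * G 1 1 1 + 2 * G 1 2 2)
     + A * DA 0 1 * (2 * X * DX 0 1 - 6 * G 2 2 1 * X ^ 3 + (10 * G 1 2 1 - 3 * G 2 2 2) * X ^ 2
                     - 4 * (G 1 1 1 - G 1 2 2) * X - G 1 1 2)
     + 6 * X ^ 4 * A ^ 2 * (G 2 2 1) ^ 2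
     - 2 * X ^ 3 * A ^ 2 * (DG 0 1 2 2 1 + 9 * G 1 2 1 * G 2 2 1 - 3 * G 2 2 1 * G 2 2 2)
     - X ^ 2 * A ^ 2 * (4 * G 2 2 1 * DX 0 1 - 3 * DG 0 1 1 2 1 - 2 * DG 1 0 2 2 1 + DG 0 1 2 2 2
                        - 12 * (G 1 2 1) ^ 2 - (G 2 2 2) ^ 2 - 7 * G 1 1 1 * G 2 2 1
                        + 7 * G 1 2 1 * G 2 2 2 + 9 * G 1 2 2 * G 2 2 1)
     + X * A ^ 2 * (2 * (3 * G 1 2 1 - G 2 2 2) * DX 0 1 - DG 0 1 1 1 1 - 3 * DG 1 0 1 2 1
                    + DG 0 1 1 2 2 + DG 1 0 2 2 2
                    - 2 * (G 1 1 1 - G 1 2 2) * (4 * G 1 2 1 - G 2 2 2) + 4 * G 1 1 2 * G 2 2 1)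
     - A ^ 2 * (2 * (G 1 1 1 - G 1 2 2) * DX 0 1 - DG 1 0 1 1 1 + DG 1 0 1 2 2
                - (G 1 1 1) ^ 2 + G 1 1 1 * G 1 2 2 + 3 * G 1 1 2 * G 1 2 1 - G 1 1 2 * G 2 2 2))"

text \<open>In coordinates with image \<open>S\<close>, centred at the origin: \<open>\<xi>\<close> is a real analytic solution
  on the neighbourhood \<open>U\<close> with the given initial values, defined for \<open>x\<^sup>2 \<in> I\<close>.\<close>

definition P1_solution ::
  "(real ^ 2) set \<Rightarrow> (2 \<Rightarrow> 2 \<Rightarrow> 2 \<Rightarrow> real ^ 2 \<Rightarrow> real) \<Rightarrow> real set \<Rightarrow> (real \<Rightarrow> real) \<Rightarrow>
     (real ^ 2) set \<Rightarrow> (real ^ 2 \<Rightarrow> real) \<Rightarrow> bool" where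
  "P1_solution S \<Gamma> I \<xi>0 U \<xi> \<longleftrightarrow>
     open U \<and> 0 \<in> U \<and> U \<subseteq> S \<and> real_analytic_on \<xi> U \<and> (\<forall>x\<in>U. P1 \<Gamma> \<xi> x = 0) \<and>
     (\<forall>t\<in>I. vector [0, t] \<in> U \<longrightarrow> \<xi> (vector [0, t]) = \<xi>0 t)"

definition P2_solution ::
  "(real ^ 2) set \<Rightarrow> (2 \<Rightarrow> 2 \<Rightarrow> 2 \<Rightarrow> real ^ 2 \<Rightarrow> real) \<Rightarrow> (real ^ 2 \<Rightarrow> real) \<Rightarrow> real set \<Rightarrow>
     (real \<Rightarrow> real) \<Rightarrow> (real \<Rightarrow> real) \<Rightarrow> (real ^ 2) set \<Rightarrow> (real ^ 2 \<Rightarrow> real) \<Rightarrow> bool" where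
  "P2_solution S \<Gamma> \<xi> J \<alpha>0 \<alpha>1 V \<alpha> \<longleftrightarrow>
     open V \<and> 0 \<in> V \<and> V \<subseteq> S \<and> real_analytic_on \<alpha> V \<and> (\<forall>x\<in>V. P2 \<Gamma> \<xi> \<alpha> x = 0) \<and>
     (\<forall>t\<in>J. vector [0, t] \<in> V \<longrightarrow>
        \<alpha> (vector [0, t]) = \<alpha>0 t \<and> D 1 0 \<alpha> (vector [0, t]) = \<alpha>1 t)"

definition T_of :: "(real ^ 2 \<Rightarrow> real) \<Rightarrow> (real ^ 2 \<Rightarrow> real) \<Rightarrow> real ^ 2 \<Rightarrow> real ^ 2 ^ 2" where
  "T_of \<xi> \<alpha> x = \<alpha> x *\<^sub>R vector [vector [\<xi> x, 1], vector [- (\<xi> x ^ 2), - \<xi> x]]"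

end

theory Submission
  imports Defs
begin

text \<open>The endomorphism \<open>T = \<alpha> v \<otimes> w\<close>, with \<open>v = \<partial>\<^sub>1 - \<xi> \<partial>\<^sub>2\<close> and \<open>w = \<xi> dx\<^sup>1 + dx\<^sup>2\<close>, enters
  the metric only through \<open>u = \<alpha>\<^sup>2\<close>.  The first equation says that the integral curves of \<open>v\<close> are
  unparametrized geodesics.  Then the scalar curvature and the divergence of the Ricci tensor vanish,
  so the contracted Bianchi identity expresses the divergence of the Weyl tensor by derivatives of the
  Ricci tensor.  All components of the Bach tensor vanish except \<open>\<BB>\<^sub>i\<^sub>j = -4 w\<^sub>i w\<^sub>j P2\<close> for base indices.

  The local solutions come from a Cauchy--Kovalevskaya theorem for first-order systems
  \<open>\<partial>\<^sub>1 U = F(U, \<partial>\<^sub>2 U)\<close>, proved by the method of majorants; the logarithmic derivatives of \<open>\<alpha>\<close>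
  turn the second equation into such a system.\<close>

section \<open>Partial derivatives and smooth functions\<close>

text \<open>The first equation is w(\<nabla>_v v) = 0, and it acts twice: it makes the
  fibre-dependent part of the Ricci tensor a multiple of y(v), and, dually, it makes \<nabla>_v w a
  multiple of w, so that the Bach tensor factors as w_i w_j times one scalar. That scalar is a
  second-order operator along v, linear in u. The tensor \<Phi> reaches the Bach tensor only through
  the Ricci term \<Phi>(v,v) w_i w_j, which dies against v because w(v) = 0. The obstacle is size:
  expanding second derivatives of the Weyl tensor in eight-index sums is out of reach. Once the
  divergence of Weyl is written by Ricci, whose only components are base-base, the large Christoffel
  components and the fibre block of the inverse metric meet only zeros. The majorant argument works
  on coefficients and knows sums and products only, so right-hand sides must be polynomial in the
  unknowns and their \<partial>_2-derivatives. This is the reason for logarithmic derivatives: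
  division is left only in the one-variable initial values.\<close>

lemma partial_eq:
  assumes "(f has_derivative f') (at x)"
  shows "partial i f x = f' (axis i 1)"
proof -
  have "((\<lambda>t. x + t *\<^sub>R axis i 1) has_derivative (\<lambda>t. t *\<^sub>R axis i 1)) (at (0::real))"
    by (auto intro!: derivative_eq_intros)
  from diff_chain_at[OF this, of f f'] assms
  have "((\<lambda>t. f (x + t *\<^sub>R axis i 1)) has_derivative (\<lambda>t. f' (t *\<^sub>R axis i 1))) (at 0)"
    by (simp add: o_def)
  moreover have "(\<lambda>t. f' (t *\<^sub>R axis i 1)) = (\<lambda>t. f' (axis i 1) * t)"
    using linear_scale[OF has_derivative_linear[OF assms]] by (auto simp: mult.commute)
  ultimately show ?thesis
    by (simp add: partial_def has_field_derivative_def DERIV_imp_deriv)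
qed

lemma has_field_derivative_partial:
  assumes "f differentiable (at (x + s *\<^sub>R axis i 1))"
  shows "((\<lambda>t. f (x + t *\<^sub>R axis i 1)) has_field_derivative partial i f (x + s *\<^sub>R axis i 1)) (at s)"
proof -
  obtain f' where f': "(f has_derivative f') (at (x + s *\<^sub>R axis i 1))"
    using assms by (auto simp: differentiable_def)
  have "((\<lambda>t. x + t *\<^sub>R axis i 1) has_derivative (\<lambda>t. t *\<^sub>R axis i 1)) (at s)"
    by (auto intro!: derivative_eq_intros)
  from diff_chain_at[OF this, of f f'] f'
  have "((\<lambda>t. f (x + t *\<^sub>R axis i 1)) has_derivative (\<lambda>t. f' (t *\<^sub>R axis i 1))) (at s)"
    by (simp add: o_def)
  moreover have "(\<lambda>t. f' (t *\<^sub>R axis i 1)) = (\<lambda>t. f' (axis i 1) * t)"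
    using linear_scale[OF has_derivative_linear[OF f']] by (auto simp: mult.commute)
  ultimately show ?thesis
    by (simp add: has_field_derivative_def partial_eq[OF f'])
qed

lemma partial_frechet: "f differentiable (at x) \<Longrightarrow> partial i f x = frechet_derivative f (at x) (axis i 1)"
  by (rule partial_eq) (simp add: frechet_derivative_works)

lemma partial_cong:
  assumes "open S" "x \<in> S" "\<And>y. y \<in> S \<Longrightarrow> f y = g y"
  shows "partial i f x = partial i g x"
proof -
  have "((\<lambda>t::real. x + t *\<^sub>R axis i 1) \<longlongrightarrow> x) (at 0)"
    by (auto intro!: tendsto_eq_intros)
  moreover have "((\<lambda>t::real. x + t *\<^sub>R axis i 1) \<longlongrightarrow> x) (nhds 0)"
    using calculation tendsto_at_iff_tendsto_nhds[of "\<lambda>t::real. x + t *\<^sub>R axis i 1" 0] by simp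
  ultimately have "\<forall>\<^sub>F t in nhds (0::real). x + t *\<^sub>R axis i 1 \<in> S"
    using assms(1,2) topological_tendstoD by blast
  then have "\<forall>\<^sub>F t in nhds (0::real). f (x + t *\<^sub>R axis i 1) = g (x + t *\<^sub>R axis i 1)"
    by eventually_elim (use assms(3) in auto)
  then show ?thesis
    unfolding partial_def by (intro deriv_cong_ev) auto
qed

lemma differentiable_cong:
  assumes "open S" "x \<in> S" "\<And>y. y \<in> S \<Longrightarrow> f y = g y"
  shows "f differentiable (at x) \<longleftrightarrow> g differentiable (at x)"
proof -
  have "q differentiable (at x)" if "p differentiable (at x)" "\<And>y. y \<in> S \<Longrightarrow> p y = q y" for p q :: "'a \<Rightarrow> 'b"
    using that assms(1,2) has_derivative_transform_within_open[of p _ x UNIV S q]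
    unfolding differentiable_def by blast
  from this[of f g] this[of g f] show ?thesis using assms(3) by auto
qed

lemma partial_const [simp]: "partial i (\<lambda>x. c) x = 0"
  by (simp add: partial_def)

lemma partial_add:
  "f differentiable (at x) \<Longrightarrow> g differentiable (at x) \<Longrightarrow>
     partial i (\<lambda>x. f x + g x) x = partial i f x + partial i g x"
  unfolding frechet_derivative_works
  by (subst partial_eq[OF has_derivative_add], assumption+) (simp add: partial_eq)

lemma partial_diff:
  "f differentiable (at x) \<Longrightarrow> g differentiable (at x) \<Longrightarrow>
     partial i (\<lambda>x. f x - g x) x = partial i f x - partial i g x"
  unfolding frechet_derivative_works
  by (subst partial_eq[OF has_derivative_diff], assumption+) (simp add: partial_eq)

lemma partial_minus:
  "f differentiable (at x) \<Longrightarrow> partial i (\<lambda>x. - f x) x = - partial i f x"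
  unfolding frechet_derivative_works
  by (subst partial_eq[OF has_derivative_minus], assumption+) (simp add: partial_eq)

lemma partial_mult:
  "f differentiable (at x) \<Longrightarrow> g differentiable (at x) \<Longrightarrow>
     partial i (\<lambda>x. f x * g x) x = partial i f x * g x + f x * partial i g x"
  unfolding frechet_derivative_works
  by (subst partial_eq[OF has_derivative_mult], assumption+) (simp add: partial_eq)

lemma partial_power:
  assumes "f differentiable (at x)"
  shows "partial i (\<lambda>x. f x ^ n) x = of_nat n * f x ^ (n - 1) * partial i f x"
proof (induction n)
  case (Suc n)
  have "(\<lambda>x. f x ^ n) differentiable (at x)" using assms by (rule differentiable_power)
  then have "partial i (\<lambda>x. f x * f x ^ n) x = partial i f x * f x ^ n + f x * (of_nat n * f x ^ (n - 1) * partial i f x)"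
    using Suc assms by (subst partial_mult) auto
  also have "\<dots> = of_nat (Suc n) * f x ^ n * partial i f x"
    by (cases n) (auto simp: algebra_simps)
  finally show ?case by simp
qed simp

lemma partial_sum:
  assumes "finite A" "\<And>a. a \<in> A \<Longrightarrow> f a differentiable (at x)"
  shows "partial i (\<lambda>x. \<Sum>a\<in>A. f a x) x = (\<Sum>a\<in>A. partial i (f a) x)"
  using assms
proof (induction A rule: finite_induct)
  case (insert a A)
  then have "(\<lambda>x. \<Sum>a\<in>A. f a x) differentiable (at x)" by (intro differentiable_sum) auto
  with insert show ?case by (simp add: partial_add)
qed simp

lemma partial_chain:
  fixes f :: "real ^ 'n::finite \<Rightarrow> real" and g :: "real ^ 'm::finite \<Rightarrow> real ^ 'n"
  assumes f: "f differentiable (at (g x))" and g: "\<And>j. (\<lambda>x. g x $ j) differentiable (at x)"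
  shows "(\<lambda>x. f (g x)) differentiable (at x)"
    and "partial i (\<lambda>x. f (g x)) x = (\<Sum>j\<in>UNIV. partial j f (g x) * partial i (\<lambda>x. g x $ j) x)"
proof -
  define g' where "g' = (\<lambda>h. \<chi> j. frechet_derivative (\<lambda>x. g x $ j) (at x) h)"
  have "(g has_derivative g') (at x)"
    unfolding has_derivative_componentwise_within[of g]
    using g[unfolded frechet_derivative_works] by (auto simp: Basis_vec_def inner_axis g'_def)
  moreover obtain f' where f': "(f has_derivative f') (at (g x))"
    using f by (auto simp: differentiable_def)
  ultimately have fg: "((\<lambda>x. f (g x)) has_derivative (\<lambda>h. f' (g' h))) (at x)"
    using diff_chain_at[of g g' x f f'] by (simp add: o_def)
  then show "(\<lambda>x. f (g x)) differentiable (at x)" by (auto simp: differentiable_def)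
  have lin: "linear f'" using f' by (rule has_derivative_linear)
  have "partial i (\<lambda>x. f (g x)) x = f' (g' (axis i 1))" by (rule partial_eq[OF fg])
  also have "g' (axis i 1) = (\<Sum>j\<in>UNIV. partial i (\<lambda>x. g x $ j) x *\<^sub>R axis j 1)"
    by (subst basis_expansion[symmetric]) (simp add: g'_def partial_frechet[OF g] scalar_mult_eq_scaleR)
  also have "f' \<dots> = (\<Sum>j\<in>UNIV. partial j f (g x) * partial i (\<lambda>x. g x $ j) x)"
    by (simp add: linear_sum[OF lin] linear_scale[OF lin] partial_eq[OF f'] mult.commute)
  finally show "partial i (\<lambda>x. f (g x)) x = (\<Sum>j\<in>UNIV. partial j f (g x) * partial i (\<lambda>x. g x $ j) x)" .
qed

lemma has_derivative_nth: "((\<lambda>x. x $ k) has_derivative (\<lambda>h. h $ k)) (at x)"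
  by (rule bounded_linear.has_derivative[OF bounded_linear_vec_nth has_derivative_ident])

lemma differentiable_nth: "(\<lambda>x::real^'n. x $ k) differentiable (at x)"
  using has_derivative_nth by (auto simp: differentiable_def)

lemma partial_nth: "partial i (\<lambda>x. x $ k) x = (if i = k then 1 else 0)"
  by (simp add: partial_eq[OF has_derivative_nth] axis_def)

lemma Ck_on_cong:
  assumes "open S" "\<And>x. x \<in> S \<Longrightarrow> f x = g x"
  shows "Ck_on k S f \<longleftrightarrow> Ck_on k S g"
  using assms(2)
proof (induction k arbitrary: f g)
  case 0
  then show ?case by (auto intro!: continuous_on_cong)
next
  case (Suc k)
  have "partial i f x = partial i g x" if "x \<in> S" for i x
    using partial_cong[OF assms(1) that] Suc.prems by blast
  then have "Ck_on k S (partial i f) = Ck_on k S (partial i g)" for i by (rule Suc.IH)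
  moreover have "f differentiable (at x) \<longleftrightarrow> g differentiable (at x)" if "x \<in> S" for x
    using differentiable_cong[OF assms(1) that] Suc.prems by blast
  ultimately show ?case by simp
qed

lemma Ck_on_Suc_imp: "Ck_on (Suc k) S f \<Longrightarrow> Ck_on k S f"
proof (induction k arbitrary: f)
  case 0
  then have "continuous_on S f"
    by (intro differentiable_imp_continuous_on) (auto simp: differentiable_on_def intro: differentiable_at_withinI)
  then show ?case by simp
qed auto

lemma Ck_on_const: "Ck_on k S (\<lambda>x. c)"
proof (induction k arbitrary: c)
  case (Suc k)
  have "partial i (\<lambda>x. c) = (\<lambda>x. 0)" for i :: 'a by auto
  with Suc show ?case by simp
qed simp

lemma Ck_on_add: "open S \<Longrightarrow> Ck_on k S f \<Longrightarrow> Ck_on k S g \<Longrightarrow> Ck_on k S (\<lambda>x. f x + g x)"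
proof (induction k arbitrary: f g)
  case (Suc k)
  have "Ck_on k S (partial i (\<lambda>x. f x + g x))" for i
    using Suc by (subst Ck_on_cong[where g = "\<lambda>x. partial i f x + partial i g x"]) (auto simp: partial_add)
  with Suc show ?case by auto
qed (auto intro: continuous_on_add)

lemma Ck_on_mult: "open S \<Longrightarrow> Ck_on k S f \<Longrightarrow> Ck_on k S g \<Longrightarrow> Ck_on k S (\<lambda>x. f x * g x)"
proof (induction k arbitrary: f g)
  case (Suc k)
  have "Ck_on k S (partial i (\<lambda>x. f x * g x))" for i
    using Suc Ck_on_Suc_imp[of k S]
    by (subst Ck_on_cong[where g = "\<lambda>x. partial i f x * g x + f x * partial i g x"])
       (auto simp: partial_mult intro!: Ck_on_add)
  with Suc show ?case by auto
qed (auto intro: continuous_on_mult)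

lemma smooth_on_cong:
  "open S \<Longrightarrow> (\<And>x. x \<in> S \<Longrightarrow> f x = g x) \<Longrightarrow> smooth_on S f \<longleftrightarrow> smooth_on S g"
  using Ck_on_cong unfolding smooth_on_def by blast

lemma smooth_on_differentiable: "smooth_on S f \<Longrightarrow> x \<in> S \<Longrightarrow> f differentiable (at x)"
  unfolding smooth_on_def using Ck_on.simps(2) by blast

lemma smooth_on_continuous: "smooth_on S f \<Longrightarrow> continuous_on S f"
  unfolding smooth_on_def using Ck_on.simps(1) by blast

lemma smooth_on_partial: "smooth_on S f \<Longrightarrow> smooth_on S (partial i f)"
  unfolding smooth_on_def using Ck_on.simps(2) by blast

lemma smooth_on_const: "smooth_on S (\<lambda>x. c)"
  by (simp add: smooth_on_def Ck_on_const)

lemma smooth_on_add: "open S \<Longrightarrow> smooth_on S f \<Longrightarrow> smooth_on S g \<Longrightarrow> smooth_on S (\<lambda>x. f x + g x)"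
  by (simp add: smooth_on_def Ck_on_add)

lemma smooth_on_mult: "open S \<Longrightarrow> smooth_on S f \<Longrightarrow> smooth_on S g \<Longrightarrow> smooth_on S (\<lambda>x. f x * g x)"
  by (simp add: smooth_on_def Ck_on_mult)

lemma smooth_on_minus: "open S \<Longrightarrow> smooth_on S f \<Longrightarrow> smooth_on S (\<lambda>x. - f x)"
  using smooth_on_mult[of S "\<lambda>x. -1" f] by (simp add: smooth_on_const)

lemma smooth_on_diff: "open S \<Longrightarrow> smooth_on S f \<Longrightarrow> smooth_on S g \<Longrightarrow> smooth_on S (\<lambda>x. f x - g x)"
  using smooth_on_add[of S f "\<lambda>x. - g x"] by (simp add: smooth_on_minus)

lemma smooth_on_divide: "open S \<Longrightarrow> smooth_on S f \<Longrightarrow> smooth_on S (\<lambda>x. f x / c)"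
  using smooth_on_mult[of S f "\<lambda>x. inverse c"] by (simp add: smooth_on_const divide_inverse)

lemma smooth_on_power: "open S \<Longrightarrow> smooth_on S f \<Longrightarrow> smooth_on S (\<lambda>x. f x ^ n)"
  by (induction n) (simp_all add: smooth_on_const smooth_on_mult)

lemma smooth_on_sum:
  "open S \<Longrightarrow> (\<And>a. a \<in> A \<Longrightarrow> smooth_on S (f a)) \<Longrightarrow> smooth_on S (\<lambda>x. \<Sum>a\<in>A. f a x)"
  by (induction A rule: infinite_finite_induct) (simp_all add: smooth_on_const smooth_on_add)

lemma smooth_on_nth: "smooth_on S (\<lambda>x. x $ k)"
proof -
  have "Ck_on n S (\<lambda>x. x $ k)" for n
  proof (cases n)
    case 0
    then show ?thesis by (auto intro!: continuous_intros)
  next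
    case (Suc m)
    have "partial i (\<lambda>x. x $ k) = (\<lambda>x. if i = k then 1 else 0)" for i by (auto simp: partial_nth)
    with Suc show ?thesis by (auto simp: differentiable_nth Ck_on_const)
  qed
  then show ?thesis by (simp add: smooth_on_def)
qed

text \<open>By the chain rule a partial derivative of the composite is built from
  \<open>partial j f\<close> composed with the same inner map, so the induction on the order keeps
  \<open>g\<close> fixed and varies \<open>f\<close>.\<close>

lemma smooth_on_compose:
  fixes f :: "real ^ 'n::finite \<Rightarrow> real" and g :: "real ^ 'm::finite \<Rightarrow> real ^ 'n"
  assumes "open S" "g ` S \<subseteq> T" and f: "smooth_on T f" and g: "\<And>j. smooth_on S (\<lambda>x. g x $ j)"
  shows "smooth_on S (\<lambda>x. f (g x))"
proof -
  have "Ck_on k S (\<lambda>x. f (g x))" for k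
    using f
  proof (induction k arbitrary: f)
    case 0
    have "continuous_on S g"
      using g by (subst continuous_on_vec_lambda[of S "\<lambda>j x. g x $ j", simplified vec_nth_inverse]) (auto intro: smooth_on_continuous)
    with 0 assms(2) show ?case
      using continuous_on_compose2[of T f S g] smooth_on_continuous by auto
  next
    case (Suc k)
    have fd: "f differentiable (at (g x))" if "x \<in> S" for x
      using that assms(2) Suc.prems smooth_on_differentiable by blast
    have gd: "(\<lambda>x. g x $ j) differentiable (at x)" if "x \<in> S" for x j
      using that g smooth_on_differentiable by blast
    have "Ck_on k S (partial i (\<lambda>x. f (g x)))" for i
    proof (subst Ck_on_cong[OF assms(1)])
      show "partial i (\<lambda>x. f (g x)) x = (\<Sum>j\<in>UNIV. partial j f (g x) * partial i (\<lambda>x. g x $ j) x)"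
        if "x \<in> S" for x
        by (rule partial_chain(2)[OF fd[OF that] gd[OF that]])
      have tm: "Ck_on k S (\<lambda>x. partial j f (g x) * partial i (\<lambda>x. g x $ j) x)" for j
        using Suc.IH[OF smooth_on_partial[OF Suc.prems]] smooth_on_partial[OF g]
        by (intro Ck_on_mult assms(1)) (auto simp: smooth_on_def)
      have "Ck_on k S (\<lambda>x. \<Sum>j\<in>A. partial j f (g x) * partial i (\<lambda>x. g x $ j) x)" if "finite A" for A
        using that by (induction A rule: finite_induct) (auto intro: Ck_on_add[OF assms(1)] tm simp: Ck_on_const)
      then show "Ck_on k S (\<lambda>x. \<Sum>j\<in>UNIV. partial j f (g x) * partial i (\<lambda>x. g x $ j) x)" by simp
    qed
    then show ?case using partial_chain(1)[OF fd gd] by simp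
  qed
  then show ?thesis by (simp add: smooth_on_def)
qed

text \<open>Both mixed derivatives arise as limits of the same second difference quotient.\<close>

lemma second_difference:
  fixes f :: "real ^ 'n::finite \<Rightarrow> real"
  assumes sub: "ball x (3 * h) \<subseteq> S" and f: "smooth_on S f" and h: "h > 0"
  obtains p where "dist p x < 3 * h"
    "f (x + h *\<^sub>R axis i 1 + h *\<^sub>R axis j 1) - f (x + h *\<^sub>R axis i 1) - f (x + h *\<^sub>R axis j 1) + f x
       = h\<^sup>2 * partial j (partial i f) p"
proof -
  have inS: "x + s *\<^sub>R axis i 1 + t *\<^sub>R axis j 1 \<in> S" if "0 \<le> s" "s \<le> h" "0 \<le> t" "t \<le> h" for s t
  proof -
    have "norm (s *\<^sub>R axis i 1 + t *\<^sub>R axis j 1 :: real ^ 'n) \<le> s + t"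
      using that by (intro order.trans[OF norm_triangle_ineq]) simp
    moreover have "dist x (x + s *\<^sub>R axis i 1 + t *\<^sub>R axis j 1) = norm (s *\<^sub>R axis i 1 + t *\<^sub>R axis j 1 :: real ^ 'n)"
      by (subst dist_commute) (simp add: dist_norm add.assoc)
    ultimately show ?thesis using that h by (intro subsetD[OF sub]) simp
  qed
  \<comment> \<open>The second difference is a first difference of the increment \<open>F\<close>;
    the mean value theorem in direction \<open>i\<close>, then in direction \<open>j\<close>, turns
    it into a mixed derivative.\<close>
  define F where "F = (\<lambda>s. f (x + h *\<^sub>R axis j 1 + s *\<^sub>R axis i 1) - f (x + s *\<^sub>R axis i 1))"
  have F': "(F has_real_derivative (partial i f (x + h *\<^sub>R axis j 1 + s *\<^sub>R axis i 1) - partial i f (x + s *\<^sub>R axis i 1))) (at s)"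
    if "0 \<le> s" "s \<le> h" for s
    unfolding F_def using inS[of s h] inS[of s 0] that h
    by (intro DERIV_diff has_field_derivative_partial smooth_on_differentiable[OF f]) (auto simp: add_ac)
  obtain s where s: "0 < s" "s < h" "F h - F 0 = h * (partial i f (x + h *\<^sub>R axis j 1 + s *\<^sub>R axis i 1) - partial i f (x + s *\<^sub>R axis i 1))"
    using MVT2[OF h, of F "\<lambda>s. partial i f (x + h *\<^sub>R axis j 1 + s *\<^sub>R axis i 1) - partial i f (x + s *\<^sub>R axis i 1)"] F' by auto
  have "((\<lambda>t. partial i f ((x + s *\<^sub>R axis i 1) + t *\<^sub>R axis j 1)) has_real_derivative
      partial j (partial i f) ((x + s *\<^sub>R axis i 1) + t *\<^sub>R axis j 1)) (at t)" if "0 \<le> t" "t \<le> h" for t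
    using inS[of s t] that s
    by (intro has_field_derivative_partial smooth_on_differentiable[OF smooth_on_partial[OF f]]) auto
  from MVT2[OF h this] obtain t where t: "0 < t" "t < h" "partial i f ((x + s *\<^sub>R axis i 1) + h *\<^sub>R axis j 1) - partial i f (x + s *\<^sub>R axis i 1)
      = h * partial j (partial i f) ((x + s *\<^sub>R axis i 1) + t *\<^sub>R axis j 1)" by auto
  show ?thesis
  proof (rule that)
    have "norm (s *\<^sub>R axis i 1 + t *\<^sub>R axis j 1 :: real ^ 'n) \<le> s + t"
      using s t by (intro order.trans[OF norm_triangle_ineq]) simp
    then show "dist ((x + s *\<^sub>R axis i 1) + t *\<^sub>R axis j 1) x < 3 * h"
      using s t by (simp add: dist_norm add.assoc)
    show "f (x + h *\<^sub>R axis i 1 + h *\<^sub>R axis j 1) - f (x + h *\<^sub>R axis i 1) - f (x + h *\<^sub>R axis j 1) + f x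
       = h\<^sup>2 * partial j (partial i f) ((x + s *\<^sub>R axis i 1) + t *\<^sub>R axis j 1)"
      using s(3) t(3) by (simp add: F_def power2_eq_square algebra_simps)
  qed
qed

lemma partial_commute:
  fixes f :: "real ^ 'n::finite \<Rightarrow> real"
  assumes S: "open S" "x \<in> S" and f: "smooth_on S f"
  shows "partial i (partial j f) x = partial j (partial i f) x"
proof -
  obtain r where r: "r > 0" "ball x r \<subseteq> S" using S by (auto simp: open_contains_ball)
  \<comment> \<open>The division by 3 keeps the ball of radius \<open>3 * h n\<close>, where the
    intermediate points live, inside the ball of radius \<open>r\<close>.\<close>
  define h where "h = (\<lambda>n::nat. r / 3 / (real n + 1))"
  have h: "h n > 0" "ball x (3 * h n) \<subseteq> S" for n
  proof -
    show "h n > 0" using r by (simp add: h_def)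
    have "3 * h n \<le> r" using r by (simp add: h_def field_simps)
    then show "ball x (3 * h n) \<subseteq> S" using r by force
  qed
  have "\<exists>p q. dist p x < 3 * h n \<and> dist q x < 3 * h n \<and>
      partial j (partial i f) p = partial i (partial j f) q" for n
  proof -
    obtain p where p: "dist p x < 3 * h n" "f (x + h n *\<^sub>R axis i 1 + h n *\<^sub>R axis j 1) - f (x + h n *\<^sub>R axis i 1) - f (x + h n *\<^sub>R axis j 1) + f x
       = (h n)\<^sup>2 * partial j (partial i f) p"
      using second_difference[OF h(2) f h(1)] by metis
    obtain q where q: "dist q x < 3 * h n" "f (x + h n *\<^sub>R axis j 1 + h n *\<^sub>R axis i 1) - f (x + h n *\<^sub>R axis j 1) - f (x + h n *\<^sub>R axis i 1) + f x
       = (h n)\<^sup>2 * partial i (partial j f) q"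
      using second_difference[OF h(2) f h(1)] by metis
    have "(h n)\<^sup>2 * partial j (partial i f) p = (h n)\<^sup>2 * partial i (partial j f) q"
      using p(2) q(2) by (simp add: algebra_simps)
    then show ?thesis using p q h(1)[of n] by auto
  qed
  then obtain p q where pq: "\<And>n. dist (p n) x < 3 * h n" "\<And>n. dist (q n) x < 3 * h n"
    "\<And>n. partial j (partial i f) (p n) = partial i (partial j f) (q n)" by metis
  have h0: "(\<lambda>n. 3 * h n) \<longlonglongrightarrow> 0"
  proof -
    have "(\<lambda>n. r * inverse (real (Suc n))) \<longlonglongrightarrow> r * 0"
      by (intro tendsto_mult_left LIMSEQ_inverse_real_of_nat)
    moreover have "(\<lambda>n. 3 * h n) = (\<lambda>n. r * inverse (real (Suc n)))"
      by (auto simp: h_def field_simps)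
    ultimately show ?thesis by simp
  qed
  have lim: "s \<longlonglongrightarrow> x" if "\<And>n. dist (s n) x < 3 * h n" for s
    by (rule metric_tendsto_imp_tendsto[OF h0, of s x]) (use that h(1) in \<open>auto intro!: always_eventually less_imp_le simp: less_imp_le\<close>)
  have "p \<longlonglongrightarrow> x" "q \<longlonglongrightarrow> x"
    using pq(1,2) by (auto intro: lim)
  moreover have "isCont (partial j (partial i f)) x" "isCont (partial i (partial j f)) x"
    using f S by (auto intro!: smooth_on_continuous smooth_on_partial simp: continuous_on_eq_continuous_at[symmetric] continuous_on_interior interior_open
      intro: continuous_on_interior)
  ultimately have "(\<lambda>n. partial j (partial i f) (p n)) \<longlonglongrightarrow> partial j (partial i f) x"
      "(\<lambda>n. partial i (partial j f) (q n)) \<longlonglongrightarrow> partial i (partial j f) x"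
    by (auto intro: isCont_tendsto_compose)
  then show ?thesis using LIMSEQ_unique by (auto simp: pq(3))
qed

section \<open>Real analytic functions of two variables\<close>

text \<open>A formal power series in two variables is an element \<open>F\<close> of \<open>real fps fps\<close>; the outer variable
  is \<open>x\<^sup>1\<close>, so \<open>F $ m $ n\<close> is the coefficient of \<open>(x\<^sup>1)\<^sup>m (x\<^sup>2)\<^sup>n\<close>.\<close>

definition fps2_term :: "real fps fps \<Rightarrow> real \<Rightarrow> real \<Rightarrow> nat \<times> nat \<Rightarrow> real" where
  "fps2_term F s t = (\<lambda>(m, n). fps_nth (fps_nth F m) n * s ^ m * t ^ n)"

text \<open>Coefficient form of convergence on a polydisc of radius \<open>1 / r\<close>. It turns
  the analytic work into inequalities between coefficients.\<close>

definition geo_bound :: "real \<Rightarrow> real \<Rightarrow> real fps fps \<Rightarrow> bool" where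
  "geo_bound M r F \<longleftrightarrow> 0 \<le> M \<and> 0 < r \<and> (\<forall>m n. \<bar>fps_nth (fps_nth F m) n\<bar> \<le> M * r ^ (m + n))"

definition has_fps2 :: "(real ^ 2 \<Rightarrow> real) \<Rightarrow> real ^ 2 \<Rightarrow> real fps fps \<Rightarrow> bool" where
  "has_fps2 f a F \<longleftrightarrow> (\<forall>\<^sub>F x in nhds a. (fps2_term F (x $ 1 - a $ 1) (x $ 2 - a $ 2) has_sum f x) UNIV)"

lemma fps2_eqI: "(\<And>m n. fps_nth (fps_nth F m) n = fps_nth (fps_nth G m) n) \<Longrightarrow> F = G"
  by (intro fps_ext)

lemma Basis_real2: "(Basis :: (real ^ 2) set) = {axis 1 1, axis 2 1}"
  by (auto simp: Basis_vec_def UNIV_2)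

lemma axis_12: "axis 1 1 \<noteq> (axis 2 1 :: real ^ 2)"
  by (simp add: axis_eq_axis)

text \<open>Multi-indices on the two basis vectors are extensional functions; the bijection
  \<open>h\<close> identifies them with pairs of exponents and carries one unconditional sum to the
  other.\<close>

lemma real_analytic_at_iff: "real_analytic_at f a \<longleftrightarrow> (\<exists>F. has_fps2 f a F)" for f :: "real ^ 2 \<Rightarrow> real"
proof -
  let ?B = "Basis :: (real ^ 2) set" and ?e1 = "axis 1 1 :: real ^ 2" and ?e2 = "axis 2 1 :: real ^ 2"
  define h :: "nat \<times> nat \<Rightarrow> real ^ 2 \<Rightarrow> nat" where
    "h = (\<lambda>(m, n). restrict (\<lambda>b. if b = ?e1 then m else n) ?B)"
  have h: "bij_betw h UNIV (?B \<rightarrow>\<^sub>E UNIV)"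
    by (rule bij_betw_byWitness[where f' = "\<lambda>\<mu>. (\<mu> ?e1, \<mu> ?e2)"])
       (auto simp: h_def Basis_real2 axis_12 axis_12[symmetric] PiE_def extensional_def fun_eq_iff restrict_def)
  have t: "(\<Prod>b\<in>?B. ((x - a) \<bullet> b) ^ h p b) = (x $ 1 - a $ 1) ^ fst p * (x $ 2 - a $ 2) ^ snd p" for x p
    by (cases p) (simp add: h_def Basis_real2 axis_12 axis_12[symmetric] inner_axis)
  have *: "((\<lambda>m. (\<Prod>b\<in>?B. ((x - a) \<bullet> b) ^ m b) *\<^sub>R c m) has_sum f x) (?B \<rightarrow>\<^sub>E UNIV) \<longleftrightarrow>
      ((\<lambda>p. (x $ 1 - a $ 1) ^ fst p * (x $ 2 - a $ 2) ^ snd p * c (h p)) has_sum f x) UNIV" for x c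
    unfolding has_sum_reindex_bij_betw[OF h, symmetric] by (simp add: t)
  show ?thesis
  proof
    assume "real_analytic_at f a"
    then obtain r c where r: "r > 0" and c: "\<And>x. x \<in> ball a r \<Longrightarrow>
        ((\<lambda>m. (\<Prod>b\<in>?B. ((x - a) \<bullet> b) ^ m b) *\<^sub>R c m) has_sum f x) (?B \<rightarrow>\<^sub>E UNIV)"
      unfolding real_analytic_at_def by blast
    have "has_fps2 f a (Abs_fps (\<lambda>m. Abs_fps (\<lambda>n. c (h (m, n)))))"
      unfolding has_fps2_def
    proof (rule eventually_mono[OF eventually_nhds_ball[OF r, of a]])
      fix x assume "x \<in> ball a r"
      from c[OF this, unfolded *]
      show "(fps2_term (Abs_fps (\<lambda>m. Abs_fps (\<lambda>n. c (h (m, n))))) (x $ 1 - a $ 1) (x $ 2 - a $ 2) has_sum f x) UNIV"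
        by (simp add: fps2_term_def case_prod_unfold mult_ac)
    qed
    then show "\<exists>F. has_fps2 f a F" by blast
  next
    assume "\<exists>F. has_fps2 f a F"
    then obtain F where "has_fps2 f a F" by blast
    then obtain r where r: "r > 0" and F: "\<And>x. x \<in> ball a r \<Longrightarrow>
        (fps2_term F (x $ 1 - a $ 1) (x $ 2 - a $ 2) has_sum f x) UNIV"
      by (auto simp: has_fps2_def eventually_nhds_metric dist_commute)
    define c where "c = (\<lambda>\<mu> :: real ^ 2 \<Rightarrow> nat. fps_nth (fps_nth F (\<mu> ?e1)) (\<mu> ?e2))"
    have ch: "c (h p) = fps_nth (fps_nth F (fst p)) (snd p)" for p
      by (cases p) (simp add: c_def h_def Basis_real2 axis_12[symmetric])
    show "real_analytic_at f a"
      unfolding real_analytic_at_def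
      by (intro exI[of _ r] conjI exI[of _ c] ballI r, subst *, drule F)
         (simp add: ch fps2_term_def case_prod_unfold mult_ac)
  qed
qed

subsection \<open>Convergence\<close>

lemma summable_geometric2:
  fixes x y :: real
  assumes "0 \<le> x" "x < 1" "0 \<le> y" "y < 1"
  shows "((\<lambda>(m, n). x ^ m * y ^ n) has_sum (1 / (1 - x) * (1 / (1 - y)))) (UNIV :: (nat \<times> nat) set)"
proof -
  have 1: "((\<lambda>n. c ^ n) has_sum (1 / (1 - c))) UNIV" if "0 \<le> c" "c < 1" for c :: real
    using that by (intro sums_nonneg_imp_has_sum geometric_sums) auto
  note X = 1[OF assms(1,2)] and Y = 1[OF assms(3,4)]
  have Y': "((\<lambda>n. x ^ m * y ^ n) has_sum (x ^ m * (1 / (1 - y)))) UNIV" for m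
    by (rule has_sum_cmult_right[OF Y])
  have X': "((\<lambda>m. x ^ m * (1 / (1 - y))) has_sum (1 / (1 - x) * (1 / (1 - y)))) UNIV"
    by (rule has_sum_cmult_left[OF X])
  have "(\<lambda>(m, n). x ^ m * y ^ n) summable_on (UNIV \<times> UNIV)"
    by (rule summable_on_SigmaI[where g = "\<lambda>m. x ^ m * (1 / (1 - y))"])
       (use Y' X' assms in \<open>auto simp: summable_on_def\<close>)
  then have "((\<lambda>(m, n). x ^ m * y ^ n) has_sum (1 / (1 - x) * (1 / (1 - y)))) (UNIV \<times> UNIV)"
    using Y' X' by (intro has_sum_SigmaI[where g = "\<lambda>m. x ^ m * (1 / (1 - y))"]) auto
  then show ?thesis by simp
qed

lemma geo_bound_abs_summable:
  assumes F: "geo_bound M r F" and "r * \<bar>s\<bar> < 1" "r * \<bar>t\<bar> < 1"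
  shows "(\<lambda>p. \<bar>fps2_term F s t p\<bar>) summable_on UNIV"
proof -
  have r: "r > 0" using F by (simp add: geo_bound_def)
  have "(\<lambda>p. M * (case p of (m, n) \<Rightarrow> (r * \<bar>s\<bar>) ^ m * (r * \<bar>t\<bar>) ^ n)) summable_on UNIV"
    using has_sum_cmult_right[OF summable_geometric2[of "r * \<bar>s\<bar>" "r * \<bar>t\<bar>"], of M] assms r
    by (auto simp: summable_on_def)
  then have "(\<lambda>p. norm (fps2_term F s t p)) summable_on UNIV"
  proof (rule Infinite_Sum.abs_summable_on_comparison_test')
    fix p :: "nat \<times> nat" assume "p \<in> UNIV"
    obtain m n where p: "p = (m, n)" by force
    have "\<bar>fps_nth (fps_nth F m) n\<bar> * (\<bar>s\<bar> ^ m * \<bar>t\<bar> ^ n) \<le> M * r ^ (m + n) * (\<bar>s\<bar> ^ m * \<bar>t\<bar> ^ n)"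
      using F by (intro mult_right_mono) (auto simp: geo_bound_def)
    then show "norm (fps2_term F s t p) \<le> M * (case p of (m, n) \<Rightarrow> (r * \<bar>s\<bar>) ^ m * (r * \<bar>t\<bar>) ^ n)"
      by (simp add: p fps2_term_def abs_mult power_abs power_mult_distrib power_add mult_ac)
  qed
  then show ?thesis by simp
qed

lemma geo_bound_summable:
  assumes "geo_bound M r F" "r * \<bar>s\<bar> < 1" "r * \<bar>t\<bar> < 1"
  shows "fps2_term F s t summable_on UNIV"
  using geo_bound_abs_summable[OF assms] abs_summable_summable[of "fps2_term F s t" UNIV] by simp

text \<open>Unconditional convergence of a real series is absolute. At a diagonal point off the
  centre the sum of absolute values bounds every single term, which bounds the coefficients
  geometrically.\<close>

lemma has_fps2_geo_bound:
  assumes "has_fps2 f a F"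
  obtains M r where "geo_bound M r F"
proof -
  obtain d where d: "d > 0" and F: "\<And>x. x \<in> ball a d \<Longrightarrow>
        (fps2_term F (x $ 1 - a $ 1) (x $ 2 - a $ 2) has_sum f x) UNIV"
    using assms by (auto simp: has_fps2_def eventually_nhds_metric dist_commute)
  \<comment> \<open>The point at offset (e, e) has l1-distance 2e from \<open>a\<close>, below
    \<open>d\<close>.\<close>
  define e where "e = d / 3"
  define x where "x = a + (\<chi> i. e)"
  have e: "e > 0" using d by (simp add: e_def)
  have "norm ((\<chi> i. e) :: real ^ 2) \<le> (\<Sum>i\<in>UNIV. \<bar>((\<chi> i. e) :: real ^ 2) $ i\<bar>)" by (rule norm_le_l1_cart)
  then have "x \<in> ball a d" using e d by (simp add: x_def dist_norm sum_2 e_def)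
  then have "fps2_term F e e summable_on UNIV"
    using F[of x] by (auto simp: x_def summable_on_def)
  then have s: "(\<lambda>p. \<bar>fps2_term F e e p\<bar>) summable_on UNIV"
    using summable_on_iff_abs_summable_on_real by fastforce
  define M where "M = infsum (\<lambda>p. \<bar>fps2_term F e e p\<bar>) UNIV"
  have M: "\<bar>fps2_term F e e p\<bar> \<le> M" for p
    using finite_sum_le_infsum[OF s, of "{p}"] by (simp add: M_def)
  have "geo_bound M (1 / e) F"
    unfolding geo_bound_def
  proof (intro conjI allI)
    show "0 \<le> M" using M[of undefined] by linarith
    show "0 < 1 / e" using e by simp
    fix m n
    have "\<bar>fps_nth (fps_nth F m) n\<bar> * e ^ (m + n) \<le> M"
      using M[of "(m, n)"] e by (simp add: fps2_term_def abs_mult power_add mult_ac)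
    then show "\<bar>fps_nth (fps_nth F m) n\<bar> \<le> M * (1 / e) ^ (m + n)"
      using e by (simp add: field_simps power_divide)
  qed
  then show ?thesis by (rule that)
qed

lemma eventually_small:
  assumes "d > (0::real)"
  shows "\<forall>\<^sub>F x in nhds (a :: real ^ 2). \<bar>x $ 1 - a $ 1\<bar> < d \<and> \<bar>x $ 2 - a $ 2\<bar> < d"
proof (rule eventually_mono[OF eventually_nhds_ball[OF assms, of a]])
  fix x assume "x \<in> ball a d"
  then show "\<bar>x $ 1 - a $ 1\<bar> < d \<and> \<bar>x $ 2 - a $ 2\<bar> < d"
    using component_le_norm_cart[of "x - a" 1] component_le_norm_cart[of "x - a" 2]
    by (auto simp: dist_norm norm_minus_commute)
qed

lemma geo_bound_has_fps2:
  assumes "geo_bound M r F"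
  shows "has_fps2 (\<lambda>x. infsum (fps2_term F (x $ 1 - a $ 1) (x $ 2 - a $ 2)) UNIV) a F"
  unfolding has_fps2_def
proof (rule eventually_mono[OF eventually_small[of "1 / r" a]])
  show r: "1 / r > 0" using assms by (simp add: geo_bound_def)
  fix x :: "real ^ 2" assume "\<bar>x $ 1 - a $ 1\<bar> < 1 / r \<and> \<bar>x $ 2 - a $ 2\<bar> < 1 / r"
  then show "(fps2_term F (x $ 1 - a $ 1) (x $ 2 - a $ 2) has_sum
      infsum (fps2_term F (x $ 1 - a $ 1) (x $ 2 - a $ 2)) UNIV) UNIV"
    using r by (intro has_sum_infsum geo_bound_summable[OF assms]) (auto simp: field_simps)
qed

lemma has_fps2_cong:
  assumes "has_fps2 f a F" "\<forall>\<^sub>F x in nhds a. f x = g x"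
  shows "has_fps2 g a F"
  using assms unfolding has_fps2_def by eventually_elim simp

subsection \<open>Re-expansion around a nearby point\<close>

definition fps2_shift :: "real \<Rightarrow> real \<Rightarrow> real fps fps \<Rightarrow> real fps fps" where
  "fps2_shift s t F = Abs_fps (\<lambda>i. Abs_fps (\<lambda>j. infsum (\<lambda>(m, n).
     fps_nth (fps_nth F (m + i)) (n + j) * real ((m + i) choose i) * real ((n + j) choose j) * s ^ m * t ^ n) UNIV))"

text \<open>Both powers are expanded by the binomial theorem. The resulting fourfold family is
  absolutely summable, since its absolute values regroup to the series at (|s| + |h|, |t| + |k|), so
  it may be summed by the powers of \<open>h\<close> and \<open>k\<close> instead.\<close>

lemma fps2_shift_has_sum:
  assumes F: "geo_bound M r F" and s: "r * (\<bar>s\<bar> + \<bar>h\<bar>) < 1" and t: "r * (\<bar>t\<bar> + \<bar>k\<bar>) < 1"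
    and y: "(fps2_term F (s + h) (t + k) has_sum y) UNIV"
  shows "(fps2_term (fps2_shift s t F) h k has_sum y) UNIV"
    and "(\<lambda>(m, n). fps_nth (fps_nth F (m + i)) (n + j) * real ((m + i) choose i) * real ((n + j) choose j)
          * s ^ m * t ^ n * h ^ i * k ^ j) summable_on UNIV"
proof -
  define T where "T = Sigma (UNIV :: (nat \<times> nat) set) (\<lambda>(m, n). {..m} \<times> {..n})"
  define \<phi> where "\<phi> = (\<lambda>((m, n), (i, j)). fps_nth (fps_nth F m) n * real (m choose i) * real (n choose j)
      * s ^ (m - i) * t ^ (n - j) * h ^ i * k ^ j)"
  have inner: "(\<Sum>(i, j)\<in>{..m} \<times> {..n}. c * real (m choose i) * real (n choose j)
      * s ^ (m - i) * t ^ (n - j) * h ^ i * k ^ j) = c * (s + h) ^ m * (t + k) ^ n" for m n and c s t h k :: real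
  proof -
    have "(h + s) ^ m * (k + t) ^ n = (\<Sum>i\<le>m. \<Sum>j\<le>n. (real (m choose i) * h ^ i * s ^ (m - i)) * (real (n choose j) * k ^ j * t ^ (n - j)))"
      unfolding binomial_ring by (rule sum_product)
    then have "c * ((h + s) ^ m * (k + t) ^ n) = (\<Sum>i\<le>m. \<Sum>j\<le>n. c * real (m choose i) * real (n choose j)
      * s ^ (m - i) * t ^ (n - j) * h ^ i * k ^ j)"
      by (simp add: sum_distrib_left mult_ac)
    then show ?thesis by (simp add: sum.cartesian_product add.commute mult.assoc)
  qed
  have "(\<lambda>q. norm (\<phi> q)) summable_on T"
    unfolding T_def
  proof (rule summable_on_SigmaI)
    show "((\<lambda>y. norm (\<phi> (x, y))) has_sum (\<bar>fps2_term F (\<bar>s\<bar> + \<bar>h\<bar>) (\<bar>t\<bar> + \<bar>k\<bar>) x\<bar>)) (case x of (m, n) \<Rightarrow> {..m} \<times> {..n})" for x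
    proof -
      obtain m n where x: "x = (m, n)" by force
      have "(\<Sum>y\<in>{..m} \<times> {..n}. norm (\<phi> (x, y))) = (\<Sum>(i, j)\<in>{..m} \<times> {..n}. \<bar>fps_nth (fps_nth F m) n\<bar> * real (m choose i) * real (n choose j)
      * \<bar>s\<bar> ^ (m - i) * \<bar>t\<bar> ^ (n - j) * \<bar>h\<bar> ^ i * \<bar>k\<bar> ^ j)"
        by (intro sum.cong) (auto simp: \<phi>_def x abs_mult power_abs)
      also have "\<dots> = \<bar>fps2_term F (\<bar>s\<bar> + \<bar>h\<bar>) (\<bar>t\<bar> + \<bar>k\<bar>) x\<bar>"
        unfolding inner by (simp add: fps2_term_def x abs_mult)
      finally show ?thesis by (simp add: x has_sum_finite_iff)
    qed
    show "(\<lambda>x. \<bar>fps2_term F (\<bar>s\<bar> + \<bar>h\<bar>) (\<bar>t\<bar> + \<bar>k\<bar>) x\<bar>) summable_on UNIV"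
      using s t by (intro geo_bound_abs_summable[OF F]) auto
  qed simp
  then have sT: "\<phi> summable_on T" by (rule abs_summable_summable)
  have "((\<lambda>x. \<Sum>y\<in>(case x of (m, n) \<Rightarrow> {..m} \<times> {..n}). \<phi> (x, y)) has_sum infsum \<phi> T) UNIV"
    using has_sum_infsum[OF sT] unfolding T_def
    by (rule has_sum_SigmaD) (auto simp: has_sum_finite_iff split: prod.splits)
  moreover have "(\<lambda>x. \<Sum>y\<in>(case x of (m, n) \<Rightarrow> {..m} \<times> {..n}). \<phi> (x, y)) = fps2_term F (s + h) (t + k)"
    using inner by (auto simp: fun_eq_iff fps2_term_def \<phi>_def case_prod_unfold)
  ultimately have "infsum \<phi> T = y" using y has_sum_unique by metis
  then have hT: "(\<phi> has_sum y) T" using has_sum_infsum[OF sT] by simp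
  define \<psi> where "\<psi> = (\<lambda>((i, j), (m, n)). fps_nth (fps_nth F (m + i)) (n + j) * real ((m + i) choose i) * real ((n + j) choose j)
      * s ^ m * t ^ n * h ^ i * k ^ j)"
  \<comment> \<open>The pair of total exponents becomes the pair of remainders m - i and n - j,
    which turns the triangular index set into a full product.\<close>
  have hU: "(\<psi> has_sum y) (UNIV \<times> UNIV)"
    by (subst has_sum_reindex_bij_witness[where j = "\<lambda>((i, j), (m, n)). ((m + i, n + j), (i, j))"
          and i = "\<lambda>((m, n), (i, j)). ((i, j), (m - i, n - j))" and T = T and h = \<phi> and s' = y])
       (use hT in \<open>auto simp: T_def \<phi>_def \<psi>_def\<close>)
  have sU: "(\<lambda>p. \<psi> (q, p)) summable_on UNIV" for q
    using summable_on_SigmaD1[of "\<lambda>a b. \<psi> (a, b)" UNIV "\<lambda>_. UNIV" q] hU by (auto simp: summable_on_def case_prod_eta)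
  then show "(\<lambda>(m, n). fps_nth (fps_nth F (m + i)) (n + j) * real ((m + i) choose i) * real ((n + j) choose j)
          * s ^ m * t ^ n * h ^ i * k ^ j) summable_on UNIV" for i j
    using sU[of "(i, j)"] by (simp add: \<psi>_def case_prod_unfold)
  have "((\<lambda>q. infsum (\<lambda>p. \<psi> (q, p)) UNIV) has_sum y) UNIV"
    using hU by (rule has_sum_SigmaD) (use sU in \<open>auto intro: has_sum_infsum\<close>)
  moreover have "(\<lambda>q. infsum (\<lambda>p. \<psi> (q, p)) UNIV) = fps2_term (fps2_shift s t F) h k"
  proof (rule ext)
    fix q :: "nat \<times> nat"
    obtain i j where q: "q = (i, j)" by force
    have "infsum (\<lambda>p. \<psi> (q, p)) UNIV = infsum (\<lambda>p. (case p of (m, n) \<Rightarrow> fps_nth (fps_nth F (m + i)) (n + j) *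
        real ((m + i) choose i) * real ((n + j) choose j) * s ^ m * t ^ n) * (h ^ i * k ^ j)) UNIV"
      by (rule infsum_cong) (auto simp: \<psi>_def q mult_ac)
    also have "\<dots> = fps2_term (fps2_shift s t F) h k q"
      unfolding infsum_cmult_left' by (simp add: fps2_term_def fps2_shift_def q mult_ac)
    finally show "infsum (\<lambda>p. \<psi> (q, p)) UNIV = fps2_term (fps2_shift s t F) h k q" .
  qed
  ultimately show "(fps2_term (fps2_shift s t F) h k has_sum y) UNIV" by simp
qed

text \<open>Displacements of the new centre and of the argument below 1/(4r) keep the sum of their
  absolute values below 1/(2r), well inside the bound needed for rearranging.\<close>

lemma has_fps2_shift:
  assumes f: "has_fps2 f a F"
  shows "\<forall>\<^sub>F b in nhds a. has_fps2 f b (fps2_shift (b $ 1 - a $ 1) (b $ 2 - a $ 2) F)"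
proof -
  obtain M r where F: "geo_bound M r F" using has_fps2_geo_bound[OF f] .
  have r: "r > 0" using F by (simp add: geo_bound_def)
  obtain d where d: "d > 0" and S: "\<And>x. dist x a < d \<Longrightarrow>
        (fps2_term F (x $ 1 - a $ 1) (x $ 2 - a $ 2) has_sum f x) UNIV"
    using f by (auto simp: has_fps2_def eventually_nhds_metric)
  have r4: "1 / (4 * r) > 0" using r by simp
  have "\<forall>\<^sub>F b in nhds a. dist b a < d / 2" using d by (auto simp: eventually_nhds_metric intro!: exI[of _ "d / 2"])
  then show ?thesis
    using eventually_small[OF r4, of a]
  proof eventually_elim
    case (elim b)
    have "\<forall>\<^sub>F x in nhds b. dist x b < d / 2" using d by (auto simp: eventually_nhds_metric intro!: exI[of _ "d / 2"])
    then show ?case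
      unfolding has_fps2_def using eventually_small[OF r4, of b]
    proof eventually_elim
      case x: (elim x)
      have "dist x a < d" using x elim dist_triangle[of x a b] by linarith
      from S[OF this] show ?case
        using x elim r by (intro fps2_shift_has_sum(1)[OF F, of _ _ _ _ "f x"]) (auto simp: field_simps)
    qed
  qed
qed

text \<open>After removing the terms of degree at most one, the rest is dominated by a geometric
  double series times the square of the distance.\<close>

lemma has_fps2_has_derivative:
  assumes f: "has_fps2 f b G"
  shows "f b = fps_nth (fps_nth G 0) 0"
    and "(f has_derivative (\<lambda>h. fps_nth (fps_nth G 1) 0 * h $ 1 + fps_nth (fps_nth G 0) 1 * h $ 2)) (at b)"
proof -
  obtain M r where G: "geo_bound M r G" using has_fps2_geo_bound[OF f] .
  have r: "r > 0" and M: "M \<ge> 0" using G by (auto simp: geo_bound_def)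
  obtain d where d: "d > 0" and S: "\<And>x. dist x b < d \<Longrightarrow>
        (fps2_term G (x $ 1 - b $ 1) (x $ 2 - b $ 2) has_sum f x) UNIV"
    using f by (auto simp: has_fps2_def eventually_nhds_metric)
  let ?D = "\<lambda>h :: real ^ 2. fps_nth (fps_nth G 1) 0 * h $ 1 + fps_nth (fps_nth G 0) 1 * h $ 2"
  have "(fps2_term G 0 0 has_sum f b) UNIV" using S[of b] d by simp
  moreover have "(fps2_term G 0 0 has_sum fps_nth (fps_nth G 0) 0) UNIV"
    by (rule has_sum_finite_neutralI[of "{(0, 0)}"]) (auto simp: fps2_term_def)
  ultimately show fb: "f b = fps_nth (fps_nth G 0) 0" using has_sum_unique by blast
  have bound: "\<bar>f y - f b - ?D (y - b)\<bar> \<le> 16 * M * r\<^sup>2 * norm (y - b) ^ 2"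
    if y: "dist y b < d" "dist y b < 1 / (2 * r)" for y
  proof -
    define h k e where "h = y $ 1 - b $ 1" and "k = y $ 2 - b $ 2" and "e = norm (y - b)"
    have hk: "\<bar>h\<bar> \<le> e" "\<bar>k\<bar> \<le> e" "0 \<le> e"
      using component_le_norm_cart[of "y - b" 1] component_le_norm_cart[of "y - b" 2] by (auto simp: h_def k_def e_def)
    have re: "r * e \<le> 1 / 2" "0 \<le> r * e" using y r hk by (auto simp: e_def dist_norm field_simps)
    let ?T = "{(0, 0), (1, 0), (0, 1)} :: (nat \<times> nat) set"
    have "(fps2_term G h k has_sum f y) UNIV" using S[OF y(1)] by (simp add: h_def k_def)
    moreover have "(fps2_term G h k has_sum (\<Sum>p\<in>?T. fps2_term G h k p)) ?T" by (simp add: has_sum_finite_iff)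
    ultimately have "(fps2_term G h k has_sum (f y - (\<Sum>p\<in>?T. fps2_term G h k p))) (UNIV - ?T)"
      by (rule has_sum_Diff) simp
    then have hs: "(fps2_term G h k has_sum (f y - f b - ?D (y - b))) (UNIV - ?T)"
      by (simp add: fps2_term_def fb h_def k_def algebra_simps)
    \<comment> \<open>Two of the m + n factors r*e are kept as the square; the others are at most
      1/2. Since (1/2)^(m+n-2) = 4 (1/2)^(m+n), the factor 4 appears, and the double geometric sum
      supplies another 4.\<close>
    define B where "B = (\<lambda>(m, n). 4 * M * (r * e)\<^sup>2 * ((1/2) ^ m * (1/2::real) ^ n))"
    have hB: "(B has_sum (4 * M * (r * e)\<^sup>2 * 4)) UNIV"
      using has_sum_cmult_right[OF summable_geometric2[of "1/2" "1/2"], of "4 * M * (r * e)\<^sup>2"]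
      by (simp add: B_def case_prod_unfold)
    have B0: "B p \<ge> 0" for p using M by (auto simp: B_def split: prod.splits)
    have le: "\<bar>fps2_term G h k p\<bar> \<le> B p" if "p \<in> UNIV - ?T" for p
    proof -
      obtain m n where p: "p = (m, n)" by force
      have mn: "m + n \<ge> 2" using that p by (cases m; cases n) (auto simp: p)
      then obtain l where l: "m + n = l + 2" by (metis le_Suc_ex add.commute)
      have "\<bar>h\<bar> ^ m * \<bar>k\<bar> ^ n \<le> e ^ m * e ^ n" using hk by (intro mult_mono power_mono) auto
      then have "\<bar>fps_nth (fps_nth G m) n\<bar> * (\<bar>h\<bar> ^ m * \<bar>k\<bar> ^ n) \<le> (M * r ^ (m + n)) * (e ^ m * e ^ n)"
        using G M r hk by - (rule mult_mono, auto simp: geo_bound_def)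
      then have "\<bar>fps2_term G h k p\<bar> \<le> (M * r ^ (m + n)) * (e ^ m * e ^ n)"
        by (simp add: fps2_term_def p abs_mult power_abs mult.assoc)
      also have "\<dots> = M * (r * e)\<^sup>2 * (r * e) ^ l"
        unfolding power_add[symmetric] l by (simp add: power_mult_distrib power_add power2_eq_square)
      also have "\<dots> \<le> M * (r * e)\<^sup>2 * (1/2) ^ l"
        using re M by (intro mult_left_mono power_mono) auto
      also have "(1/2 :: real) ^ l = 4 * (1/2) ^ (m + n)" by (simp add: l power_add)
      finally show ?thesis by (simp add: B_def p power_add mult_ac)
    qed
    have sB: "B summable_on (UNIV - ?T)" using hB summable_on_subset_banach[of B UNIV] by (auto simp: summable_on_def)
    then have sa: "(\<lambda>p. norm (fps2_term G h k p)) summable_on (UNIV - ?T)"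
      by (rule Infinite_Sum.abs_summable_on_comparison_test') (use le in simp)
    have "\<bar>f y - f b - ?D (y - b)\<bar> = norm (infsum (fps2_term G h k) (UNIV - ?T))"
      using infsumI[OF hs] by simp
    also have "\<dots> \<le> infsum (\<lambda>p. norm (fps2_term G h k p)) (UNIV - ?T)"
      by (rule norm_infsum_bound[OF sa])
    also have "\<dots> \<le> infsum B (UNIV - ?T)" by (rule infsum_mono[OF sa sB]) (use le in simp)
    also have "\<dots> \<le> infsum B UNIV"
      by (rule infsum_mono_neutral[OF sB]) (use hB B0 in \<open>auto simp: summable_on_def\<close>)
    also have "\<dots> = 16 * M * r\<^sup>2 * e\<^sup>2" using infsumI[OF hB] by (simp add: power_mult_distrib)
    finally show ?thesis by (simp add: e_def)
  qed
  show "(f has_derivative ?D) (at b)"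
  proof (rule has_derivativeI_sandwich[where e = "min d (1 / (2 * r))" and H = "\<lambda>y. 16 * M * r\<^sup>2 * norm (y - b)"])
    show "0 < min d (1 / (2 * r))" using d r by simp
    show "bounded_linear ?D"
      by (intro bounded_linear_add bounded_linear_compose[OF bounded_linear_mult_right bounded_linear_vec_nth])
    have "((\<lambda>y. 16 * M * r\<^sup>2 * norm (y - b)) \<longlongrightarrow> 16 * M * r\<^sup>2 * norm (b - b)) (at b)" by (intro tendsto_intros)
    then show "((\<lambda>y. 16 * M * r\<^sup>2 * norm (y - b)) \<longlongrightarrow> 0) (at b)" by simp
    fix y assume y: "y \<noteq> b" "dist y b < min d (1 / (2 * r))"
    have "norm (y - b) > 0" using y by simp
    then show "norm (f y - f b - ?D (y - b)) / norm (y - b) \<le> 16 * M * r\<^sup>2 * norm (y - b)"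
      using bound[of y] y by (simp add: divide_le_eq power2_eq_square mult_ac)
  qed
qed

section \<open>Derivatives and uniqueness of power series\<close>

definition fps2_dy :: "real fps fps \<Rightarrow> real fps fps" where
  "fps2_dy F = Abs_fps (\<lambda>m. fps_deriv (fps_nth F m))"

lemma fps2_dx_nth: "fps_nth (fps_nth (fps_deriv F) m) n = real (m + 1) * fps_nth (fps_nth F (m + 1)) n"
  for F :: "real fps fps"
  by (simp add: fps_of_nat[symmetric] del: of_nat_Suc of_nat_add)

lemma fps2_dy_nth: "fps_nth (fps_nth (fps2_dy F) m) n = real (n + 1) * fps_nth (fps_nth F m) (n + 1)"
  by (simp add: fps2_dy_def)

lemma Suc_le_power2: "real (n + 1) \<le> 2 ^ n"
  using less_exp[of n] by (metis Suc_eq_plus1 Suc_leI of_nat_le_iff of_nat_numeral of_nat_power)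

text \<open>The factor produced by differentiation is at most a power of 2 and is absorbed by
  doubling \<open>r\<close>.\<close>

lemma geo_bound_deriv:
  assumes F: "geo_bound M r F"
  shows "geo_bound (M * r) (2 * r) (fps_deriv F)" "geo_bound (M * r) (2 * r) (fps2_dy F)"
proof -
  have r: "r > 0" and M: "M \<ge> 0" using F by (auto simp: geo_bound_def)
  have step: "real (a + 1) * c \<le> M * r * (2 * r) ^ (m + n)" if "c \<le> M * r ^ (m + n + 1)" "a \<le> m + n" "0 \<le> c" for a m n c
  proof -
    have "real (a + 1) \<le> 2 ^ (m + n)"
      using Suc_le_power2[of a] power_increasing[OF that(2), of "2::real"] by linarith
    then have "real (a + 1) * c \<le> 2 ^ (m + n) * (M * r ^ (m + n + 1))" using that by (intro mult_mono) auto
    then show ?thesis by (simp add: power_mult_distrib mult_ac)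
  qed
  have bnd: "\<bar>fps_nth (fps_nth F i) j\<bar> \<le> M * r ^ (m + n + 1)" if "i + j = m + n + 1" for i j m n
    using F that unfolding geo_bound_def by metis
  show "geo_bound (M * r) (2 * r) (fps_deriv F)"
    unfolding geo_bound_def
  proof (intro conjI allI)
    fix m n
    show "\<bar>fps_nth (fps_nth (fps_deriv F) m) n\<bar> \<le> M * r * (2 * r) ^ (m + n)"
      using step[OF bnd[of "m + 1" n m n]] unfolding fps2_dx_nth abs_mult by simp
  qed (use r M in auto)
  show "geo_bound (M * r) (2 * r) (fps2_dy F)"
    unfolding geo_bound_def
  proof (intro conjI allI)
    fix m n
    show "\<bar>fps_nth (fps_nth (fps2_dy F) m) n\<bar> \<le> M * r * (2 * r) ^ (m + n)"
      using step[OF bnd[of m "n + 1" m n]] unfolding fps2_dy_nth abs_mult by simp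
  qed (use r M in auto)
qed

text \<open>The derivative at a nearby point \<open>b\<close> is a linear coefficient of the series
  re-expanded at \<open>b\<close>, and that coefficient is the formally differentiated series
  evaluated at \<open>b\<close>. No separate theorem on termwise differentiation enters.\<close>

lemma has_fps2_partial:
  assumes f: "has_fps2 f a F"
  shows "has_fps2 (partial 1 f) a (fps_deriv F)" "has_fps2 (partial 2 f) a (fps2_dy F)"
proof -
  obtain M r where F: "geo_bound M r F" using has_fps2_geo_bound[OF f] .
  have 1: "\<forall>\<^sub>F b in nhds a. infsum (fps2_term (fps_deriv F) (b $ 1 - a $ 1) (b $ 2 - a $ 2)) UNIV = partial 1 f b"
    using has_fps2_shift[OF f]
  proof eventually_elim
    case (elim b)
    show ?case
      unfolding partial_eq[OF has_fps2_has_derivative(2)[OF elim]]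
      by (simp add: axis_def fps2_shift_def fps2_term_def fps2_dx_nth mult_ac del: fps_deriv_nth)
  qed
  have 2: "\<forall>\<^sub>F b in nhds a. infsum (fps2_term (fps2_dy F) (b $ 1 - a $ 1) (b $ 2 - a $ 2)) UNIV = partial 2 f b"
    using has_fps2_shift[OF f]
  proof eventually_elim
    case (elim b)
    show ?case
      unfolding partial_eq[OF has_fps2_has_derivative(2)[OF elim]]
      by (simp add: axis_def fps2_shift_def fps2_term_def fps2_dy_nth mult_ac)
  qed
  show "has_fps2 (partial 1 f) a (fps_deriv F)"
    by (rule has_fps2_cong[OF geo_bound_has_fps2[OF geo_bound_deriv(1)[OF F]] 1])
  show "has_fps2 (partial 2 f) a (fps2_dy F)"
    by (rule has_fps2_cong[OF geo_bound_has_fps2[OF geo_bound_deriv(2)[OF F]] 2])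
qed

text \<open>The value at the centre gives the constant coefficient; partial derivatives shift the
  other coefficients into that place.\<close>

lemma has_fps2_unique:
  assumes "has_fps2 f a F" "has_fps2 f a G"
  shows "F = G"
proof (rule fps2_eqI)
  fix m n
  have base: "fps_nth (fps_nth F 0) n = fps_nth (fps_nth G 0) n" if "has_fps2 f a F" "has_fps2 f a G" for f F G n
    using that
  proof (induction n arbitrary: f F G)
    case 0
    then show ?case using has_fps2_has_derivative(1) by metis
  next
    case (Suc n)
    show ?case using Suc.IH[OF has_fps2_partial(2)[OF Suc.prems(1)] has_fps2_partial(2)[OF Suc.prems(2)]]
      by (simp add: fps2_dy_nth)
  qed
  have "fps_nth (fps_nth F m) n = fps_nth (fps_nth G m) n" if "has_fps2 f a F" "has_fps2 f a G" for f F G m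
    using that
  proof (induction m arbitrary: f F G)
    case (Suc m)
    show ?case using Suc.IH[OF has_fps2_partial(1)[OF Suc.prems(1)] has_fps2_partial(1)[OF Suc.prems(2)]]
      by (simp add: fps2_dx_nth del: fps_deriv_nth)
  qed (rule base)
  then show "fps_nth (fps_nth F m) n = fps_nth (fps_nth G m) n" using assms by blast
qed

subsection \<open>Algebraic operations\<close>

lemma has_fps2_const: "has_fps2 (\<lambda>x. c) a (fps_const (fps_const c))"
proof -
  have "(fps2_term (fps_const (fps_const c)) s t has_sum c) UNIV" for s t
    by (rule has_sum_finite_neutralI[of "{(0, 0)}"]) (auto simp: fps2_term_def split: if_splits)
  then show ?thesis by (simp add: has_fps2_def)
qed

lemma has_fps2_add:
  assumes "has_fps2 f a F" "has_fps2 g a G"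
  shows "has_fps2 (\<lambda>x. f x + g x) a (F + G)"
  using assms unfolding has_fps2_def
proof eventually_elim
  case (elim x)
  have "fps2_term (F + G) s t = (\<lambda>p. fps2_term F s t p + fps2_term G s t p)" for s t
    by (auto simp: fps2_term_def fun_eq_iff algebra_simps)
  then show ?case using has_sum_add[OF elim] by simp
qed

text \<open>Absolute convergence makes the family of products of terms summable over all pairs;
  collecting equal total exponents gives the coefficients of the product.\<close>

lemma has_fps2_mult:
  assumes f: "has_fps2 f a F" and g: "has_fps2 g a G"
  shows "has_fps2 (\<lambda>x. f x * g x) a (F * G)"
  using f g unfolding has_fps2_def
proof eventually_elim
  case (elim x)
  let ?s = "x $ 1 - a $ 1" and ?t = "x $ 2 - a $ 2"
  let ?F = "fps2_term F ?s ?t" and ?G = "fps2_term G ?s ?t"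
  have "?F summable_on UNIV" "?G summable_on UNIV" using elim by (auto simp: summable_on_def)
  then have abs: "(\<lambda>p. norm (?F p)) summable_on UNIV" "(\<lambda>p. norm (?G p)) summable_on UNIV"
    using summable_on_iff_abs_summable_on_real by auto
  have "(\<lambda>q. norm ((\<lambda>(p, q). ?F p * ?G q) q)) summable_on (UNIV \<times> UNIV)"
    by (rule summable_on_SigmaI[where g = "\<lambda>p. norm (?F p) * infsum (\<lambda>q. norm (?G q)) UNIV"])
       (auto simp: norm_mult abs_mult intro!: has_sum_cmult_right has_sum_infsum summable_on_cmult_left abs[simplified])
  then have "(\<lambda>(p, q). ?F p * ?G q) summable_on (UNIV \<times> UNIV)" by (rule abs_summable_summable)
  then have prod: "((\<lambda>(p, q). ?F p * ?G q) has_sum (f x * g x)) (UNIV \<times> UNIV)"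
    by (intro has_sum_SigmaI[where g = "\<lambda>p. ?F p * g x"])
       (auto intro!: has_sum_cmult_right has_sum_cmult_left elim)
  define T where "T = Sigma (UNIV :: (nat \<times> nat) set) (\<lambda>(m, n). {..m} \<times> {..n})"
  have "((\<lambda>((m, n), (i, j)). ?F (i, j) * ?G (m - i, n - j)) has_sum (f x * g x)) T"
    by (subst has_sum_reindex_bij_witness[where j = "\<lambda>((m, n), (i, j)). ((i, j), (m - i, n - j))"
          and i = "\<lambda>((i, j), (m, n)). ((m + i, n + j), (i, j))" and T = "UNIV \<times> UNIV"
          and h = "\<lambda>(p, q). ?F p * ?G q" and s' = "f x * g x"])
       (use prod in \<open>auto simp: T_def\<close>)
  then have "((\<lambda>(m, n). \<Sum>(i, j)\<in>{..m} \<times> {..n}. ?F (i, j) * ?G (m - i, n - j)) has_sum (f x * g x)) UNIV"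
    unfolding T_def by (rule has_sum_SigmaD) (auto simp: has_sum_finite_iff split: prod.splits)
  also have "(\<lambda>(m, n). \<Sum>(i, j)\<in>{..m} \<times> {..n}. ?F (i, j) * ?G (m - i, n - j)) = fps2_term (F * G) ?s ?t"
  proof
    fix p :: "nat \<times> nat"
    obtain m n where p: "p = (m, n)" by force
    have "(\<Sum>(i, j)\<in>{..m} \<times> {..n}. ?F (i, j) * ?G (m - i, n - j))
      = (\<Sum>i\<le>m. \<Sum>j\<le>n. fps_nth (fps_nth F i) j * fps_nth (fps_nth G (m - i)) (n - j) * ?s ^ m * ?t ^ n)"
      unfolding sum.cartesian_product
    proof (rule sum.cong[OF refl])
      fix q assume "q \<in> {..m} \<times> {..n}"
      then obtain i j where q: "q = (i, j)" "i \<le> m" "j \<le> n" by auto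
      then have "?s ^ m = ?s ^ i * ?s ^ (m - i)" "?t ^ n = ?t ^ j * ?t ^ (n - j)"
        by (simp_all add: power_add[symmetric])
      then show "(case q of (i, j) \<Rightarrow> ?F (i, j) * ?G (m - i, n - j)) =
          (case q of (i, j) \<Rightarrow> fps_nth (fps_nth F i) j * fps_nth (fps_nth G (m - i)) (n - j) * ?s ^ m * ?t ^ n)"
        by (simp add: q fps2_term_def mult_ac)
    qed
    also have "\<dots> = fps2_term (F * G) ?s ?t (m, n)"
      by (simp add: fps2_term_def fps_mult_nth fps_sum_nth sum_distrib_right atMost_atLeast0)
    finally show "(case p of (m, n) \<Rightarrow> \<Sum>(i, j)\<in>{..m} \<times> {..n}. ?F (i, j) * ?G (m - i, n - j)) = fps2_term (F * G) ?s ?t p"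
      by (simp add: p del: split_paired_All)
  qed
  finally show ?case .
qed

lemma has_fps2_minus: "has_fps2 f a F \<Longrightarrow> has_fps2 (\<lambda>x. - f x) a (- F)"
  using has_fps2_mult[OF has_fps2_const[of "-1"], of f a F] by (simp add: fps_const_neg[symmetric] del: fps_const_neg)

lemma has_fps2_diff: "has_fps2 f a F \<Longrightarrow> has_fps2 g a G \<Longrightarrow> has_fps2 (\<lambda>x. f x - g x) a (F - G)"
  using has_fps2_add[OF _ has_fps2_minus, of f a F g G] by simp

lemma has_fps2_power: "has_fps2 f a F \<Longrightarrow> has_fps2 (\<lambda>x. f x ^ n) a (F ^ n)"
  by (induction n) (use has_fps2_const[of 1] has_fps2_mult in auto)

lemma has_fps2_numeral: "has_fps2 (\<lambda>x. numeral c) a (numeral c)"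
  using has_fps2_const[of "numeral c"] by (simp add: numeral_fps_const)

lemma has_fps2_zero_iff: "has_fps2 f a F \<Longrightarrow> F = 0 \<longleftrightarrow> (\<forall>\<^sub>F x in nhds a. f x = 0)"
proof
  assume f: "has_fps2 f a F" and "F = 0"
  have z: "(fps2_term 0 s t has_sum 0) UNIV" for s t
    by (rule has_sum_0) (auto simp: fps2_term_def)
  show "\<forall>\<^sub>F x in nhds a. f x = 0"
    using f unfolding has_fps2_def \<open>F = 0\<close> by (rule eventually_mono) (rule has_sum_unique[OF _ z])
next
  assume f: "has_fps2 f a F" and "\<forall>\<^sub>F x in nhds a. f x = 0"
  then have "has_fps2 (\<lambda>x. 0) a F" by (rule has_fps2_cong)
  then show "F = 0" using has_fps2_unique[OF _ has_fps2_const[of 0]] by simp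
qed

subsection \<open>Analyticity and smoothness\<close>

lemma real_analytic_at_eventually:
  fixes f :: "real ^ 2 \<Rightarrow> real"
  shows "real_analytic_at f a \<Longrightarrow> \<forall>\<^sub>F x in nhds a. real_analytic_at f x"
  unfolding real_analytic_at_iff using has_fps2_shift by (metis (mono_tags, lifting) eventually_mono)

lemma real_analytic_at_partial:
  fixes f :: "real ^ 2 \<Rightarrow> real"
  assumes "real_analytic_at f a"
  shows "real_analytic_at (partial i f) a"
proof -
  have "i = 1 \<or> i = 2" using exhaust_2 by auto
  then show ?thesis using assms has_fps2_partial unfolding real_analytic_at_iff by blast
qed

lemma real_analytic_on_imp_smooth_on:
  fixes f :: "real ^ 2 \<Rightarrow> real"
  assumes "real_analytic_on f S"
  shows "smooth_on S f"
proof -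
  have d: "f differentiable (at x)" if "real_analytic_at f x" for f :: "real ^ 2 \<Rightarrow> real" and x
    using that unfolding real_analytic_at_iff by (auto simp: differentiable_def dest: has_fps2_has_derivative(2))
  have "Ck_on k S f" for k
    using assms
  proof (induction k arbitrary: f)
    case 0
    then have "f differentiable (at x within S)" if "x \<in> S" for x
      using d that differentiable_at_withinI unfolding real_analytic_on_def by blast
    then show ?case by (simp add: differentiable_imp_continuous_on differentiable_on_def)
  next
    case (Suc k)
    then show ?case using d by (auto simp: real_analytic_on_def real_analytic_at_partial)
  qed
  then show ?thesis by (simp add: smooth_on_def)
qed

text \<open>Initial data depend on \<open>x\<^sup>2\<close> alone, hence appear as a series that is
  constant in the outer variable; \<open>c\<close> is later compared with the coefficient of order
  zero in \<open>x\<^sup>1\<close>.\<close>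

lemma real_analytic_at_1d:
  fixes f :: "real \<Rightarrow> real" and a :: "real ^ 2"
  assumes "real_analytic_at f (a $ 2)"
  obtains c where "has_fps2 (\<lambda>x. f (x $ 2)) a (fps_const c)"
proof -
  let ?B = "Basis :: real set"
  define h :: "nat \<Rightarrow> real \<Rightarrow> nat" where "h = (\<lambda>n. restrict (\<lambda>b. n) ?B)"
  have h: "bij_betw h UNIV (?B \<rightarrow>\<^sub>E UNIV)"
    by (rule bij_betw_byWitness[where f' = "\<lambda>\<mu>. \<mu> 1"])
       (auto simp: h_def PiE_def extensional_def fun_eq_iff restrict_def)
  obtain r c where r: "r > 0" and c: "\<And>x. x \<in> ball (a $ 2) r \<Longrightarrow>
        ((\<lambda>m. (\<Prod>b\<in>?B. ((x - a $ 2) \<bullet> b) ^ m b) *\<^sub>R c m) has_sum f x) (?B \<rightarrow>\<^sub>E UNIV)"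
    using assms unfolding real_analytic_at_def by blast
  have "has_fps2 (\<lambda>x. f (x $ 2)) a (fps_const (Abs_fps (\<lambda>n. c (h n))))"
    unfolding has_fps2_def
  proof (rule eventually_mono[OF eventually_small[OF r, of a]])
    fix x :: "real ^ 2" assume x: "\<bar>x $ 1 - a $ 1\<bar> < r \<and> \<bar>x $ 2 - a $ 2\<bar> < r"
    let ?t = "fps2_term (fps_const (Abs_fps (\<lambda>n. c (h n)))) (x $ 1 - a $ 1) (x $ 2 - a $ 2)"
    have "((\<lambda>n. c (h n) * (x $ 2 - a $ 2) ^ n) has_sum f (x $ 2)) UNIV"
      using c[of "x $ 2"] x unfolding has_sum_reindex_bij_betw[OF h, symmetric]
      by (simp add: h_def dist_real_def abs_minus_commute mult.commute)
    also have "(\<lambda>n. c (h n) * (x $ 2 - a $ 2) ^ n) = ?t \<circ> Pair 0"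
      by (auto simp: fps2_term_def)
    finally have "(?t has_sum f (x $ 2)) (range (Pair 0))"
      by (subst has_sum_reindex) (auto simp: inj_on_def o_def)
    then show "(?t has_sum f (x $ 2)) UNIV"
      by (rule has_sum_cong_neutral[THEN iffD1, rotated -1]) (auto simp: fps2_term_def split: if_splits)
  qed
  then show ?thesis by (rule that)
qed

lemma real_analytic_at_add:
  fixes f g :: "'a::euclidean_space \<Rightarrow> 'b::real_normed_vector"
  assumes "real_analytic_at f a" "real_analytic_at g a"
  shows "real_analytic_at (\<lambda>x. f x + g x) a"
proof -
  let ?P = "\<lambda>x m. \<Prod>b\<in>Basis. ((x - a) \<bullet> b) ^ m b :: real"
  obtain r c r' c' where "r > 0" "r' > 0"
    and "\<forall>x\<in>ball a r. ((\<lambda>m. ?P x m *\<^sub>R c m) has_sum f x) (Basis \<rightarrow>\<^sub>E UNIV)"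
    and "\<forall>x\<in>ball a r'. ((\<lambda>m. ?P x m *\<^sub>R c' m) has_sum g x) (Basis \<rightarrow>\<^sub>E UNIV)"
    using assms unfolding real_analytic_at_def by blast
  then show ?thesis
    unfolding real_analytic_at_def
    by (intro exI[of _ "min r r'"] conjI exI[of _ "\<lambda>m. c m + c' m"] ballI)
       (auto simp: scaleR_add_right intro!: has_sum_add)
qed

lemma real_analytic_at_bounded_linear:
  assumes "bounded_linear L" "real_analytic_at f a"
  shows "real_analytic_at (\<lambda>x. L (f x)) a"
proof -
  let ?P = "\<lambda>x m. \<Prod>b\<in>Basis. ((x - a) \<bullet> b) ^ m b :: real"
  obtain r c where r: "r > 0" and c: "\<forall>x\<in>ball a r. ((\<lambda>m. ?P x m *\<^sub>R c m) has_sum f x) (Basis \<rightarrow>\<^sub>E UNIV)"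
    using assms(2) unfolding real_analytic_at_def by blast
  have "((\<lambda>m. ?P x m *\<^sub>R L (c m)) has_sum L (f x)) (Basis \<rightarrow>\<^sub>E UNIV)" if "x \<in> ball a r" for x
    using has_sum_bounded_linear[OF assms(1) c[rule_format, OF that]]
    by (simp only: linear_scale[OF bounded_linear.linear[OF assms(1)]])
  then show ?thesis
    unfolding real_analytic_at_def by (intro exI[of _ r] conjI r exI[of _ "\<lambda>m. L (c m)"] ballI)
qed

section \<open>The Cauchy--Kovalevskaya theorem for quasilinear systems\<close>

subsection \<open>Formal solutions\<close>

text \<open>Congruence modulo the k-th power of the outer variable \<open>x\<^sup>1\<close>. The
  \<partial>_2-derivative preserves it, the \<partial>_1-derivative loses one order; this asymmetry
  drives all formal arguments below.\<close>

definition agree :: "nat \<Rightarrow> 'a fps \<Rightarrow> 'a::zero fps \<Rightarrow> bool" where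
  "agree k F G \<longleftrightarrow> (\<forall>j<k. fps_nth F j = fps_nth G j)"

lemma agree_refl: "agree k F F" by (simp add: agree_def)

lemma agree_mono: "agree k F G \<Longrightarrow> l \<le> k \<Longrightarrow> agree l F G" by (simp add: agree_def)

lemma agree_all: "(\<And>k. agree k F G) \<Longrightarrow> F = G"
  by (rule fps_ext) (auto simp: agree_def)

lemma agree_add: "agree k F F' \<Longrightarrow> agree k G G' \<Longrightarrow> agree k (F + G) (F' + G')"
  for F :: "'a::comm_ring_1 fps" by (simp add: agree_def)

lemma agree_diff: "agree k F F' \<Longrightarrow> agree k G G' \<Longrightarrow> agree k (F - G) (F' - G')"
  for F :: "'a::comm_ring_1 fps" by (simp add: agree_def)

lemma agree_minus: "agree k F F' \<Longrightarrow> agree k (- F) (- F')"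
  for F :: "'a::comm_ring_1 fps" by (simp add: agree_def)

lemma agree_mult: "agree k F F' \<Longrightarrow> agree k G G' \<Longrightarrow> agree k (F * G) (F' * G')"
  for F :: "'a::comm_ring_1 fps" by (auto simp: agree_def fps_mult_nth intro!: sum.cong)

lemma agree_power: "agree k F F' \<Longrightarrow> agree k (F ^ n) (F' ^ n)"
  for F :: "'a::comm_ring_1 fps" by (induction n) (auto intro: agree_mult agree_refl)

lemma agree_dy: "agree k F F' \<Longrightarrow> agree k (fps2_dy F) (fps2_dy F')"
  by (simp add: agree_def fps2_dy_def)

lemma agree_dx: "agree (Suc k) F F' \<Longrightarrow> agree k (fps_deriv F) (fps_deriv F')"
  for F :: "'a::comm_ring_1 fps" by (simp add: agree_def)

lemmas agree_intros = agree_refl agree_add agree_diff agree_minus agree_mult agree_power agree_dy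

lemma agree_SucI:
  fixes F G :: "real fps fps"
  assumes "fps_nth F 0 = fps_nth G 0" "agree k (fps_deriv F) (fps_deriv G)"
  shows "agree (Suc k) F G"
  unfolding agree_def
proof (intro allI impI)
  fix j assume j: "j < Suc k"
  show "fps_nth F j = fps_nth G j"
  proof (cases j)
    case (Suc i)
    then have "fps_nth (fps_deriv F) i = fps_nth (fps_deriv G) i"
      using assms(2) j unfolding agree_def by blast
    then have "real (i + 1) * fps_nth (fps_nth F (i + 1)) n = real (i + 1) * fps_nth (fps_nth G (i + 1)) n" for n
      unfolding fps2_dx_nth[symmetric] by (simp only:)
    then have "fps_nth (fps_nth F (i + 1)) n = fps_nth (fps_nth G (i + 1)) n" for n
      by (metis Suc_eq_plus1 mult_cancel_left of_nat_neq_0)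
    then show ?thesis using Suc by (intro fps_ext) simp
  qed (use assms in simp)
qed

text \<open>An operator without \<partial>_1-derivatives cannot lower the order of agreement, while
  integrating in \<open>x\<^sup>1\<close> raises it by one. Agreement therefore propagates to every
  order from equal initial values.\<close>

lemma evolution_unique:
  fixes U V :: "'i \<Rightarrow> real fps fps"
  assumes causal: "\<And>k U V i. (\<And>i. agree k (U i) (V i)) \<Longrightarrow> agree k (Op U i) (Op V i)"
    and "\<And>i. fps_nth (U i) 0 = fps_nth (V i) 0"
    and "\<And>i. fps_deriv (U i) = Op U i" "\<And>i. fps_deriv (V i) = Op V i"
  shows "U i = V i"
proof (rule agree_all)
  have "\<forall>i. agree k (U i) (V i)" for k
  proof (induction k)
    case (Suc k)
    then show ?case using agree_SucI[OF assms(2)] assms(3,4) causal by metis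
  qed (simp add: agree_def)
  then show "agree k (U i) (V i)" for k by blast
qed

definition majorized :: "real fps fps \<Rightarrow> real fps fps \<Rightarrow> bool" where
  "majorized F B \<longleftrightarrow> (\<forall>m n. \<bar>fps_nth (fps_nth F m) n\<bar> \<le> fps_nth (fps_nth B m) n)"

definition fps2_int :: "real fps fps \<Rightarrow> real fps fps" where
  "fps2_int F = Abs_fps (\<lambda>n. if n = 0 then 0 else fps_const (1 / real n) * fps_nth F (n - 1))"

lemma deriv_fps2_int: "fps_deriv (fps2_int F) = F"
  by (rule fps2_eqI) (simp add: fps2_dx_nth fps2_int_def del: fps_deriv_nth)

text \<open>Picard iteration in formal power series: each round fixes one further order in
  \<open>x\<^sup>1\<close>. The hypothesis \<open>bound\<close> makes \<open>B\<close> a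
  supersolution, so no iterate leaves its range and the limit inherits the bound.\<close>

lemma evolution_exists:
  fixes Op :: "('i \<Rightarrow> real fps fps) \<Rightarrow> 'i \<Rightarrow> real fps fps" and U0 :: "'i \<Rightarrow> real fps"
  assumes causal: "\<And>k U V i. (\<And>i. agree k (U i) (V i)) \<Longrightarrow> agree k (Op U i) (Op V i)"
    and init: "\<And>i n. \<bar>fps_nth (U0 i) n\<bar> \<le> fps_nth (fps_nth B 0) n"
    and bound: "\<And>U i. (\<And>i. majorized (U i) B) \<Longrightarrow> majorized (Op U i) (fps_deriv B)"
    and B0: "\<And>m n. 0 \<le> fps_nth (fps_nth B m) n"
  obtains U where "\<And>i. fps_nth (U i) 0 = U0 i" "\<And>i. fps_deriv (U i) = Op U i" "\<And>i. majorized (U i) B"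
proof -
  define step where "step U i = fps_const (U0 i) + fps2_int (Op U i)" for U i
  define it where "it n = (step ^^ n) (\<lambda>i. 0)" for n
  have it_Suc: "it (Suc n) = step (it n)" for n by (simp add: it_def)
  have step_agree: "agree (Suc k) (step U i) (step V i)" if "\<And>i. agree k (U i) (V i)" for k U V i
  proof -
    have "agree k (Op U i) (Op V i)" by (rule causal) (rule that)
    then show ?thesis by (auto simp: agree_def step_def fps2_int_def)
  qed
  have chain: "agree n (it n i) (it (n + l) i)" for n l i
  proof (induction n arbitrary: i)
    case (Suc n)
    then show ?case using step_agree[of n "it n" "it (n + l)" i] by (simp add: it_Suc)
  qed (simp add: agree_def)
  \<comment> \<open>The coefficient of order m is final from iterate m + 1 on.\<close>
  define U where "U i = Abs_fps (\<lambda>m. fps_nth (it (Suc m) i) m)" for i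
  have U_it: "agree n (U i) (it n i)" for n i
    unfolding agree_def
  proof (intro allI impI)
    fix j assume "j < n"
    then show "fps_nth (U i) j = fps_nth (it n i) j"
      using chain[of "Suc j" i "n - Suc j"] by (simp add: agree_def U_def)
  qed
  have fixp: "step U i = U i" for i
  proof (rule agree_all)
    fix k
    have "agree (Suc k) (step U i) (it (Suc k) i)" unfolding it_Suc by (rule step_agree) (rule U_it)
    moreover have "agree (Suc k) (U i) (it (Suc k) i)" by (rule U_it)
    ultimately show "agree k (step U i) (U i)" by (simp add: agree_def)
  qed
  have maj: "majorized (it n i) B" for n i
  proof (induction n arbitrary: i)
    case 0
    then show ?case using B0 by (simp add: majorized_def it_def)
  next
    case (Suc n)
    have "majorized (Op (it n) i) (fps_deriv B)" by (rule bound) (rule Suc)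
    note b = this[unfolded majorized_def fps2_dx_nth, rule_format]
    show ?case
      unfolding majorized_def
    proof (intro allI)
      fix m l
      show "\<bar>fps_nth (fps_nth (it (Suc n) i) m) l\<bar> \<le> fps_nth (fps_nth B m) l"
      proof (cases m)
        case 0
        then show ?thesis using init by (simp add: it_Suc step_def fps2_int_def)
      next
        case (Suc j)
        then show ?thesis using b[of j l] by (simp add: it_Suc step_def fps2_int_def abs_mult field_simps)
      qed
    qed
  qed
  show ?thesis
  proof (rule that[of U])
    show "fps_nth (U i) 0 = U0 i" for i
      by (subst fixp[symmetric]) (simp add: step_def fps2_int_def)
    show "fps_deriv (U i) = Op U i" for i
      by (subst fixp[symmetric]) (simp add: step_def deriv_fps2_int)
    show "majorized (U i) B" for i
      using maj by (simp add: majorized_def U_def)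
  qed
qed

subsection \<open>The majorant\<close>

text \<open>The majorant is \<open>\<phi>(R x\<^sup>1 + \<rho> x\<^sup>2)\<close> with \<open>\<phi>(s) = \<Sum> cw k s\<^sup>k\<close>.  The weights are chosen such that
  \<open>\<phi>\<^sup>2\<close> is majorized by \<open>\<phi>\<close>, and a \<open>\<partial>\<^sub>1\<close>-derivative gains the factor \<open>R / \<rho>\<close> over a \<open>\<partial>\<^sub>2\<close>-derivative.\<close>

definition cw :: "nat \<Rightarrow> real" where "cw k = 1 / (8 * (real k + 1)\<^sup>2)"

lemma cw_pos: "cw k > 0" by (simp add: cw_def)

lemma sum_inverse_squares: "(\<Sum>k\<le>N. 1 / (real k + 1)\<^sup>2) \<le> 2 - 1 / (real N + 1)"
proof (induction N)
  case (Suc N)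
  have "1 / (real N + 2)\<^sup>2 \<le> 1 / ((real N + 1) * (real N + 2))"
    by (intro divide_left_mono) (auto simp: power2_eq_square)
  also have "\<dots> = 1 / (real N + 1) - 1 / (real N + 2)" by (simp add: field_simps)
  finally show ?case using Suc by (simp add: algebra_simps)
qed simp

text \<open>With a = 1/(k+1) and b = 1/(N-k+1), partial fractions give ab = (a+b)/(N+2). Squaring
  and summing bounds the convolution of the inverse squares by 8/(N+1)^2, and the normalization 1/8
  in \<open>cw\<close> absorbs exactly this 8.\<close>

lemma cw_convolution: "(\<Sum>k\<le>N. cw k * cw (N - k)) \<le> cw N"
proof -
  define q where "q k = 1 / (real k + 1)\<^sup>2" for k
  define c where "c = 1 / (real N + 1)\<^sup>2"
  have le: "cw k * cw (N - k) \<le> c / 32 * (q k + q (N - k))" if "k \<le> N" for k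
  proof -
    define a b where "a = 1 / (real k + 1)" and "b = 1 / (real (N - k) + 1)"
    have ab: "a * b = (a + b) / (real N + 2)"
    proof -
      have "a * (real k + 1) = 1" "b * (real (N - k) + 1) = 1" "real N = real k + real (N - k)"
        using that by (simp_all add: a_def b_def)
      then have "a * b * (real N + 2) = a + b" by algebra
      then show ?thesis by (simp add: field_simps)
    qed
    have "(a * b)\<^sup>2 = (a + b)\<^sup>2 * (1 / (real N + 2)\<^sup>2)" by (simp add: ab power_divide)
    also have "\<dots> \<le> (2 * (a\<^sup>2 + b\<^sup>2)) * c"
      unfolding c_def
    proof (intro mult_mono)
      show "(a + b)\<^sup>2 \<le> 2 * (a\<^sup>2 + b\<^sup>2)" using sum_squares_bound[of a b] by (simp add: power2_sum)
      show "1 / (real N + 2)\<^sup>2 \<le> 1 / (real N + 1)\<^sup>2" by (intro divide_left_mono power_mono) auto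
    qed auto
    finally have "(a * b)\<^sup>2 \<le> 2 * (c * (a\<^sup>2 + b\<^sup>2))" by (simp only: mult_ac)
    moreover have "cw k * cw (N - k) = (a * b)\<^sup>2 / 64" "q k = a\<^sup>2" "q (N - k) = b\<^sup>2"
      by (simp_all add: cw_def q_def a_def b_def power_divide power_mult_distrib)
    ultimately show ?thesis by simp
  qed
  have c: "c \<ge> 0" by (simp add: c_def)
  have "(\<Sum>k\<le>N. q k) \<le> 2 - 1 / (real N + 1)" unfolding q_def by (rule sum_inverse_squares)
  moreover have "1 / (real N + 1) \<ge> 0" by simp
  ultimately have q2: "(\<Sum>k\<le>N. q k) \<le> 2" by linarith
  have "(\<Sum>k\<le>N. cw k * cw (N - k)) \<le> (\<Sum>k\<le>N. c / 32 * (q k + q (N - k)))"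
    by (intro sum_mono le) auto
  also have "\<dots> = c / 32 * ((\<Sum>k\<le>N. q k) + (\<Sum>k\<le>N. q (N - k)))"
    by (simp only: sum_distrib_left[symmetric] sum.distrib)
  also have "(\<Sum>k\<le>N. q (N - k)) = (\<Sum>k\<le>N. q k)" 
    by (rule sum.reindex_bij_witness[of _ "\<lambda>k. N - k" "\<lambda>k. N - k"]) auto
  also have "c / 32 * ((\<Sum>k\<le>N. q k) + (\<Sum>k\<le>N. q k)) \<le> c / 32 * (2 + 2)"
    using q2 c by (intro mult_left_mono add_mono) auto
  finally show ?thesis by (simp add: cw_def c_def)
qed

definition Phi :: "real \<Rightarrow> real \<Rightarrow> real fps fps" where
  "Phi R \<rho> = Abs_fps (\<lambda>m. Abs_fps (\<lambda>n. cw (m + n) * real ((m + n) choose m) * R ^ m * \<rho> ^ n))"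

text \<open>The series of \<phi>'(R x1 + \<rho> x2), where \<phi> is the generating function of the
  weights. It is the common factor of both partial derivatives of \<open>Phi\<close>.\<close>

definition Phi1 :: "real \<Rightarrow> real \<Rightarrow> real fps fps" where
  "Phi1 R \<rho> = Abs_fps (\<lambda>m. Abs_fps (\<lambda>n. (real (m + n) + 1) * cw (m + n + 1) * real ((m + n) choose m) * R ^ m * \<rho> ^ n))"

lemma deriv_Phi: "fps_nth (fps_nth (fps_deriv (Phi R \<rho>)) m) n = R * fps_nth (fps_nth (Phi1 R \<rho>) m) n"
proof -
  have "Suc m * (Suc (m + n) choose Suc m) = Suc (m + n) * ((m + n) choose m)"
    using Suc_times_binomial_eq[of "m + n" m] by (simp add: mult.commute)
  then have "real (Suc m) * real (Suc (m + n) choose Suc m) = real (Suc (m + n)) * real ((m + n) choose m)"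
    by (metis of_nat_mult)
  moreover have "real (Suc (m + n)) = 1 + (real m + real n)" by simp
  ultimately have "(real (Suc m) * real (Suc (m + n) choose Suc m)) * (cw (m + n + 1) * R ^ Suc m * \<rho> ^ n)
      = ((1 + (real m + real n)) * real ((m + n) choose m)) * (cw (m + n + 1) * R ^ Suc m * \<rho> ^ n)" by simp
  then show ?thesis
    unfolding fps2_dx_nth by (simp add: Phi_def Phi1_def mult_ac add_ac del: of_nat_Suc binomial_Suc_Suc)
qed

lemma dy_Phi: "fps_nth (fps_nth (fps2_dy (Phi R \<rho>)) m) n = \<rho> * fps_nth (fps_nth (Phi1 R \<rho>) m) n"
proof -
  have "Suc n * (Suc (m + n) choose m) = Suc (m + n) * ((m + n) choose m)"
    using Suc_times_binomial_eq[of "m + n" n] binomial_symmetric[of m "m + n"] binomial_symmetric[of m "Suc (m + n)"]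
    by (simp add: mult.commute Suc_diff_le)
  then have "real (Suc n) * real (Suc (m + n) choose m) = real (Suc (m + n)) * real ((m + n) choose m)"
    by (metis of_nat_mult)
  moreover have "real (Suc (m + n)) = 1 + (real m + real n)" by simp
  ultimately have "(real (Suc n) * real (Suc (m + n) choose m)) * (cw (m + n + 1) * R ^ m * \<rho> ^ Suc n)
      = ((1 + (real m + real n)) * real ((m + n) choose m)) * (cw (m + n + 1) * R ^ m * \<rho> ^ Suc n)" by simp
  then show ?thesis
    unfolding fps2_dy_nth by (simp add: Phi_def Phi1_def mult_ac add_ac del: of_nat_Suc)
qed

text \<open>Grouping by k = i + j and enlarging the range to all (k, i), which only adds nonnegative
  terms, leaves Vandermonde's identity in \<open>i\<close>. In this way products of series in one
  linear form reduce to one-variable convolutions.\<close>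

lemma binomial_double_sum:
  assumes h: "\<And>k. (0::real) \<le> h k"
  shows "(\<Sum>i\<le>m. \<Sum>j\<le>n. h (i + j) * real ((i + j) choose i) * real ((m - i + (n - j)) choose (m - i)))
    \<le> (\<Sum>k\<le>m + n. h k) * real ((m + n) choose m)"
proof -
  let ?c = "\<lambda>(k, i). h k * real (k choose i) * real ((m + n - k) choose (m - i))"
  have "(\<Sum>i\<le>m. \<Sum>j\<le>n. h (i + j) * real ((i + j) choose i) * real ((m - i + (n - j)) choose (m - i)))
      = (\<Sum>p\<in>{..m} \<times> {..n}. ?c (fst p + snd p, fst p))"
    unfolding sum.cartesian_product
  proof (rule sum.cong[OF refl])
    fix p assume "p \<in> {..m} \<times> {..n}"
    then obtain i j where p: "p = (i, j)" "i \<le> m" "j \<le> n" by auto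
    then have "m - i + (n - j) = m + n - (i + j)" by simp
    then show "(case p of (i, j) \<Rightarrow> h (i + j) * real ((i + j) choose i) * real ((m - i + (n - j)) choose (m - i)))
        = ?c (fst p + snd p, fst p)" by (simp add: p add.commute)
  qed
  also have "\<dots> = (\<Sum>q\<in>(\<lambda>p. (fst p + snd p, fst p)) ` ({..m} \<times> {..n}). ?c q)"
    by (subst sum.reindex) (auto simp: inj_on_def)
  also have "\<dots> \<le> (\<Sum>q\<in>{..m + n} \<times> {..m}. ?c q)"
    by (rule sum_mono2) (auto simp: h)
  also have "\<dots> = (\<Sum>k\<le>m + n. h k * (\<Sum>i\<le>m. real (k choose i) * real ((m + n - k) choose (m - i))))"
    by (simp add: sum.cartesian_product[symmetric] sum_distrib_left mult.assoc)
  also have "\<dots> = (\<Sum>k\<le>m + n. h k * real ((m + n) choose m))"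
  proof (rule sum.cong[OF refl])
    fix k assume "k \<in> {..m + n}"
    then have "(\<Sum>i\<le>m. (k choose i) * ((m + n - k) choose (m - i))) = (m + n) choose m"
      using vandermonde[of k "m + n - k" m] by simp
    then have "(\<Sum>i\<le>m. real (k choose i) * real ((m + n - k) choose (m - i))) = real ((m + n) choose m)"
      by (simp flip: of_nat_mult of_nat_sum)
    then show "h k * (\<Sum>i\<le>m. real (k choose i) * real ((m + n - k) choose (m - i))) = h k * real ((m + n) choose m)" by simp
  qed
  finally show ?thesis by (simp add: sum_distrib_right)
qed

lemma fps2_mult_nth:
  "fps_nth (fps_nth (F * G) m) n = (\<Sum>i\<le>m. \<Sum>j\<le>n. fps_nth (fps_nth F i) j * fps_nth (fps_nth G (m - i)) (n - j))"
  for F G :: "real fps fps"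
  by (simp add: fps_mult_nth fps_sum_nth atMost_atLeast0)

context
  fixes R \<rho> :: real
  assumes R: "R > 0" and rho: "\<rho> > 0"
begin

lemma Phi_pos: "0 < fps_nth (fps_nth (Phi R \<rho>) m) n"
  using R rho cw_pos[of "m + n"] by (simp add: Phi_def)

lemma Phi1_pos: "0 < fps_nth (fps_nth (Phi1 R \<rho>) m) n"
  using R rho cw_pos[of "m + n + 1"] by (simp add: Phi1_def add_nonneg_pos)

lemma Phi_square: "fps_nth (fps_nth (Phi R \<rho> * Phi R \<rho>) m) n \<le> fps_nth (fps_nth (Phi R \<rho>) m) n"
proof -
  have "fps_nth (fps_nth (Phi R \<rho> * Phi R \<rho>) m) n = (\<Sum>i\<le>m. \<Sum>j\<le>n. (cw (i + j) * cw (m + n - (i + j))) * real ((i + j) choose i)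
      * real ((m - i + (n - j)) choose (m - i))) * (R ^ m * \<rho> ^ n)"
    unfolding fps2_mult_nth sum_distrib_right
  proof (intro sum.cong refl)
    fix i j assume "i \<in> {..m}" "j \<in> {..n}"
    then have "R ^ m = R ^ i * R ^ (m - i)" "\<rho> ^ n = \<rho> ^ j * \<rho> ^ (n - j)" "m - i + (n - j) = m + n - (i + j)"
      by (simp_all add: power_add[symmetric])
    then show "fps_nth (fps_nth (Phi R \<rho>) i) j * fps_nth (fps_nth (Phi R \<rho>) (m - i)) (n - j) =
         cw (i + j) * cw (m + n - (i + j)) * real ((i + j) choose i) * real ((m - i + (n - j)) choose (m - i)) * (R ^ m * \<rho> ^ n)"
      by (simp add: Phi_def)
  qed
  also have "\<dots> \<le> ((\<Sum>k\<le>m + n. cw k * cw (m + n - k)) * real ((m + n) choose m)) * (R ^ m * \<rho> ^ n)"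
    using R rho cw_pos by (intro mult_right_mono binomial_double_sum) (auto simp: less_imp_le)
  also have "\<dots> \<le> (cw (m + n) * real ((m + n) choose m)) * (R ^ m * \<rho> ^ n)"
    using R rho by (intro mult_right_mono cw_convolution) auto
  finally show ?thesis by (simp add: Phi_def)
qed

text \<open>The \<partial>_1-derivative of the square estimate: the square contributes 2 R
  \<open>Phi\<close> \<open>Phi1\<close>, the right-hand side R \<open>Phi1\<close>. The spare
  factor 2 is dropped by nonnegativity.\<close>

lemma Phi_Phi1: "fps_nth (fps_nth (Phi R \<rho> * Phi1 R \<rho>) m) n \<le> fps_nth (fps_nth (Phi1 R \<rho>) m) n"
proof -
  have d: "fps_deriv (Phi R \<rho>) = fps_const (fps_const R) * Phi1 R \<rho>"
    by (rule fps2_eqI) (simp add: deriv_Phi del: fps_deriv_nth)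
  have e: "fps_deriv (Phi R \<rho> * Phi R \<rho>) = fps_const (fps_const (2 * R)) * (Phi R \<rho> * Phi1 R \<rho>)"
  proof -
    have "fps_const (fps_const (2 * R)) = fps_const (fps_const R) + fps_const (fps_const R)" by simp
    then show ?thesis unfolding fps_deriv_mult d by (simp only: algebra_simps)
  qed
  have "fps_nth (fps_nth (fps_deriv (Phi R \<rho> * Phi R \<rho>)) m) n = 2 * R * fps_nth (fps_nth (Phi R \<rho> * Phi1 R \<rho>) m) n"
    unfolding e by simp
  moreover have "fps_nth (fps_nth (fps_deriv (Phi R \<rho> * Phi R \<rho>)) m) n \<le> fps_nth (fps_nth (fps_deriv (Phi R \<rho>)) m) n"
    unfolding fps2_dx_nth by (intro mult_left_mono Phi_square) auto
  ultimately have "R * (2 * fps_nth (fps_nth (Phi R \<rho> * Phi1 R \<rho>) m) n) \<le> R * fps_nth (fps_nth (Phi1 R \<rho>) m) n"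
    by (simp add: deriv_Phi del: fps_deriv_nth)
  then have "2 * fps_nth (fps_nth (Phi R \<rho> * Phi1 R \<rho>) m) n \<le> fps_nth (fps_nth (Phi1 R \<rho>) m) n"
    using R by simp
  moreover have "0 \<le> fps_nth (fps_nth (Phi R \<rho> * Phi1 R \<rho>) m) n"
    unfolding fps2_mult_nth by (intro sum_nonneg mult_nonneg_nonneg less_imp_le[OF Phi_pos] less_imp_le[OF Phi1_pos])
  ultimately show ?thesis by linarith
qed

end

section \<open>Calculus of majorized series\<close>

definition maj0 :: "real \<Rightarrow> real \<Rightarrow> real \<Rightarrow> real fps fps \<Rightarrow> bool" where
  "maj0 R \<rho> c F \<longleftrightarrow> (\<forall>m n. \<bar>fps_nth (fps_nth F m) n\<bar> \<le> c * fps_nth (fps_nth (Phi R \<rho>) m) n)"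

text \<open>The scale for terms carrying one derivative. Multiplication by series of the scale
  \<open>maj0\<close> preserves it, which suits right-hand sides that are linear in the
  derivatives.\<close>

definition maj1 :: "real \<Rightarrow> real \<Rightarrow> real \<Rightarrow> real fps fps \<Rightarrow> bool" where
  "maj1 R \<rho> c F \<longleftrightarrow> (\<forall>m n. \<bar>fps_nth (fps_nth F m) n\<bar> \<le> c * fps_nth (fps_nth (Phi1 R \<rho>) m) n)"

lemma abs_mult_nth_le:
  fixes F G P Q :: "real fps fps"
  assumes F: "\<And>m n. \<bar>fps_nth (fps_nth F m) n\<bar> \<le> a * fps_nth (fps_nth P m) n"
    and G: "\<And>m n. \<bar>fps_nth (fps_nth G m) n\<bar> \<le> b * fps_nth (fps_nth Q m) n"
  shows "\<bar>fps_nth (fps_nth (F * G) m) n\<bar> \<le> a * b * fps_nth (fps_nth (P * Q) m) n"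
proof -
  have "\<bar>fps_nth (fps_nth (F * G) m) n\<bar> \<le> (\<Sum>i\<le>m. \<Sum>j\<le>n. \<bar>fps_nth (fps_nth F i) j\<bar> * \<bar>fps_nth (fps_nth G (m - i)) (n - j)\<bar>)"
    unfolding fps2_mult_nth abs_mult[symmetric] by (intro order.trans[OF sum_abs] sum_mono order.trans[OF sum_abs]) auto
  also have "\<dots> \<le> (\<Sum>i\<le>m. \<Sum>j\<le>n. (a * fps_nth (fps_nth P i) j) * (b * fps_nth (fps_nth Q (m - i)) (n - j)))"
    using F G by (intro sum_mono mult_mono order.trans[OF abs_ge_zero F]) auto
  also have "\<dots> = a * b * fps_nth (fps_nth (P * Q) m) n"
    unfolding fps2_mult_nth by (simp add: sum_distrib_left mult_ac)
  finally show ?thesis .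
qed

context
  fixes R \<rho> :: real
  assumes R: "R > 0" and rho: "\<rho> > 0"
begin

lemma maj0_nonneg: "maj0 R \<rho> c F \<Longrightarrow> 0 \<le> c"
  unfolding maj0_def using Phi_pos[OF R rho, of 0 0] by (metis abs_ge_zero order.trans zero_le_mult_iff not_less)

lemma maj1_nonneg: "maj1 R \<rho> c F \<Longrightarrow> 0 \<le> c"
  unfolding maj1_def using Phi1_pos[OF R rho, of 0 0] by (metis abs_ge_zero order.trans zero_le_mult_iff not_less)

lemma maj0_mult: "maj0 R \<rho> a F \<Longrightarrow> maj0 R \<rho> b G \<Longrightarrow> maj0 R \<rho> (a * b) (F * G)"
  using abs_mult_nth_le[of F a "Phi R \<rho>" G b "Phi R \<rho>"] Phi_square[OF R rho] maj0_nonneg[of a F] maj0_nonneg[of b G]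
  unfolding maj0_def by (meson mult_left_mono mult_nonneg_nonneg order_trans)

lemma maj01_mult: "maj0 R \<rho> a F \<Longrightarrow> maj1 R \<rho> b G \<Longrightarrow> maj1 R \<rho> (a * b) (F * G)"
  using abs_mult_nth_le[of F a "Phi R \<rho>" G b "Phi1 R \<rho>"] Phi_Phi1[OF R rho] maj0_nonneg[of a F] maj1_nonneg[of b G]
  unfolding maj0_def maj1_def by (meson mult_left_mono mult_nonneg_nonneg order_trans)

lemma maj1_add: "maj1 R \<rho> a F \<Longrightarrow> maj1 R \<rho> b G \<Longrightarrow> maj1 R \<rho> (a + b) (F + G)"
  unfolding maj1_def fps_add_nth distrib_right using abs_triangle_ineq add_mono order_trans by meson

lemma maj1_diff: "maj1 R \<rho> a F \<Longrightarrow> maj1 R \<rho> b G \<Longrightarrow> maj1 R \<rho> (a + b) (F - G)"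
  unfolding maj1_def fps_sub_nth distrib_right using abs_triangle_ineq4 add_mono order_trans by meson

lemma maj0_diff: "maj0 R \<rho> a F \<Longrightarrow> maj0 R \<rho> b G \<Longrightarrow> maj0 R \<rho> (a + b) (F - G)"
  unfolding maj0_def fps_sub_nth distrib_right using abs_triangle_ineq4 add_mono order_trans by meson

text \<open>The constant 8 is the reciprocal of \<open>cw 0\<close>.\<close>

lemma maj0_one: "maj0 R \<rho> 8 1"
proof -
  have "fps_nth (fps_nth (1 :: real fps fps) m) n = (if m = 0 \<and> n = 0 then 1 else 0)" for m n
    by simp
  then show ?thesis
    using less_imp_le[OF Phi_pos[OF R rho]] by (simp add: maj0_def) (simp add: Phi_def cw_def)
qed

lemma maj0_power: "maj0 R \<rho> a F \<Longrightarrow> maj0 R \<rho> (a ^ n * 8) (F ^ n)"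
  by (induction n) (auto simp: maj0_one mult.assoc intro: maj0_mult)

lemma maj0_numeral: "maj0 R \<rho> (8 * numeral k) (numeral k)"
proof -
  have "fps_nth (fps_nth (numeral k :: real fps fps) m) n = (if m = 0 \<and> n = 0 then numeral k else 0)" for m n
    by (simp add: numeral_fps_const)
  moreover have "x \<le> 8 * x * fps_nth (fps_nth (Phi R \<rho>) 0) 0" for x by (simp add: Phi_def cw_def)
  ultimately show ?thesis
    using less_imp_le[OF Phi_pos[OF R rho]] unfolding maj0_def by (metis abs_numeral abs_zero mult_nonneg_nonneg zero_le_numeral)
qed

text \<open>Terms of order zero must also fit under \<open>Phi1\<close>. The ratio of weights is
  (k+2)^2/(k+1)^3, which is at most 4, with equality at k = 0.\<close>

lemma maj0_maj1: assumes "maj0 R \<rho> a F" shows "maj1 R \<rho> (4 * a) F"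
proof -
  have *: "fps_nth (fps_nth (Phi R \<rho>) m) n \<le> 4 * fps_nth (fps_nth (Phi1 R \<rho>) m) n" for m n
  proof -
    define k where "k = real (m + n)"
    have k: "k \<ge> 0" by (simp add: k_def)
    have "(k + 2)\<^sup>2 \<le> (2 * (k + 1))\<^sup>2" using k by (intro power_mono) auto
    also have "\<dots> = 4 * (k + 1)\<^sup>2 * 1" by (simp add: power2_eq_square algebra_simps)
    also have "\<dots> \<le> 4 * (k + 1)\<^sup>2 * (k + 1)" using k by (intro mult_left_mono) auto
    finally have "1 / (8 * (k + 1)\<^sup>2) \<le> 4 * ((k + 1) * (1 / (8 * (k + 2)\<^sup>2)))"
      using k by (simp add: field_simps add_pos_nonneg)
    then have "cw (m + n) \<le> 4 * ((real (m + n) + 1) * cw (m + n + 1))"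
      by (simp add: cw_def k_def add_ac)
    then have "cw (m + n) * (real ((m + n) choose m) * R ^ m * \<rho> ^ n)
        \<le> 4 * ((real (m + n) + 1) * cw (m + n + 1)) * (real ((m + n) choose m) * R ^ m * \<rho> ^ n)"
      using R rho by (intro mult_right_mono) auto
    then show ?thesis by (simp add: Phi_def Phi1_def mult_ac)
  qed
  show ?thesis
    unfolding maj1_def
  proof (intro allI)
    fix m n
    have "\<bar>fps_nth (fps_nth F m) n\<bar> \<le> a * fps_nth (fps_nth (Phi R \<rho>) m) n" using assms by (simp add: maj0_def)
    also have "\<dots> \<le> a * (4 * fps_nth (fps_nth (Phi1 R \<rho>) m) n)"
      using maj0_nonneg[OF assms] * by (intro mult_left_mono) auto
    finally show "\<bar>fps_nth (fps_nth F m) n\<bar> \<le> 4 * a * fps_nth (fps_nth (Phi1 R \<rho>) m) n" by simp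
  qed
qed

lemma maj0_dy: assumes "maj0 R \<rho> a F" shows "maj1 R \<rho> (\<rho> * a) (fps2_dy F)"
  unfolding maj1_def
proof (intro allI)
  fix m n
  have "\<bar>fps_nth (fps_nth (fps2_dy F) m) n\<bar> = real (n + 1) * \<bar>fps_nth (fps_nth F m) (n + 1)\<bar>"
    by (simp add: fps2_dy_nth abs_mult)
  also have "\<dots> \<le> real (n + 1) * (a * fps_nth (fps_nth (Phi R \<rho>) m) (n + 1))"
    using assms by (intro mult_left_mono) (auto simp: maj0_def)
  also have "\<dots> = a * fps_nth (fps_nth (fps2_dy (Phi R \<rho>)) m) n" by (simp add: fps2_dy_nth)
  also have "\<dots> = \<rho> * a * fps_nth (fps_nth (Phi1 R \<rho>) m) n" by (simp add: dy_Phi)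
  finally show "\<bar>fps_nth (fps_nth (fps2_dy F) m) n\<bar> \<le> \<rho> * a * fps_nth (fps_nth (Phi1 R \<rho>) m) n" .
qed

end

section \<open>Geometric bounds compared with the majorant\<close>

lemma square_le_power2: "(real k + 1)\<^sup>2 \<le> 4 * 2 ^ k"
proof (induction k rule: less_induct)
  case (less k)
  consider "k = 0" | "k = 1" | "k = 2" | j where "k = Suc j" "j \<ge> 2" by (metis One_nat_def Suc_1 le_less_Suc_eq not_less_eq_eq old.nat.exhaust le0 less_Suc_eq_le not_less)
  then show ?case
  proof cases
    case 4
    have "(real k + 1)\<^sup>2 \<le> 2 * (real j + 1)\<^sup>2"
    proof -
      have "2 \<le> real j" using 4 by simp
      then have "real j * 2 \<le> real j * real j" by (intro mult_left_mono) auto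
      moreover have "(real k + 1)\<^sup>2 = real j * real j + 4 * real j + 4" "2 * (real j + 1)\<^sup>2 = 2 * (real j * real j) + 4 * real j + 2"
        by (simp_all add: 4 power2_eq_square algebra_simps)
      ultimately show ?thesis using \<open>2 \<le> real j\<close> by linarith
    qed
    then show ?thesis using less[of j] 4 by simp
  qed (auto simp: power2_eq_square)
qed

text \<open>A factor 2 in the radius pays for the polynomial decay of the weights; 32 is the 8 in
  \<open>cw\<close> times the 4 in \<open>square_le_power2\<close>.\<close>

lemma power_le_cw:
  assumes "0 \<le> r" "2 * r \<le> \<rho>"
  shows "r ^ k \<le> 32 * cw k * \<rho> ^ k"
proof -
  have "(real k + 1)\<^sup>2 * r ^ k \<le> 4 * 2 ^ k * r ^ k" using assms square_le_power2 by (intro mult_right_mono) auto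
  also have "\<dots> = 4 * (2 * r) ^ k" by (simp add: power_mult_distrib)
  also have "\<dots> \<le> 4 * \<rho> ^ k" using assms by (intro mult_left_mono power_mono) auto
  finally show ?thesis by (simp add: cw_def field_simps)
qed

text \<open>Replacing \<rho> by the larger \<open>R\<close> and inserting a binomial coefficient
  only increases the right-hand side. The constant is therefore the same for every \<open>R\<close>
  above \<rho>.\<close>

lemma geo_bound_maj0:
  assumes F: "geo_bound M r F" and "2 * r \<le> \<rho>" "\<rho> \<le> R"
  shows "maj0 R \<rho> (32 * M) F"
  unfolding maj0_def
proof (intro allI)
  fix m n
  have r: "r > 0" and M: "M \<ge> 0" using F by (auto simp: geo_bound_def)
  then have rho: "\<rho> > 0" using assms by linarith
  have "\<bar>fps_nth (fps_nth F m) n\<bar> \<le> M * r ^ (m + n)" using F by (simp add: geo_bound_def)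
  also have "\<dots> \<le> M * (32 * cw (m + n) * \<rho> ^ (m + n))"
    using assms r M by (intro mult_left_mono power_le_cw) auto
  also have "\<dots> \<le> M * (32 * cw (m + n) * (real ((m + n) choose m) * R ^ m * \<rho> ^ n))"
  proof -
    have "1 * \<rho> ^ m \<le> real ((m + n) choose m) * R ^ m"
      using assms rho binomial_eq_0_iff[of "m + n" m] by (intro mult_mono power_mono) (auto simp: Suc_le_eq neq0_conv[symmetric] simp del: neq0_conv)
    then show ?thesis
      using M rho cw_pos[of "m + n"] by (intro mult_left_mono) (auto simp: power_add intro!: mult_right_mono)
  qed
  finally show "\<bar>fps_nth (fps_nth F m) n\<bar> \<le> 32 * M * fps_nth (fps_nth (Phi R \<rho>) m) n"
    by (simp add: Phi_def mult_ac)
qed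

lemma maj0_geo_bound:
  assumes F: "maj0 R \<rho> c F" and R: "R > 0" "\<rho> > 0" "\<rho> \<le> R"
  shows "geo_bound c (2 * R) F"
  unfolding geo_bound_def
proof (intro conjI allI)
  show c: "0 \<le> c" using maj0_nonneg[OF R(1,2) F] .
  fix m n
  have "\<bar>fps_nth (fps_nth F m) n\<bar> \<le> c * (cw (m + n) * real ((m + n) choose m) * R ^ m * \<rho> ^ n)"
    using F by (simp add: maj0_def Phi_def)
  also have "\<dots> \<le> c * (1 * 2 ^ (m + n) * R ^ m * R ^ n)"
  proof -
    have "cw (m + n) \<le> 1"
    proof -
      have "1 \<le> 8 * (real (m + n) + 1)\<^sup>2" using one_le_power[of "real (m + n) + 1" 2] by linarith
      then show ?thesis by (simp add: cw_def divide_le_eq)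
    qed
    moreover have "real ((m + n) choose m) \<le> 2 ^ (m + n)"
      using binomial_le_pow2[of "m + n" m] by (metis of_nat_le_iff of_nat_numeral of_nat_power)
    ultimately show ?thesis
      using R c cw_pos[of "m + n"] by (intro mult_left_mono mult_mono power_mono) auto
  qed
  finally show "\<bar>fps_nth (fps_nth F m) n\<bar> \<le> c * (2 * R) ^ (m + n)"
    by (simp add: power_mult_distrib power_add mult_ac)
qed (use R in simp)

lemma geo_bound_mono: "geo_bound M r F \<Longrightarrow> M \<le> M' \<Longrightarrow> r \<le> r' \<Longrightarrow> geo_bound M' r' F"
  unfolding geo_bound_def by (meson mult_mono order.trans power_mono less_imp_le zero_le_power order_less_le_trans)

lemma geo_bound_common:
  assumes "finite S" "\<And>F. F \<in> S \<Longrightarrow> \<exists>M r. geo_bound M r F"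
  shows "\<exists>M r. 0 \<le> M \<and> 0 < r \<and> (\<forall>F\<in>S. geo_bound M r F)"
  using assms
proof (induction S rule: finite_induct)
  case empty
  then show ?case by (intro exI[of _ 0] exI[of _ 1]) simp
next
  case (insert F S)
  then obtain M r M' r' where "0 \<le> M" "0 < r" "\<forall>F\<in>S. geo_bound M r F" "geo_bound M' r' F" by blast
  then show ?case
    by (intro exI[of _ "max M M'"] exI[of _ "max r r'"]) (auto intro: geo_bound_mono)
qed

text \<open>Right-hand sides without derivatives (\<open>tame0\<close>) and with first-order \<open>\<partial>\<^sub>2\<close>-derivatives (\<open>tame1\<close>).
  The bound \<open>D\<close> must not depend on \<open>R\<close>, so that a large \<open>R\<close> absorbs it.\<close>

definition tame0 :: "real \<Rightarrow> (('i \<Rightarrow> real fps fps) \<Rightarrow> real fps fps) \<Rightarrow> bool" where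
  "tame0 \<rho> f \<longleftrightarrow> 0 < \<rho> \<and>
     (\<forall>K>0. \<exists>D. \<forall>R\<ge>\<rho>. \<forall>U. (\<forall>i. maj0 R \<rho> K (U i)) \<longrightarrow> maj0 R \<rho> D (f U))"

definition tame1 :: "real \<Rightarrow> (('i \<Rightarrow> real fps fps) \<Rightarrow> real fps fps) \<Rightarrow> bool" where
  "tame1 \<rho> f \<longleftrightarrow> 0 < \<rho> \<and>
     (\<forall>K>0. \<exists>D. \<forall>R\<ge>\<rho>. \<forall>U. (\<forall>i. maj0 R \<rho> K (U i)) \<longrightarrow> maj1 R \<rho> D (f U))"

lemma tame0_var: "0 < \<rho> \<Longrightarrow> tame0 \<rho> (\<lambda>U. U i)"
  unfolding tame0_def by auto

lemma tame0_coeff: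
  assumes F: "geo_bound M r F"
  shows "tame0 (2 * r) (\<lambda>U. F)"
  unfolding tame0_def
proof (intro conjI allI impI exI[of _ "32 * M"])
  show "0 < 2 * r" using F by (simp add: geo_bound_def)
qed (rule geo_bound_maj0[OF F], auto)

lemma tame1_dy: "0 < \<rho> \<Longrightarrow> tame1 \<rho> (\<lambda>U. fps2_dy (U i))"
  unfolding tame1_def by (auto intro!: maj0_dy exI[of _ "\<rho> * _"])

lemma tame0_numeral: "0 < \<rho> \<Longrightarrow> tame0 \<rho> (\<lambda>U. numeral k)"
  unfolding tame0_def by (auto intro!: maj0_numeral exI[of _ "8 * numeral k"])

lemma tame0_diff:
  assumes "tame0 \<rho> f" "tame0 \<rho> g"
  shows "tame0 \<rho> (\<lambda>U. f U - g U)"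
  using assms maj0_diff unfolding tame0_def by (meson order_less_le_trans)

lemma tame0_mult:
  assumes "tame0 \<rho> f" "tame0 \<rho> g"
  shows "tame0 \<rho> (\<lambda>U. f U * g U)"
  using assms maj0_mult unfolding tame0_def by (meson order_less_le_trans)

lemma tame0_power:
  assumes "tame0 \<rho> f"
  shows "tame0 \<rho> (\<lambda>U. f U ^ n)"
  using assms maj0_power unfolding tame0_def by (meson order_less_le_trans)

lemma tame1_add:
  assumes "tame1 \<rho> f" "tame1 \<rho> g"
  shows "tame1 \<rho> (\<lambda>U. f U + g U)"
  using assms maj1_add unfolding tame1_def by (meson order_less_le_trans)

lemma tame1_diff:
  assumes "tame1 \<rho> f" "tame1 \<rho> g"
  shows "tame1 \<rho> (\<lambda>U. f U - g U)"
  using assms maj1_diff unfolding tame1_def by (meson order_less_le_trans)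

lemma tame1_mult:
  assumes "tame0 \<rho> f" "tame1 \<rho> g"
  shows "tame1 \<rho> (\<lambda>U. f U * g U)"
  using assms maj01_mult unfolding tame0_def tame1_def by (meson order_less_le_trans)

lemma tame1_tame0:
  assumes "tame0 \<rho> f"
  shows "tame1 \<rho> f"
  using assms maj0_maj1 unfolding tame0_def tame1_def by (meson order_less_le_trans)

text \<open>The scaled majorant \<open>K * Phi\<close> is a supersolution once \<open>R\<close> is
  large, because its \<partial>_1-derivative is \<open>K * R * Phi1\<close> while the right-hand
  side is bounded by \<open>D * Phi1\<close> with \<open>D\<close> independent of
  \<open>R\<close>.\<close>

theorem cauchy_kovalevskaya:
  fixes Op :: "('i::finite \<Rightarrow> real fps fps) \<Rightarrow> 'i \<Rightarrow> real fps fps" and U0 :: "'i \<Rightarrow> real fps"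
  assumes causal: "\<And>k U V i. (\<And>i. agree k (U i) (V i)) \<Longrightarrow> agree k (Op U i) (Op V i)"
    and init: "\<And>i. geo_bound M r (fps_const (U0 i))"
    and rho: "2 * r \<le> \<rho>"
    and tame: "\<And>i. tame1 \<rho> (\<lambda>U. Op U i)"
  obtains U where "\<And>i. fps_nth (U i) 0 = U0 i" "\<And>i. fps_deriv (U i) = Op U i"
    "\<And>i. \<exists>M r. geo_bound M r (U i)"
proof -
  have r: "r > 0" and M: "M \<ge> 0" using init by (auto simp: geo_bound_def)
  then have rho0: "\<rho> > 0" using rho by linarith
  \<comment> \<open>The initial data are majorized with constant \<open>32 * M\<close>; adding 1
    keeps \<open>K\<close> positive even if \<open>M\<close> vanishes.\<close>
  define K where "K = 32 * (M + 1)"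
  have K: "K > 0" using M by (simp add: K_def)
  obtain d where d: "\<And>R U i. R \<ge> \<rho> \<Longrightarrow> (\<And>i. maj0 R \<rho> K (U i)) \<Longrightarrow> maj1 R \<rho> (d i) (Op U i)"
  proof -
    have "\<exists>D. \<forall>R\<ge>\<rho>. \<forall>U. (\<forall>i. maj0 R \<rho> K (U i)) \<longrightarrow> maj1 R \<rho> D (Op U i)" for i
      using tame[of i] K by (auto simp: tame1_def)
    then have "\<exists>d. \<forall>i. \<forall>R\<ge>\<rho>. \<forall>U. (\<forall>i. maj0 R \<rho> K (U i)) \<longrightarrow> maj1 R \<rho> (d i) (Op U i)"
      by (intro choice allI)
    then show ?thesis using that by blast
  qed
  define D where "D = Max (range d)"
  have D: "maj1 R \<rho> D (Op U i)" if "R \<ge> \<rho>" "\<And>i. maj0 R \<rho> K (U i)" for R U i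
  proof -
    have "d i \<le> D" by (simp add: D_def)
    then have "d i * fps_nth (fps_nth (Phi1 R \<rho>) m) n \<le> D * fps_nth (fps_nth (Phi1 R \<rho>) m) n" for m n
      using Phi1_pos[of R \<rho> m n] rho0 that(1) by (intro mult_right_mono) auto
    then show ?thesis using d[OF that, of i] unfolding maj1_def by (meson order_trans)
  qed
  \<comment> \<open>\<open>D\<close> holds for all admissible \<open>R\<close> at once, so
    \<open>R\<close> may be chosen after \<open>D\<close>.\<close>
  define R where "R = max \<rho> (D / K)"
  have R: "R > 0" "\<rho> \<le> R" "D / K \<le> R" using rho0 by (auto simp: R_def)
  define B where "B = fps_const (fps_const K) * Phi R \<rho>"
  have B: "fps_nth (fps_nth B m) n = K * fps_nth (fps_nth (Phi R \<rho>) m) n" for m n by (simp add: B_def)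
  have maj: "majorized F B \<longleftrightarrow> maj0 R \<rho> K F" for F by (simp add: majorized_def maj0_def B)
  obtain U where U: "\<And>i. fps_nth (U i) 0 = U0 i" "\<And>i. fps_deriv (U i) = Op U i" "\<And>i. majorized (U i) B"
  proof (rule evolution_exists[of Op U0 B])
    show "agree k (Op U i) (Op V i)" if "\<And>i. agree k (U i) (V i)" for k U V i
      by (rule causal) (rule that)
    show "\<bar>fps_nth (U0 i) n\<bar> \<le> fps_nth (fps_nth B 0) n" for i n
    proof -
      have "maj0 R \<rho> (32 * M) (fps_const (U0 i))" using geo_bound_maj0[OF init rho R(2)] .
      then have "\<bar>fps_nth (U0 i) n\<bar> \<le> 32 * M * fps_nth (fps_nth (Phi R \<rho>) 0) n"
        unfolding maj0_def by (auto dest: spec[of _ 0])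
      also have "\<dots> \<le> K * fps_nth (fps_nth (Phi R \<rho>) 0) n"
        using Phi_pos[OF R(1) rho0, of 0 n] by (intro mult_right_mono) (auto simp: K_def)
      finally show ?thesis by (simp add: B)
    qed
    show "majorized (Op U i) (fps_deriv B)" if "\<And>i. majorized (U i) B" for U i
      unfolding majorized_def
    proof (intro allI)
      fix m n
      have "\<bar>fps_nth (fps_nth (Op U i) m) n\<bar> \<le> D * fps_nth (fps_nth (Phi1 R \<rho>) m) n"
        using D[OF R(2), of U i] that unfolding maj maj1_def by blast
      also have "\<dots> \<le> (K * R) * fps_nth (fps_nth (Phi1 R \<rho>) m) n"
        using R(3) K less_imp_le[OF Phi1_pos[OF R(1) rho0]] by (intro mult_right_mono) (auto simp: field_simps)
      also have "\<dots> = fps_nth (fps_nth (fps_deriv B) m) n"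
        using deriv_Phi[of R \<rho> m n] by (simp add: B_def del: fps_deriv_nth)
      finally show "\<bar>fps_nth (fps_nth (Op U i) m) n\<bar> \<le> fps_nth (fps_nth (fps_deriv B) m) n" .
    qed
    show "0 \<le> fps_nth (fps_nth B m) n" for m n
      using K less_imp_le[OF Phi_pos[OF R(1) rho0]] by (simp add: B)
  qed (rule that)
  show ?thesis
    by (rule that[of U]) (use U maj0_geo_bound[OF _ R(1) rho0 R(2)] maj in blast)+
qed

section \<open>The two equations\<close>

lemma fps2_term_initial: "fps2_term F 0 t = fps2_term (fps_const (fps_nth F 0)) s t"
  by (auto simp: fps2_term_def fun_eq_iff)

lemma filterlim_initial_line: "filterlim (\<lambda>x. vector [p $ 1, x $ 2]) (nhds p) (nhds (p :: real ^ 2))"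
proof -
  have t: "((\<lambda>x. \<chi> i::2. if i = 1 then p $ 1 else x $ 2) \<longlongrightarrow> (\<chi> i. if i = 1 then p $ 1 else p $ 2)) (nhds p)"
    by (intro tendsto_vec_lambda) (auto intro!: tendsto_vec_nth filterlim_ident)
  have e: "(\<chi> i. if i = 1 then a else b) = (vector [a, b] :: real ^ 2)" for a b
    by (simp add: vec_eq_iff forall_2)
  have e': "vector [p $ 1, p $ 2] = p" by (simp add: vec_eq_iff forall_2)
  show ?thesis using t unfolding e e' .
qed

lemma has_fps2_restrict:
  assumes f: "has_fps2 f p F"
  shows "has_fps2 (\<lambda>x. f (vector [p $ 1, x $ 2])) p (fps_const (fps_nth F 0))"
proof -
  have "\<forall>\<^sub>F x in nhds p. (\<lambda>y. (fps2_term F (y $ 1 - p $ 1) (y $ 2 - p $ 2) has_sum f y) UNIV) (vector [p $ 1, x $ 2])"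
    using f unfolding has_fps2_def by (rule eventually_compose_filterlim[OF _ filterlim_initial_line])
  then show ?thesis
    unfolding has_fps2_def
  proof eventually_elim
    case (elim x)
    then show ?case by (simp add: fps2_term_initial[of F _ "x $ 1 - p $ 1"])
  qed
qed

text \<open>One direction evaluates both series at zero displacement in \<open>x\<^sup>1\<close>;
  the other extends the restriction to the initial line constantly in \<open>x\<^sup>1\<close> and
  uses uniqueness of the series.\<close>

lemma initial_value_iff:
  assumes f: "has_fps2 f p F" and h: "has_fps2 (\<lambda>x. h (x $ 2)) p (fps_const C)"
  shows "fps_nth F 0 = C \<longleftrightarrow> (\<forall>\<^sub>F x in nhds p. x $ 1 = p $ 1 \<longrightarrow> f x = h (x $ 2))"
proof
  assume C: "fps_nth F 0 = C"
  show "\<forall>\<^sub>F x in nhds p. x $ 1 = p $ 1 \<longrightarrow> f x = h (x $ 2)"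
    using f h unfolding has_fps2_def
    by eventually_elim (auto simp: fps2_term_initial[of F _ 0] C intro: has_sum_unique)
next
  assume ev: "\<forall>\<^sub>F x in nhds p. x $ 1 = p $ 1 \<longrightarrow> f x = h (x $ 2)"
  have "\<forall>\<^sub>F x in nhds p. f (vector [p $ 1, x $ 2]) = h (x $ 2)"
    using eventually_compose_filterlim[OF ev filterlim_initial_line] by simp
  from has_fps2_cong[OF has_fps2_restrict[OF f] this] have "fps_const (fps_nth F 0) = fps_const C"
    using has_fps2_unique h by blast
  then show "fps_nth F 0 = C" by simp
qed

section \<open>The first equation\<close>

lemma P1_fps:
  assumes G: "\<And>i j k. has_fps2 (\<Gamma> i j k) p (G i j k)" and X: "has_fps2 \<xi> p X"
  shows "has_fps2 (P1 \<Gamma> \<xi>) p (- fps_deriv X + X * fps2_dy X + G 2 2 1 * X ^ 3 - (2 * G 1 2 1 - G 2 2 2) * X ^ 2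
     + (G 1 1 1 - 2 * G 1 2 2) * X + G 1 1 2)"
proof -
  have "has_fps2 (\<lambda>x. P1 \<Gamma> \<xi> x) p (- fps_deriv X + X * fps2_dy X + G 2 2 1 * X ^ 3 - (2 * G 1 2 1 - G 2 2 2) * X ^ 2
     + (G 1 1 1 - 2 * G 1 2 2) * X + G 1 1 2)"
    unfolding P1_def Let_def D_def
    by (simp, intro has_fps2_add has_fps2_diff has_fps2_mult has_fps2_minus has_fps2_power has_fps2_numeral
        has_fps2_partial G X)
  then show ?thesis .
qed

text \<open>Solved for the \<partial>_1-derivative of \<xi>, the equation is a system with a single
  unknown, hence the index type \<open>unit\<close>. One geometric bound is taken for all
  coefficients and the initial value together.\<close>

lemma P1_exists:
  assumes \<Gamma>: "\<And>i j k. real_analytic_at (\<Gamma> i j k) p" and \<xi>0: "real_analytic_at \<xi>0 (p $ 2)"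
  obtains \<xi> where "real_analytic_at \<xi> p" "\<forall>\<^sub>F x in nhds p. P1 \<Gamma> \<xi> x = 0"
    "\<forall>\<^sub>F x in nhds p. x $ 1 = p $ 1 \<longrightarrow> \<xi> x = \<xi>0 (x $ 2)"
proof -
  obtain G where G: "\<And>i j k. has_fps2 (\<Gamma> i j k) p (G i j k)"
    using \<Gamma> unfolding real_analytic_at_iff by metis
  obtain C where C: "has_fps2 (\<lambda>x. \<xi>0 (x $ 2)) p (fps_const C)" using real_analytic_at_1d[OF \<xi>0] .
  define S where "S = insert (fps_const C) ((\<lambda>(i, j, k). G i j k) ` UNIV)"
  have "\<exists>M r. geo_bound M r F" if "F \<in> S" for F
    using that has_fps2_geo_bound[OF C] has_fps2_geo_bound[OF G] unfolding S_def by auto metis+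
  then obtain M r where r: "0 < r" and S: "\<And>F. F \<in> S \<Longrightarrow> geo_bound M r F"
    using geo_bound_common[of S] by (metis S_def finite finite_imageI finite_insert)
  define Op where "Op U i = U i * fps2_dy (U i) + G 2 2 1 * U i ^ 3 - (2 * G 1 2 1 - G 2 2 2) * U i ^ 2
     + (G 1 1 1 - 2 * G 1 2 2) * U i + G 1 1 2" for U and i :: unit
  have tG: "tame0 (2 * r) (\<lambda>U. G i j k)" for i j k
    by (rule tame0_coeff[OF S], unfold S_def, rule insertI2, rule image_eqI[of _ _ "(i, j, k)"]) auto
  obtain U where U: "fps_nth (U ()) 0 = C" "fps_deriv (U ()) = Op U ()" "\<exists>M r. geo_bound M r (U ())"
  proof (rule cauchy_kovalevskaya[of Op M r "\<lambda>_. C" "2 * r"])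
    show "agree k (Op U i) (Op V i)" if "\<And>i. agree k (U i) (V i)" for k U V i
      unfolding Op_def by (intro agree_intros that)
    show "tame1 (2 * r) (\<lambda>U. Op U i)" for i
      unfolding Op_def
      by (intro tame1_add tame1_diff tame1_mult[OF tame0_var tame1_dy] tame1_tame0 tame0_mult tame0_diff
          tame0_power tame0_numeral tG tame0_var) (use r in auto)
    show "geo_bound M r (fps_const C)" by (rule S) (simp add: S_def)
  qed auto
  then obtain M' r' where "geo_bound M' r' (U ())" by blast
  then obtain \<xi> where \<xi>: "has_fps2 \<xi> p (U ())" using geo_bound_has_fps2 by blast
  show ?thesis
  proof (rule that[of \<xi>])
    show "real_analytic_at \<xi> p" using \<xi> real_analytic_at_iff by blast
    show "\<forall>\<^sub>F x in nhds p. P1 \<Gamma> \<xi> x = 0"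
      using has_fps2_zero_iff[OF P1_fps[where \<Gamma> = \<Gamma> and G = G, OF G \<xi>]] U(2) by (simp add: Op_def algebra_simps)
    show "\<forall>\<^sub>F x in nhds p. x $ 1 = p $ 1 \<longrightarrow> \<xi> x = \<xi>0 (x $ 2)"
      using initial_value_iff[OF \<xi> C] U(1) by blast
  qed
qed

lemma has_fps2_eventually_eq: "has_fps2 f p F \<Longrightarrow> has_fps2 g p F \<Longrightarrow> \<forall>\<^sub>F x in nhds p. f x = g x"
  using has_fps2_zero_iff[OF has_fps2_diff, of f p F g F] by simp

lemma P1_unique:
  assumes \<Gamma>: "\<And>i j k. real_analytic_at (\<Gamma> i j k) p" and \<xi>0: "real_analytic_at \<xi>0 (p $ 2)"
    and an: "real_analytic_at \<xi> p" "real_analytic_at \<xi>' p"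
    and P: "\<forall>\<^sub>F x in nhds p. P1 \<Gamma> \<xi> x = 0" "\<forall>\<^sub>F x in nhds p. P1 \<Gamma> \<xi>' x = 0"
    and init: "\<forall>\<^sub>F x in nhds p. x $ 1 = p $ 1 \<longrightarrow> \<xi> x = \<xi>0 (x $ 2)"
      "\<forall>\<^sub>F x in nhds p. x $ 1 = p $ 1 \<longrightarrow> \<xi>' x = \<xi>0 (x $ 2)"
  shows "\<forall>\<^sub>F x in nhds p. \<xi> x = \<xi>' x"
proof -
  obtain G where G: "\<And>i j k. has_fps2 (\<Gamma> i j k) p (G i j k)"
    using \<Gamma> unfolding real_analytic_at_iff by metis
  obtain C where C: "has_fps2 (\<lambda>x. \<xi>0 (x $ 2)) p (fps_const C)" using real_analytic_at_1d[OF \<xi>0] .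
  obtain X X' where X: "has_fps2 \<xi> p X" "has_fps2 \<xi>' p X'" using an unfolding real_analytic_at_iff by metis
  define Op where "Op U i = U i * fps2_dy (U i) + G 2 2 1 * U i ^ 3 - (2 * G 1 2 1 - G 2 2 2) * U i ^ 2
     + (G 1 1 1 - 2 * G 1 2 2) * U i + G 1 1 2" for U and i :: unit
  have "X = X'"
  proof (rule evolution_unique[of Op "\<lambda>_. X" "\<lambda>_. X'"])
    show "agree k (Op U i) (Op V i)" if "\<And>i. agree k (U i) (V i)" for k U V i
      unfolding Op_def by (intro agree_intros that)
    show "fps_nth X 0 = fps_nth X' 0" using initial_value_iff[OF X(1) C] initial_value_iff[OF X(2) C] init by simp
    show "fps_deriv X = Op (\<lambda>_. X) i" "fps_deriv X' = Op (\<lambda>_. X') i" for i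
      using has_fps2_zero_iff[OF P1_fps[where \<Gamma> = \<Gamma> and G = G, OF G X(1)]] has_fps2_zero_iff[OF P1_fps[where \<Gamma> = \<Gamma> and G = G, OF G X(2)]] P
      by (simp_all add: Op_def algebra_simps)
  qed
  then show ?thesis using X has_fps2_eventually_eq by blast
qed

section \<open>The second equation\<close>

lemma fps2_dx_dy: "fps2_dy (fps_deriv F) = fps_deriv (fps2_dy F)"
  by (rule fps2_eqI) (simp add: fps2_dx_nth fps2_dy_nth del: fps_deriv_nth)

lemma fps2_dy_mult: "fps2_dy (F * G) = fps2_dy F * G + F * fps2_dy G"
  by (rule fps_ext) (simp add: fps2_dy_def fps_mult_nth fps_deriv_sum sum.distrib)

lemma geo_bound_fps_mult:
  assumes "geo_bound M r F" "geo_bound M' r' G"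
  shows "\<exists>M r. geo_bound M r (F * G)"
  using has_fps2_geo_bound[OF has_fps2_mult[OF geo_bound_has_fps2[OF assms(1), of 0] geo_bound_has_fps2[OF assms(2), of 0]]]
  by metis

text \<open>Needed for the initial values of the logarithmic derivatives. A reciprocal has positive
  radius of convergence, and absolute convergence at some \<open>e\<close> inside it gives back a
  geometric bound.\<close>

lemma geo_bound_inverse:
  assumes A: "geo_bound M r (fps_const A)" and A0: "fps_nth A 0 \<noteq> 0"
  shows "\<exists>M r. geo_bound M r (fps_const (inverse A))"
proof -
  have r: "r > 0" and M: "M \<ge> 0" and bd: "\<bar>fps_nth A n\<bar> \<le> M * r ^ n" for n
    using A by (auto simp: geo_bound_def dest: spec[of _ 0])
  have "summable (\<lambda>n. fps_nth A n * (1 / (2 * r)) ^ n)"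
  proof (rule summable_comparison_test')
    show "summable (\<lambda>n. M * (1 / 2) ^ n)" by (intro summable_mult summable_geometric) simp
    fix n
    have "\<bar>fps_nth A n\<bar> * (1 / (2 * r)) ^ n \<le> (M * r ^ n) * (1 / (2 * r)) ^ n"
      using bd r by (intro mult_right_mono) auto
    also have "\<dots> = M * (1 / 2) ^ n" using r by (simp add: power_mult_distrib power_divide)
    finally show "norm (fps_nth A n * (1 / (2 * r)) ^ n) \<le> M * (1 / 2) ^ n"
      using r by (simp add: abs_mult power_abs)
  qed
  from conv_radius_geI[OF this] have "fps_conv_radius A \<ge> ereal (1 / (2 * r))"
    using r by (simp add: fps_conv_radius_def)
  then have "fps_conv_radius A > 0" using r by (metis ereal_less(2) half_gt_zero less_le_trans zero_less_divide_1_iff mult_pos_pos zero_less_numeral)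
  then have pos: "fps_conv_radius (inverse A) > 0" by (rule fps_conv_radius_inverse_pos[OF A0])
  obtain e where e: "e > 0" "ereal e < fps_conv_radius (inverse A)"
    using ereal_dense2[OF pos] by (metis ereal_less(2) )
  have s: "summable (\<lambda>n. norm (fps_nth (inverse A) n * e ^ n))"
    using e by (intro abs_summable_in_conv_radius) (auto simp: fps_conv_radius_def)
  define M' where "M' = (\<Sum>n. norm (fps_nth (inverse A) n * e ^ n))"
  have M': "\<bar>fps_nth (inverse A) n\<bar> * e ^ n \<le> M'" for n
    using sum_le_suminf[OF s, of "{n}"] e by (simp add: M'_def abs_mult)
  have nn: "M' \<ge> 0" unfolding M'_def by (intro suminf_nonneg s) simp
  have "geo_bound M' (1 / e) (fps_const (inverse A))"
    unfolding geo_bound_def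
  proof (intro conjI allI)
    fix m n
    have "\<bar>fps_nth (inverse A) n\<bar> \<le> M' * (1 / e) ^ n" using M'[of n] e by (simp add: field_simps power_divide)
    then show "\<bar>fps_nth (fps_nth (fps_const (inverse A)) m) n\<bar> \<le> M' * (1 / e) ^ (m + n)"
      using nn e by (cases "m = 0") auto
  qed (use nn e in auto)
  then show ?thesis by blast
qed

text \<open>\<open>C1\<close>, \<open>C2\<close> and \<open>C0\<close> collect the coefficients of
  -\<alpha>\<alpha>^(1,0), \<alpha>\<alpha>^(0,1) and \<alpha>^2, which do not contain \<alpha>. The
  first summand holds the only second \<partial>_1-derivative.\<close>

definition fps2_P2 :: "real fps fps \<Rightarrow> real fps fps \<Rightarrow> real fps fps \<Rightarrow> real fps fps \<Rightarrow> real fps fps \<Rightarrow> real fps fps" where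
  "fps2_P2 C0 C1 C2 X A = A * fps_deriv (fps_deriv A) + (X ^ 2 * A * fps2_dy (fps2_dy A) - 2 * X * A * fps_deriv (fps2_dy A)
     + fps_deriv A ^ 2 + X ^ 2 * fps2_dy A ^ 2 - 2 * X * fps_deriv A * fps2_dy A
     - A * fps_deriv A * C1 + A * fps2_dy A * C2 + A ^ 2 * C0)"

lemma real_analytic_at_arith:
  fixes f g :: "real ^ 2 \<Rightarrow> real"
  assumes "real_analytic_at f a" "real_analytic_at g a"
  shows real_analytic_at_diff: "real_analytic_at (\<lambda>x. f x - g x) a"
    and real_analytic_at_mult: "real_analytic_at (\<lambda>x. f x * g x) a"
  using assms has_fps2_diff has_fps2_mult unfolding real_analytic_at_iff by blast+

lemma real_analytic_at_const: "real_analytic_at (\<lambda>x :: 'a::euclidean_space. k :: 'b::real_normed_vector) a"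
proof -
  let ?m = "restrict (\<lambda>_. 0) Basis :: 'a \<Rightarrow> nat"
  have "((\<lambda>m. (\<Prod>b\<in>Basis. ((x - a) \<bullet> b) ^ m b) *\<^sub>R (if m = ?m then k else 0)) has_sum k) (Basis \<rightarrow>\<^sub>E UNIV)" for x :: 'a
    by (rule has_sum_finite_neutralI[of "{?m}"]) (auto simp: prod.neutral)
  then show ?thesis
    unfolding real_analytic_at_def by (intro exI[of _ 1] conjI exI[of _ "\<lambda>m. if m = ?m then k else 0"]) auto
qed

lemma real_analytic_at_power:
  fixes f :: "real ^ 2 \<Rightarrow> real"
  shows "real_analytic_at f a \<Longrightarrow> real_analytic_at (\<lambda>x. f x ^ n) a"
  using has_fps2_power unfolding real_analytic_at_iff by blast

lemmas real_analytic_intros = real_analytic_at_add real_analytic_at_diff real_analytic_at_mult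
  real_analytic_at_power real_analytic_at_partial real_analytic_at_const

lemma P2_fps:
  assumes G: "\<And>i j k. has_fps2 (\<Gamma> i j k) p (G i j k)" and X: "has_fps2 \<xi> p X"
  obtains C0 C1 C2 where "\<And>\<alpha> A. has_fps2 \<alpha> p A \<Longrightarrow> has_fps2 (P2 \<Gamma> \<xi> \<alpha>) p (fps2_P2 C0 C1 C2 X A)"
    "\<exists>M r. geo_bound M r C0" "\<exists>M r. geo_bound M r C1" "\<exists>M r. geo_bound M r C2"
proof -
  note intros = has_fps2_add has_fps2_diff has_fps2_mult has_fps2_minus has_fps2_power has_fps2_numeral
        has_fps2_partial G X
  define c1 where "c1 x = 2 * partial 2 \<xi> x - 5 * \<Gamma> 2 2 1 x * (\<xi> x)\<^sup>2 + 2 * (4 * \<Gamma> 1 2 1 x - \<Gamma> 2 2 2 x) * \<xi> x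
                     - 3 * \<Gamma> 1 1 1 x + 2 * \<Gamma> 1 2 2 x" for x
  define c2 where "c2 x = 2 * \<xi> x * partial 2 \<xi> x - 6 * \<Gamma> 2 2 1 x * \<xi> x ^ 3 + (10 * \<Gamma> 1 2 1 x - 3 * \<Gamma> 2 2 2 x) * (\<xi> x)\<^sup>2
                     - 4 * (\<Gamma> 1 1 1 x - \<Gamma> 1 2 2 x) * \<xi> x - \<Gamma> 1 1 2 x" for x
  define c0 where "c0 x = 6 * \<xi> x ^ 4 * (\<Gamma> 2 2 1 x) ^ 2
       - 2 * \<xi> x ^ 3 * (partial 2 (\<Gamma> 2 2 1) x + 9 * \<Gamma> 1 2 1 x * \<Gamma> 2 2 1 x - 3 * \<Gamma> 2 2 1 x * \<Gamma> 2 2 2 x)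
       - \<xi> x ^ 2 * (4 * \<Gamma> 2 2 1 x * partial 2 \<xi> x - 3 * partial 2 (\<Gamma> 1 2 1) x - 2 * partial 1 (\<Gamma> 2 2 1) x + partial 2 (\<Gamma> 2 2 2) x
                        - 12 * (\<Gamma> 1 2 1 x) ^ 2 - (\<Gamma> 2 2 2 x) ^ 2 - 7 * \<Gamma> 1 1 1 x * \<Gamma> 2 2 1 x
                        + 7 * \<Gamma> 1 2 1 x * \<Gamma> 2 2 2 x + 9 * \<Gamma> 1 2 2 x * \<Gamma> 2 2 1 x)
       + \<xi> x * (2 * (3 * \<Gamma> 1 2 1 x - \<Gamma> 2 2 2 x) * partial 2 \<xi> x - partial 2 (\<Gamma> 1 1 1) x - 3 * partial 1 (\<Gamma> 1 2 1) x
                    + partial 2 (\<Gamma> 1 2 2) x + partial 1 (\<Gamma> 2 2 2) x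
                    - 2 * (\<Gamma> 1 1 1 x - \<Gamma> 1 2 2 x) * (4 * \<Gamma> 1 2 1 x - \<Gamma> 2 2 2 x) + 4 * \<Gamma> 1 1 2 x * \<Gamma> 2 2 1 x)
       - (2 * (\<Gamma> 1 1 1 x - \<Gamma> 1 2 2 x) * partial 2 \<xi> x - partial 1 (\<Gamma> 1 1 1) x + partial 1 (\<Gamma> 1 2 2) x
                - (\<Gamma> 1 1 1 x) ^ 2 + \<Gamma> 1 1 1 x * \<Gamma> 1 2 2 x + 3 * \<Gamma> 1 1 2 x * \<Gamma> 1 2 1 x - \<Gamma> 1 1 2 x * \<Gamma> 2 2 2 x)" for x
  have an: "real_analytic_at (\<Gamma> i j k) p" "real_analytic_at \<xi> p" for i j k
    using G X real_analytic_at_iff by blast+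
  have "real_analytic_at c1 p" "real_analytic_at c2 p" "real_analytic_at c0 p"
    unfolding c1_def[abs_def] c2_def[abs_def] c0_def[abs_def] by (intro real_analytic_intros an)+
  then obtain C0 C1 C2 where C: "has_fps2 c0 p C0" "has_fps2 c1 p C1" "has_fps2 c2 p C2"
    unfolding real_analytic_at_iff by blast
  show ?thesis
  proof (rule that)
    fix \<alpha> A assume A: "has_fps2 \<alpha> p A"
    have "P2 \<Gamma> \<xi> \<alpha> x = \<alpha> x * partial 1 (partial 1 \<alpha>) x + ((\<xi> x) ^ 2 * \<alpha> x * partial 2 (partial 2 \<alpha>) x
       - 2 * \<xi> x * \<alpha> x * partial 1 (partial 2 \<alpha>) x
       + (partial 1 \<alpha> x) ^ 2 + (\<xi> x) ^ 2 * (partial 2 \<alpha> x) ^ 2 - 2 * \<xi> x * partial 1 \<alpha> x * partial 2 \<alpha> x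
       - \<alpha> x * partial 1 \<alpha> x * c1 x + \<alpha> x * partial 2 \<alpha> x * c2 x + (\<alpha> x) ^ 2 * c0 x)" for x
      unfolding P2_def Let_def D_def c0_def c1_def c2_def
      by (simp add: eval_nat_numeral) (simp add: algebra_simps)
    then have "P2 \<Gamma> \<xi> \<alpha> = (\<lambda>x. \<alpha> x * partial 1 (partial 1 \<alpha>) x + ((\<xi> x) ^ 2 * \<alpha> x * partial 2 (partial 2 \<alpha>) x
       - 2 * \<xi> x * \<alpha> x * partial 1 (partial 2 \<alpha>) x
       + (partial 1 \<alpha> x) ^ 2 + (\<xi> x) ^ 2 * (partial 2 \<alpha> x) ^ 2 - 2 * \<xi> x * partial 1 \<alpha> x * partial 2 \<alpha> x
       - \<alpha> x * partial 1 \<alpha> x * c1 x + \<alpha> x * partial 2 \<alpha> x * c2 x + (\<alpha> x) ^ 2 * c0 x))" by auto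
    then show "has_fps2 (P2 \<Gamma> \<xi> \<alpha>) p (fps2_P2 C0 C1 C2 X A)"
      unfolding fps2_P2_def by (simp only:) (intro intros A C)
  qed (use C has_fps2_geo_bound in metis)+
qed

text \<open>Dividing by \<open>\<alpha>\<^sup>2\<close> turns the second-order equation into a first-order system for the
  logarithmic derivatives \<open>h = \<alpha>\<^sub>1 / \<alpha>\<close> and \<open>k = \<alpha>\<^sub>2 / \<alpha>\<close>.\<close>

lemma fps2_P2_exists:
  assumes b: "geo_bound M0 r0 (fps_const A0)" "geo_bound M1 r1 (fps_const A1)"
    "\<exists>M r. geo_bound M r C0" "\<exists>M r. geo_bound M r C1" "\<exists>M r. geo_bound M r C2" "\<exists>M r. geo_bound M r X"
    and A0: "fps_nth A0 0 \<noteq> 0"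
  obtains A where "fps_nth A 0 = A0" "fps_nth A 1 = A1" "\<exists>M r. geo_bound M r A" "fps2_P2 C0 C1 C2 X A = 0"
proof -
  \<comment> \<open>Index 1 is \<alpha>, index 2 is h, index 3 is k; the last two start from the
    quotients of the prescribed data by \<alpha>0.\<close>
  define U0 where "U0 i = (if i = 1 then A0 else if i = 2 then A1 * inverse A0 else fps_deriv A0 * inverse A0)" for i :: 3
  have dA: "fps_const (fps_deriv A0) = fps2_dy (fps_const A0)"
    by (rule fps_ext) (simp add: fps2_dy_def)
  obtain Mi ri where inv: "geo_bound Mi ri (fps_const (inverse A0))" using geo_bound_inverse[OF b(1) A0] by blast
  have A1: "\<exists>M r. geo_bound M r (fps_const (A1 * inverse A0))"
    using geo_bound_fps_mult[OF b(2) inv] by simp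
  have A2: "\<exists>M r. geo_bound M r (fps_const (fps_deriv A0 * inverse A0))"
    using geo_bound_fps_mult[OF geo_bound_deriv(2)[OF b(1)] inv] unfolding dA[symmetric] by simp
  have cases: "\<exists>M r. Q M r (if c then x else if d then y else z)"
    if "\<exists>M r. Q M r x" "\<exists>M r. Q M r y" "\<exists>M r. Q M r z" for Q and c d and x y z :: "real fps"
    using that by (cases c; cases d) simp_all
  have A0': "\<exists>M r. geo_bound M r (fps_const A0)" using b(1) by blast
  have U0: "\<exists>M r. geo_bound M r (fps_const (U0 i))" for i
    unfolding U0_def by (rule cases[of "\<lambda>M r F. geo_bound M r (fps_const F)", OF A0' A1 A2])
  define S where "S = {C0, C1, C2, X} \<union> range (\<lambda>i. fps_const (U0 i))"
  have fin: "finite S" by (simp add: S_def)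
  have "\<exists>M r. geo_bound M r F" if "F \<in> S" for F
    using that unfolding S_def
  proof (elim UnE insertE emptyE rangeE)
    show "\<exists>M r. geo_bound M r F" if "F = fps_const (U0 i)" for i unfolding that by (rule U0)
  qed (simp_all only: b)
  then obtain M r where r: "0 < r" and S: "\<And>F. F \<in> S \<Longrightarrow> geo_bound M r F"
    using geo_bound_common[OF fin] by blast
  \<comment> \<open>The quotients of \<alpha>_11, \<alpha>_12, \<alpha>_22 by \<alpha> are h_1 +
    h^2, h_2 + hk, k_2 + k^2. Inserting them and solving for h_1 gives the second line; the third,
    k_1 = h_2, expresses equality of mixed derivatives.\<close>
  define Op where "Op U i = (if i = 1 then U 2 * U 1
     else if i = 2 then 2 * X * fps2_dy (U 2) - X ^ 2 * fps2_dy (U 3)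
       + (U 2 * C1 - U 3 * C2 - C0 - 2 * U 2 ^ 2 - 2 * X ^ 2 * U 3 ^ 2 + 4 * X * U 2 * U 3)
     else fps2_dy (U 2))" for U :: "3 \<Rightarrow> real fps fps" and i :: 3
  have t: "tame0 (2 * r) (\<lambda>U. F)" if "F \<in> S" for F by (rule tame0_coeff[OF S[OF that]])
  obtain U where U: "\<And>i. fps_nth (U i) 0 = U0 i" "\<And>i. fps_deriv (U i) = Op U i" "\<And>i. \<exists>M r. geo_bound M r (U i)"
  proof (rule cauchy_kovalevskaya[of Op M r U0 "2 * r"])
    show "agree k (Op U i) (Op V i)" if "\<And>i. agree k (U i) (V i)" for k U V i
      unfolding Op_def by (auto intro!: agree_intros that)
    have 1: "tame1 (2 * r) (\<lambda>U :: 3 \<Rightarrow> real fps fps. U 2 * U 1)"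
      by (intro tame1_tame0 tame0_mult tame0_var) (use r in auto)
    have 2: "tame1 (2 * r) (\<lambda>U :: 3 \<Rightarrow> real fps fps. 2 * X * fps2_dy (U 2) - X ^ 2 * fps2_dy (U 3)
       + (U 2 * C1 - U 3 * C2 - C0 - 2 * U 2 ^ 2 - 2 * X ^ 2 * U 3 ^ 2 + 4 * X * U 2 * U 3))"
      by (intro tame1_add tame1_diff tame1_mult[OF _ tame1_dy] tame1_tame0 tame0_mult tame0_diff
          tame0_power tame0_numeral t tame0_var) (use r in \<open>auto simp: S_def\<close>)
    have 3: "tame1 (2 * r) (\<lambda>U :: 3 \<Rightarrow> real fps fps. fps2_dy (U 2))"
      by (rule tame1_dy) (use r in auto)
    show "tame1 (2 * r) (\<lambda>U. Op U i)" for i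
      using 1 2 3 exhaust_3[of i] unfolding Op_def by auto
    show "geo_bound M r (fps_const (U0 i))" for i by (rule S) (simp add: S_def)
  qed (use that in auto)
  define A h k where "A = U 1" and "h = U 2" and "k = U 3"
  have dA: "fps_deriv A = h * A" using U(2)[of 1] by (simp add: Op_def A_def h_def)
  have dh: "fps_deriv h = 2 * X * fps2_dy h - X ^ 2 * fps2_dy k
       + (h * C1 - k * C2 - C0 - 2 * h ^ 2 - 2 * X ^ 2 * k ^ 2 + 4 * X * h * k)"
    using U(2)[of 2] by (simp add: Op_def h_def k_def)
  have dk: "fps_deriv k = fps2_dy h" using U(2)[of 3] by (simp add: Op_def h_def k_def)
  have i: "fps_nth A 0 = A0" "fps_nth h 0 = A1 * inverse A0" "fps_nth k 0 = fps_deriv A0 * inverse A0"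
    using U(1)[of 1] U(1)[of 2] U(1)[of 3] by (simp_all add: U0_def A_def h_def k_def)
  have inv: "inverse A0 * A0 = 1" by (rule inverse_mult_eq_1[OF A0])
  \<comment> \<open>The system does not contain the relation \<alpha>_2 = k\<alpha>. Its defect
    \<open>E\<close> solves E_1 = hE with zero initial value and so vanishes.\<close>
  define E where "E = fps2_dy A - k * A"
  have "E = 0"
  proof (rule evolution_unique[of "\<lambda>U i. h * U i" "\<lambda>_ :: unit. E" "\<lambda>_. 0"])
    show "agree n (h * U i) (h * V i)" if "\<And>i. agree n (U i) (V i)" for n i and U V :: "unit \<Rightarrow> real fps fps"
      by (intro agree_intros that)
    show "fps_nth E 0 = fps_nth 0 0"
      using inv by (simp add: E_def i fps2_dy_def mult.assoc)
    have "fps_deriv (fps2_dy A) = fps2_dy h * A + h * fps2_dy A"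
      unfolding fps2_dx_dy[symmetric] dA fps2_dy_mult by simp
    then show "fps_deriv E = h * E"
      by (simp add: E_def dA dk algebra_simps)
    show "fps_deriv 0 = h * 0" by simp
  qed
  then have dyA: "fps2_dy A = k * A" by (simp add: E_def)
  have d2: "fps_deriv (fps_deriv A) = fps_deriv h * A + h * (h * A)"
    "fps2_dy (fps2_dy A) = fps2_dy k * A + k * (k * A)"
    "fps_deriv (fps2_dy A) = fps2_dy h * A + k * (h * A)"
    unfolding dA dyA fps2_dy_mult fps_deriv_mult dk by (simp_all add: algebra_simps)
  show ?thesis
  proof (rule that[of A])
    show "fps_nth A 0 = A0" by (rule i)
    show "fps_nth A 1 = A1"
    proof -
      have "fps_nth (fps_deriv A) 0 = fps_nth (h * A) 0" by (simp only: dA)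
      then show ?thesis using inv by (simp add: i mult.assoc)
    qed
    show "\<exists>M r. geo_bound M r A" unfolding A_def by (rule U(3))
    show "fps2_P2 C0 C1 C2 X A = 0"
      unfolding fps2_P2_def d2 unfolding dyA dA dh by (simp add: algebra_simps power2_eq_square)
  qed
qed

text \<open>The k-th coefficient of the product is the constant term of \<open>A\<close> times the
  k-th coefficient of \<open>F\<close>, plus terms already known to agree. A nonzero constant term
  can be cancelled.\<close>

lemma agree_mult_cancel:
  fixes A A' F F' :: "'a::idom fps"
  assumes "agree (Suc k) (A * F) (A' * F')" "agree (Suc k) A A'" "agree k F F'" "fps_nth A 0 \<noteq> 0"
  shows "agree (Suc k) F F'"
proof -
  have s: "fps_nth (B * H) k = fps_nth B 0 * fps_nth H k + (\<Sum>i\<in>{0<..k}. fps_nth B i * fps_nth H (k - i))" for B H :: "'a fps"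
    by (simp add: fps_mult_nth atLeast0AtMost sum.remove[of _ 0] greaterThanAtMost_def lessThan_def)
       (auto intro!: sum.cong)
  have "(\<Sum>i\<in>{0<..k}. fps_nth A i * fps_nth F (k - i)) = (\<Sum>i\<in>{0<..k}. fps_nth A' i * fps_nth F' (k - i))"
    using assms(2,3) by (intro sum.cong) (auto simp: agree_def)
  moreover have "fps_nth A 0 = fps_nth A' 0" using assms(2) by (simp add: agree_def)
  moreover have "fps_nth (A * F) k = fps_nth (A' * F') k" using assms(1) by (simp add: agree_def)
  ultimately have "fps_nth A 0 * fps_nth F k = fps_nth A 0 * fps_nth F' k" unfolding s by simp
  then show ?thesis using assms(3,4) by (auto simp: agree_def less_Suc_eq)
qed

text \<open>Argues on the second-order equation itself: apart from the leading product only one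
  \<partial>_1-derivative occurs. Agreement to order k + 2 thus gives agreement of \<alpha>_11 to
  order k + 1, and two integrations reach order k + 3.\<close>

lemma fps2_P2_unique:
  assumes "fps2_P2 C0 C1 C2 X A = 0" "fps2_P2 C0 C1 C2 X B = 0"
    and "fps_nth A 0 = fps_nth B 0" "fps_nth (fps_deriv A) 0 = fps_nth (fps_deriv B) 0" "fps_nth A 0 \<noteq> 0"
  shows "A = B"
proof (rule agree_all)
  have "agree (Suc (Suc k)) A B" for k
  proof (induction k)
    case 0
    show ?case by (rule agree_SucI[OF assms(3)]) (simp add: agree_def assms(4) del: fps_deriv_nth)
  next
    case (Suc k)
    note 2 = Suc and 1 = agree_mono[OF Suc, of "Suc k", simplified]
    define Q where "Q A = X ^ 2 * A * fps2_dy (fps2_dy A) - 2 * X * A * fps_deriv (fps2_dy A)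
     + fps_deriv A ^ 2 + X ^ 2 * fps2_dy A ^ 2 - 2 * X * fps_deriv A * fps2_dy A
     - A * fps_deriv A * C1 + A * fps2_dy A * C2 + A ^ 2 * C0" for A
    have "agree (Suc k) (- Q A) (- Q B)"
      unfolding Q_def by (intro agree_intros 1 agree_dx[OF agree_dy[OF 2]] agree_dx[OF 2])
    moreover have "A * fps_deriv (fps_deriv A) + Q A = 0" "B * fps_deriv (fps_deriv B) + Q B = 0"
      using assms(1,2) unfolding fps2_P2_def Q_def .
    then have "A * fps_deriv (fps_deriv A) = - Q A" "B * fps_deriv (fps_deriv B) = - Q B"
      unfolding eq_neg_iff_add_eq_0 .
    ultimately have "agree (Suc k) (A * fps_deriv (fps_deriv A)) (B * fps_deriv (fps_deriv B))" by simp
    then have "agree (Suc k) (fps_deriv (fps_deriv A)) (fps_deriv (fps_deriv B))"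
      by (rule agree_mult_cancel[OF _ 1 agree_dx[OF agree_dx[OF 2]] assms(5)])
    then show ?case by (rule agree_SucI[OF assms(3) agree_SucI[OF assms(4)]])
  qed
  then show "agree k A B" for k using agree_mono[of "Suc (Suc k)" A B k] by auto
qed

lemma P2_exists:
  assumes \<Gamma>: "\<And>i j k. real_analytic_at (\<Gamma> i j k) p" and \<xi>: "real_analytic_at \<xi> p"
    and a0: "real_analytic_at \<alpha>0 (p $ 2)" "\<alpha>0 (p $ 2) \<noteq> 0" and a1: "real_analytic_at \<alpha>1 (p $ 2)"
  obtains \<alpha> where "real_analytic_at \<alpha> p" "\<forall>\<^sub>F x in nhds p. P2 \<Gamma> \<xi> \<alpha> x = 0"
    "\<forall>\<^sub>F x in nhds p. x $ 1 = p $ 1 \<longrightarrow> \<alpha> x = \<alpha>0 (x $ 2)"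
    "\<forall>\<^sub>F x in nhds p. x $ 1 = p $ 1 \<longrightarrow> partial 1 \<alpha> x = \<alpha>1 (x $ 2)"
proof -
  obtain G where G: "\<And>i j k. has_fps2 (\<Gamma> i j k) p (G i j k)"
    using \<Gamma> unfolding real_analytic_at_iff by metis
  obtain X where X: "has_fps2 \<xi> p X" using \<xi> unfolding real_analytic_at_iff by blast
  obtain A0 where A0: "has_fps2 (\<lambda>x. \<alpha>0 (x $ 2)) p (fps_const A0)" using real_analytic_at_1d[OF a0(1)] .
  obtain A1 where A1: "has_fps2 (\<lambda>x. \<alpha>1 (x $ 2)) p (fps_const A1)" using real_analytic_at_1d[OF a1] .
  obtain C0 C1 C2 where P: "\<And>\<alpha> A. has_fps2 \<alpha> p A \<Longrightarrow> has_fps2 (P2 \<Gamma> \<xi> \<alpha>) p (fps2_P2 C0 C1 C2 X A)"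
    and C: "\<exists>M r. geo_bound M r C0" "\<exists>M r. geo_bound M r C1" "\<exists>M r. geo_bound M r C2"
    using P2_fps[where \<Gamma> = \<Gamma> and G = G, OF G X] by metis
  obtain M0 r0 M1 r1 where b: "geo_bound M0 r0 (fps_const A0)" "geo_bound M1 r1 (fps_const A1)"
    using has_fps2_geo_bound[OF A0] has_fps2_geo_bound[OF A1] by metis
  have "fps_nth A0 0 = \<alpha>0 (p $ 2)" using has_fps2_has_derivative(1)[OF A0] by simp
  then obtain A where A: "fps_nth A 0 = A0" "fps_nth A 1 = A1" "\<exists>M r. geo_bound M r A" "fps2_P2 C0 C1 C2 X A = 0"
    using fps2_P2_exists[OF b C] has_fps2_geo_bound[OF X] a0(2) by metis
  obtain \<alpha> where \<alpha>: "has_fps2 \<alpha> p A" using A(3) geo_bound_has_fps2 by blast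
  show ?thesis
  proof (rule that[of \<alpha>])
    show "real_analytic_at \<alpha> p" using \<alpha> real_analytic_at_iff by blast
    show "\<forall>\<^sub>F x in nhds p. P2 \<Gamma> \<xi> \<alpha> x = 0" using has_fps2_zero_iff[OF P[OF \<alpha>]] A(4) by blast
    show "\<forall>\<^sub>F x in nhds p. x $ 1 = p $ 1 \<longrightarrow> \<alpha> x = \<alpha>0 (x $ 2)"
      using initial_value_iff[OF \<alpha> A0] A(1) by blast
    show "\<forall>\<^sub>F x in nhds p. x $ 1 = p $ 1 \<longrightarrow> partial 1 \<alpha> x = \<alpha>1 (x $ 2)"
      using initial_value_iff[OF has_fps2_partial(1)[OF \<alpha>] A1] A(2) by simp
  qed
qed

lemma P2_unique:
  assumes \<Gamma>: "\<And>i j k. real_analytic_at (\<Gamma> i j k) p" and \<xi>: "real_analytic_at \<xi> p"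
    and a0: "real_analytic_at \<alpha>0 (p $ 2)" "\<alpha>0 (p $ 2) \<noteq> 0" and a1: "real_analytic_at \<alpha>1 (p $ 2)"
    and an: "real_analytic_at \<alpha> p" "real_analytic_at \<alpha>' p"
    and P2: "\<forall>\<^sub>F x in nhds p. P2 \<Gamma> \<xi> \<alpha> x = 0" "\<forall>\<^sub>F x in nhds p. P2 \<Gamma> \<xi> \<alpha>' x = 0"
    and init0: "\<forall>\<^sub>F x in nhds p. x $ 1 = p $ 1 \<longrightarrow> \<alpha> x = \<alpha>0 (x $ 2)"
      "\<forall>\<^sub>F x in nhds p. x $ 1 = p $ 1 \<longrightarrow> \<alpha>' x = \<alpha>0 (x $ 2)"
    and init1: "\<forall>\<^sub>F x in nhds p. x $ 1 = p $ 1 \<longrightarrow> partial 1 \<alpha> x = \<alpha>1 (x $ 2)"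
      "\<forall>\<^sub>F x in nhds p. x $ 1 = p $ 1 \<longrightarrow> partial 1 \<alpha>' x = \<alpha>1 (x $ 2)"
  shows "\<forall>\<^sub>F x in nhds p. \<alpha> x = \<alpha>' x"
proof -
  obtain G where G: "\<And>i j k. has_fps2 (\<Gamma> i j k) p (G i j k)"
    using \<Gamma> unfolding real_analytic_at_iff by metis
  obtain X where X: "has_fps2 \<xi> p X" using \<xi> unfolding real_analytic_at_iff by blast
  obtain A0 where A0: "has_fps2 (\<lambda>x. \<alpha>0 (x $ 2)) p (fps_const A0)" using real_analytic_at_1d[OF a0(1)] .
  obtain A1 where A1: "has_fps2 (\<lambda>x. \<alpha>1 (x $ 2)) p (fps_const A1)" using real_analytic_at_1d[OF a1] .
  obtain A B where AB: "has_fps2 \<alpha> p A" "has_fps2 \<alpha>' p B" using an unfolding real_analytic_at_iff by metis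
  obtain C0 C1 C2 where P: "\<And>\<alpha> A. has_fps2 \<alpha> p A \<Longrightarrow> has_fps2 (P2 \<Gamma> \<xi> \<alpha>) p (fps2_P2 C0 C1 C2 X A)"
    using P2_fps[where \<Gamma> = \<Gamma> and G = G, OF G X] by metis
  have "A = B"
  proof (rule fps2_P2_unique)
    show "fps2_P2 C0 C1 C2 X A = 0" "fps2_P2 C0 C1 C2 X B = 0"
      using has_fps2_zero_iff[OF P[OF AB(1)]] has_fps2_zero_iff[OF P[OF AB(2)]] P2 by blast+
    have 0: "fps_nth A 0 = A0" "fps_nth B 0 = A0"
      using initial_value_iff[OF AB(1) A0] initial_value_iff[OF AB(2) A0] init0 by blast+
    then show "fps_nth A 0 = fps_nth B 0" by simp
    have "fps_nth (fps_deriv A) 0 = A1" "fps_nth (fps_deriv B) 0 = A1"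
      using initial_value_iff[OF has_fps2_partial(1)[OF AB(1)] A1] initial_value_iff[OF has_fps2_partial(1)[OF AB(2)] A1] init1
      by blast+
    then show "fps_nth (fps_deriv A) 0 = fps_nth (fps_deriv B) 0" by (simp only:)
    have "fps_nth A0 0 = \<alpha>0 (p $ 2)" using has_fps2_has_derivative(1)[OF A0] by simp
    then show "fps_nth A 0 \<noteq> 0" using 0(1) a0(2) by auto
  qed
  then show ?thesis using AB has_fps2_eventually_eq by blast
qed

section \<open>Levi-Civita calculus in coordinates\<close>

lemma matrix_diff_ldistrib: "(A::real^'n^'m) ** (B - C) = A ** B - A ** C"
  by (vector matrix_matrix_mult_def sum_subtractf right_diff_distrib)

lemma matrix_diff_rdistrib: "((A::real^'n^'m) - B) ** C = A ** C - B ** C"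
  by (vector matrix_matrix_mult_def sum_subtractf left_diff_distrib)

lemma matrix_add_rdistrib: "((A::real^'n^'m) + B) ** C = A ** C + B ** C"
  by (vector matrix_matrix_mult_def sum.distrib distrib_right)

text \<open>Components of the curvature operator: \<open>R(\<partial>\<^sub>i, \<partial>\<^sub>j)\<partial>\<^sub>k = curv \<Gamma> i j k m \<partial>\<^sub>m\<close>.\<close>

definition curv ::
  "('n \<Rightarrow> 'n \<Rightarrow> 'n \<Rightarrow> real ^ 'n \<Rightarrow> real) \<Rightarrow> 'n \<Rightarrow> 'n \<Rightarrow> 'n \<Rightarrow> 'n \<Rightarrow> real ^ 'n::finite \<Rightarrow> real" where
  "curv \<Gamma> i j k m z = partial i (\<Gamma> j k m) z - partial j (\<Gamma> i k m) z
     + (\<Sum>l\<in>UNIV. \<Gamma> i l m z * \<Gamma> j k l z) - (\<Sum>l\<in>UNIV. \<Gamma> j l m z * \<Gamma> i k l z)"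

lemma sum_axis_mult: "(\<Sum>i\<in>UNIV. axis k (1::real) $ i * f i) = f k"
  by (simp add: axis_def if_distrib[of "\<lambda>c. c * _"] cong: if_cong)

lemma vf_apply_coord_field: "vf_apply (coord_field i) f z = partial i f z"
  by (simp add: vf_apply_def coord_field_def sum_axis_mult)

lemma cov_deriv_coord_field:
  "cov_deriv \<Gamma> (coord_field i) V z $ m = partial i (\<lambda>w. V w $ m) z + (\<Sum>l\<in>UNIV. \<Gamma> i l m z * V z $ l)"
proof -
  have "(\<Sum>i'\<in>UNIV. \<Sum>j\<in>UNIV. \<Gamma> i' j m z * axis i 1 $ i' * V z $ j)
      = (\<Sum>i'\<in>UNIV. axis i 1 $ i' * (\<Sum>j\<in>UNIV. \<Gamma> i' j m z * V z $ j))"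
    by (simp add: sum_distrib_left mult_ac)
  then show ?thesis
    by (simp add: cov_deriv_def vf_apply_coord_field) (simp add: coord_field_def sum_axis_mult)
qed

lemma curv_op_coord_field:
  "curv_op \<Gamma> (coord_field i) (coord_field j) (coord_field k) z $ m = curv \<Gamma> i j k m z"
proof -
  have 1: "cov_deriv \<Gamma> (coord_field j) (coord_field k) w $ m = \<Gamma> j k m w" for j m w
  proof -
    have "(\<Sum>l\<in>UNIV. \<Gamma> j l m w * axis k 1 $ l) = \<Gamma> j k m w"
      by (subst mult.commute) (rule sum_axis_mult)
    then show ?thesis by (simp add: cov_deriv_coord_field) (simp add: coord_field_def)
  qed
  have 2: "lie_bracket (coord_field i) (coord_field j) = (\<lambda>x. 0)"
    by (simp add: lie_bracket_def vf_apply_coord_field vec_eq_iff fun_eq_iff) (simp add: coord_field_def)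
  have 3: "cov_deriv \<Gamma> (\<lambda>x. 0) V z = 0" for V
    by (simp add: cov_deriv_def vf_apply_def vec_eq_iff)
  show ?thesis
    by (simp add: curv_op_def 2 3 1 curv_def
        cov_deriv_coord_field[of \<Gamma> _ "cov_deriv \<Gamma> (coord_field _) (coord_field k)"])
qed

lemma riem_curv: "riem g i j k l z = (\<Sum>m\<in>UNIV. curv (levi_civita g) i j k m z * g z $ m $ l)"
  by (simp add: riem_def curv_op_coord_field)

lemma ricci_curv: "ricci g j k z = (\<Sum>i\<in>UNIV. curv (levi_civita g) i j k i z)"
  by (simp add: ricci_def curv_op_coord_field)

lemma curv_antisym: "curv \<Gamma> i j k m z = - curv \<Gamma> j i k m z"
  by (simp add: curv_def)

definition cov2 ::
  "('n \<Rightarrow> 'n \<Rightarrow> 'n \<Rightarrow> real ^ 'n \<Rightarrow> real) \<Rightarrow> ('n \<Rightarrow> 'n \<Rightarrow> real ^ 'n::finite \<Rightarrow> real) \<Rightarrow>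
     'n \<Rightarrow> 'n \<Rightarrow> 'n \<Rightarrow> real ^ 'n \<Rightarrow> real" where
  "cov2 \<Gamma> t a i j z = partial a (t i j) z - (\<Sum>m\<in>UNIV. \<Gamma> a i m z * t m j z) - (\<Sum>m\<in>UNIV. \<Gamma> a j m z * t i m z)"

definition cov3 ::
  "('n \<Rightarrow> 'n \<Rightarrow> 'n \<Rightarrow> real ^ 'n \<Rightarrow> real) \<Rightarrow> ('n \<Rightarrow> 'n \<Rightarrow> 'n \<Rightarrow> real ^ 'n::finite \<Rightarrow> real) \<Rightarrow>
     'n \<Rightarrow> 'n \<Rightarrow> 'n \<Rightarrow> 'n \<Rightarrow> real ^ 'n \<Rightarrow> real" where
  "cov3 \<Gamma> t a k i j z = partial a (t k i j) z - (\<Sum>m\<in>UNIV. \<Gamma> a k m z * t m i j z)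
     - (\<Sum>m\<in>UNIV. \<Gamma> a i m z * t k m j z) - (\<Sum>m\<in>UNIV. \<Gamma> a j m z * t k i m z)"

definition cov4 ::
  "('n \<Rightarrow> 'n \<Rightarrow> 'n \<Rightarrow> real ^ 'n \<Rightarrow> real) \<Rightarrow> ('n \<Rightarrow> 'n \<Rightarrow> 'n \<Rightarrow> 'n \<Rightarrow> real ^ 'n::finite \<Rightarrow> real) \<Rightarrow>
     'n \<Rightarrow> 'n \<Rightarrow> 'n \<Rightarrow> 'n \<Rightarrow> 'n \<Rightarrow> real ^ 'n \<Rightarrow> real" where
  "cov4 \<Gamma> t a k i j l z = partial a (t k i j l) z - (\<Sum>m\<in>UNIV. \<Gamma> a k m z * t m i j l z)
     - (\<Sum>m\<in>UNIV. \<Gamma> a i m z * t k m j l z) - (\<Sum>m\<in>UNIV. \<Gamma> a j m z * t k i m l z)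
     - (\<Sum>m\<in>UNIV. \<Gamma> a l m z * t k i j m z)"

text \<open>The covariant derivative of the curvature with its last index raised.\<close>

definition cov_curv ::
  "('n \<Rightarrow> 'n \<Rightarrow> 'n \<Rightarrow> real ^ 'n \<Rightarrow> real) \<Rightarrow> 'n \<Rightarrow> 'n \<Rightarrow> 'n \<Rightarrow> 'n \<Rightarrow> 'n \<Rightarrow> real ^ 'n::finite \<Rightarrow> real" where
  "cov_curv \<Gamma> a k i j m z = partial a (curv \<Gamma> k i j m) z - (\<Sum>n\<in>UNIV. \<Gamma> a k n z * curv \<Gamma> n i j m z)
     - (\<Sum>n\<in>UNIV. \<Gamma> a i n z * curv \<Gamma> k n j m z) - (\<Sum>n\<in>UNIV. \<Gamma> a j n z * curv \<Gamma> k i n m z)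
     + (\<Sum>n\<in>UNIV. \<Gamma> a n m z * curv \<Gamma> k i j n z)"

lemma cov_tensor_weyl:
  "cov_tensor \<Gamma> (weyl_tensor g) [b, k, i, j, l] z = cov4 \<Gamma> (weyl g) b k i j l z"
  by (simp add: cov_tensor_def weyl_tensor_def cov4_def lessThan_Suc sum.distrib
      numeral_2_eq_2 numeral_3_eq_3 eval_nat_numeral algebra_simps)

lemma cov_tensor_5:
  "cov_tensor \<Gamma> t [a, b, k, i, j, l] z = partial a (t [b, k, i, j, l]) z
     - (\<Sum>m\<in>UNIV. \<Gamma> a b m z * t [m, k, i, j, l] z) - (\<Sum>m\<in>UNIV. \<Gamma> a k m z * t [b, m, i, j, l] z)
     - (\<Sum>m\<in>UNIV. \<Gamma> a i m z * t [b, k, m, j, l] z) - (\<Sum>m\<in>UNIV. \<Gamma> a j m z * t [b, k, i, m, l] z)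
     - (\<Sum>m\<in>UNIV. \<Gamma> a l m z * t [b, k, i, j, m] z)"
  by (simp add: cov_tensor_def lessThan_Suc eval_nat_numeral algebra_simps)

text \<open>Smoothness of the inverse metric is part of the locale, since the inverse is explicit
  for the metrics to which it is applied.\<close>

locale smooth_metric =
  fixes \<Omega> :: "(real ^ 'n::finite) set" and g :: "real ^ 'n \<Rightarrow> real ^ 'n ^ 'n"
  assumes open_dom: "open \<Omega>"
    and smooth_g: "\<And>i j. smooth_on \<Omega> (\<lambda>z. g z $ i $ j)"
    and smooth_up: "\<And>i j. smooth_on \<Omega> (g_up g i j)"
    and sym: "\<And>z i j. z \<in> \<Omega> \<Longrightarrow> g z $ i $ j = g z $ j $ i"
    and inv: "\<And>z. z \<in> \<Omega> \<Longrightarrow> matrix_inv (g z) ** g z = mat 1"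
begin

abbreviation "\<Gamma> \<equiv> levi_civita g"

lemmas smooth_intros = open_dom smooth_on_const smooth_on_add smooth_on_diff smooth_on_minus smooth_on_mult
  smooth_on_divide smooth_on_sum smooth_on_partial

lemma inv': "z \<in> \<Omega> \<Longrightarrow> g z ** matrix_inv (g z) = mat 1"
  using inv matrix_left_right_inverse by blast

lemma up_mult: "z \<in> \<Omega> \<Longrightarrow> (\<Sum>m\<in>UNIV. g_up g i m z * g z $ m $ j) = (if i = j then 1 else 0)"
  using inv[of z] by (simp add: vec_eq_iff matrix_matrix_mult_def g_up_def mat_def)

lemma mult_up: "z \<in> \<Omega> \<Longrightarrow> (\<Sum>m\<in>UNIV. g z $ i $ m * g_up g m j z) = (if i = j then 1 else 0)"
  using inv'[of z] by (simp add: vec_eq_iff matrix_matrix_mult_def g_up_def mat_def)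

lemma smooth_Gamma: "smooth_on \<Omega> (\<Gamma> i j k)"
proof -
  have "\<Gamma> i j k = (\<lambda>z. 1/2 * (\<Sum>l\<in>UNIV. g_up g k l z *
     (partial i (\<lambda>w. g w $ j $ l) z + partial j (\<lambda>w. g w $ i $ l) z - partial l (\<lambda>w. g w $ i $ j) z)))"
    by (simp add: levi_civita_def fun_eq_iff)
  then show ?thesis by (auto intro!: smooth_intros smooth_g smooth_up)
qed

lemma dg_sym: "z \<in> \<Omega> \<Longrightarrow> partial l (\<lambda>w. g w $ i $ j) z = partial l (\<lambda>w. g w $ j $ i) z"
  by (rule partial_cong[OF open_dom]) (auto simp: sym)

lemma Gamma_sym: "z \<in> \<Omega> \<Longrightarrow> \<Gamma> i j k z = \<Gamma> j i k z"
  unfolding levi_civita_def by (simp add: dg_sym[of z _ i j] add.commute)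

lemma Gamma_lower:
  assumes z: "z \<in> \<Omega>"
  shows "(\<Sum>k\<in>UNIV. \<Gamma> i j k z * g z $ k $ n) =
    1/2 * (partial i (\<lambda>w. g w $ j $ n) z + partial j (\<lambda>w. g w $ i $ n) z - partial n (\<lambda>w. g w $ i $ j) z)"
proof -
  let ?c = "\<lambda>l. partial i (\<lambda>w. g w $ j $ l) z + partial j (\<lambda>w. g w $ i $ l) z - partial l (\<lambda>w. g w $ i $ j) z"
  have "(\<Sum>k\<in>UNIV. \<Gamma> i j k z * g z $ k $ n) = 1/2 * (\<Sum>k\<in>UNIV. \<Sum>l\<in>UNIV. g z $ n $ k * g_up g k l z * ?c l)"
    by (simp add: levi_civita_def sum_distrib_right sum_distrib_left sym[OF z, of _ n] mult_ac)
  also have "(\<Sum>k\<in>UNIV. \<Sum>l\<in>UNIV. g z $ n $ k * g_up g k l z * ?c l)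
      = (\<Sum>l\<in>UNIV. (\<Sum>k\<in>UNIV. g z $ n $ k * g_up g k l z) * ?c l)"
    by (subst sum.swap) (simp add: sum_distrib_right)
  also have "\<dots> = ?c n"
    by (simp add: mult_up[OF z] if_distrib[of "\<lambda>c. c * _"] cong: if_cong)
  finally show ?thesis .
qed

lemma metric_compat:
  assumes z: "z \<in> \<Omega>"
  shows "partial a (\<lambda>w. g w $ b $ c) z =
    (\<Sum>m\<in>UNIV. \<Gamma> a b m z * g z $ m $ c) + (\<Sum>m\<in>UNIV. \<Gamma> a c m z * g z $ b $ m)"
proof -
  have "(\<Sum>m\<in>UNIV. \<Gamma> a c m z * g z $ b $ m) = (\<Sum>m\<in>UNIV. \<Gamma> a c m z * g z $ m $ b)"
    using sym[OF z, of b] by (intro sum.cong) auto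
  then show ?thesis
    by (simp only: Gamma_lower[OF z] dg_sym[OF z, of a c b]) (simp add: field_simps)
qed

text \<open>The identity (inverse metric)(metric) = 1 is differentiated as a matrix equation. Metric
  compatibility writes the derivative of the metric as LG + GL^T, and multiplying by the inverse
  isolates the derivative of the inverse.\<close>

lemma partial_up:
  assumes z: "z \<in> \<Omega>"
  shows "partial a (g_up g b c) z =
    - (\<Sum>m\<in>UNIV. \<Gamma> a m b z * g_up g m c z) - (\<Sum>m\<in>UNIV. \<Gamma> a m c z * g_up g b m z)"
proof -
  let ?G = "g z" and ?U = "matrix_inv (g z)"
  define L where "L = (\<chi> b m. \<Gamma> a b m z)"
  define DG where "DG = (\<chi> b c. partial a (\<lambda>w. g w $ b $ c) z)"
  define DU where "DU = (\<chi> b c. partial a (g_up g b c) z)"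
  have DG: "DG = L ** ?G + ?G ** transpose L"
    by (simp add: vec_eq_iff DG_def L_def matrix_matrix_mult_def transpose_def metric_compat[OF z] mult.commute)
  have "DU ** ?G + ?U ** DG = 0"
  proof -
    have "partial a (\<lambda>w. \<Sum>m\<in>UNIV. g_up g i m w * g w $ m $ j) z = 0" for i j
    proof -
      have "partial a (\<lambda>w. \<Sum>m\<in>UNIV. g_up g i m w * g w $ m $ j) z = partial a (\<lambda>w. if i = j then 1 else 0) z"
        by (rule partial_cong[OF open_dom z]) (simp add: up_mult)
      then show ?thesis by simp
    qed
    moreover have "partial a (\<lambda>w. \<Sum>m\<in>UNIV. g_up g i m w * g w $ m $ j) z
       = (\<Sum>m\<in>UNIV. partial a (g_up g i m) z * g z $ m $ j + g_up g i m z * partial a (\<lambda>w. g w $ m $ j) z)" for i j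
      using smooth_on_differentiable[OF smooth_g z] smooth_on_differentiable[OF smooth_up z]
      by (subst partial_sum) (auto simp: partial_mult)
    ultimately show ?thesis
      by (simp add: vec_eq_iff DU_def DG_def matrix_matrix_mult_def sum.distrib) (simp add: g_up_def)
  qed
  then have "(DU ** ?G + ?U ** DG) ** ?U = 0" by simp
  then have "DU + ?U ** L + transpose L ** ?U = 0"
    unfolding DG matrix_add_ldistrib matrix_add_rdistrib matrix_mul_assoc[symmetric] inv'[OF z]
    by (simp add: matrix_mul_assoc inv[OF z] add.assoc)
  then have "DU = - (transpose L ** ?U) - ?U ** L"
    by (simp add: algebra_simps eq_neg_iff_add_eq_0)
  then have "DU $ b $ c = (- (transpose L ** ?U) - ?U ** L) $ b $ c" by simp
  then show ?thesis
    by (simp add: DU_def L_def transpose_def matrix_matrix_mult_def g_up_def mult.commute)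
qed

lemma smooth_curv: "smooth_on \<Omega> (curv \<Gamma> i j k m)"
proof -
  have "curv \<Gamma> i j k m = (\<lambda>z. partial i (\<Gamma> j k m) z - partial j (\<Gamma> i k m) z
     + (\<Sum>l\<in>UNIV. \<Gamma> i l m z * \<Gamma> j k l z) - (\<Sum>l\<in>UNIV. \<Gamma> j l m z * \<Gamma> i k l z))"
    by (simp add: curv_def fun_eq_iff)
  then show ?thesis by (auto intro!: smooth_intros smooth_Gamma)
qed

lemma smooth_riem: "smooth_on \<Omega> (riem g i j k l)"
proof -
  have "riem g i j k l = (\<lambda>z. \<Sum>m\<in>UNIV. curv \<Gamma> i j k m z * g z $ m $ l)"
    by (simp add: riem_curv fun_eq_iff)
  then show ?thesis by (auto intro!: smooth_intros smooth_curv smooth_g)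
qed

lemma smooth_ricci: "smooth_on \<Omega> (ricci g i j)"
proof -
  have "ricci g i j = (\<lambda>z. \<Sum>m\<in>UNIV. curv \<Gamma> m i j m z)"
    by (simp add: ricci_curv fun_eq_iff)
  then show ?thesis by (auto intro!: smooth_intros smooth_curv)
qed

lemma smooth_scal: "smooth_on \<Omega> (scal g)"
proof -
  have "scal g = (\<lambda>z. \<Sum>i\<in>UNIV. \<Sum>j\<in>UNIV. g_up g i j z * ricci g i j z)"
    by (simp add: scal_def fun_eq_iff)
  then show ?thesis by (auto intro!: smooth_intros smooth_ricci smooth_up)
qed

lemma smooth_weyl: "smooth_on \<Omega> (weyl g i j k l)"
proof -
  let ?n = "real CARD('n)"
  have "weyl g i j k l = (\<lambda>z. riem g i j k l z
     - 1 / (?n - 2) * (ricci g j k z * g z $ i $ l - ricci g i k z * g z $ j $ l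
                      + ricci g i l z * g z $ j $ k - ricci g j l z * g z $ i $ k)
     + (1 / ((?n - 1) * (?n - 2))) * scal g z * (g z $ i $ l * g z $ j $ k - g z $ i $ k * g z $ j $ l))"
    by (simp add: weyl_def Let_def fun_eq_iff)
  then show ?thesis by (auto intro!: smooth_intros smooth_ricci smooth_riem smooth_scal smooth_g)
qed

lemma smooth_cov4:
  assumes "\<And>k i j l. smooth_on \<Omega> (t k i j l)"
  shows "smooth_on \<Omega> (cov4 \<Gamma> t a k i j l)"
proof -
  have "cov4 \<Gamma> t a k i j l = (\<lambda>z. partial a (t k i j l) z - (\<Sum>m\<in>UNIV. \<Gamma> a k m z * t m i j l z)
     - (\<Sum>m\<in>UNIV. \<Gamma> a i m z * t k m j l z) - (\<Sum>m\<in>UNIV. \<Gamma> a j m z * t k i m l z)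
     - (\<Sum>m\<in>UNIV. \<Gamma> a l m z * t k i j m z))" by (simp add: cov4_def fun_eq_iff)
  then show ?thesis by (auto intro!: smooth_intros smooth_Gamma assms)
qed

lemmas diffs = smooth_on_differentiable[OF smooth_Gamma] smooth_on_differentiable[OF smooth_g]
  smooth_on_differentiable[OF smooth_up] smooth_on_differentiable[OF smooth_curv]
  smooth_on_differentiable[OF smooth_riem] smooth_on_differentiable[OF smooth_ricci]
  smooth_on_differentiable[OF smooth_weyl] smooth_on_differentiable[OF smooth_on_partial[OF smooth_Gamma]]

section \<open>The Bianchi identities\<close>

text \<open>In the indices \<open>m\<close>, \<open>j\<close> everything is a matrix:
  \<open>A\<close> is the connection, \<open>K\<close> the curvature. The cyclic sum of dK + [A, K]
  cancels by commuting second derivatives and associativity.\<close>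

lemma second_bianchi:
  assumes z: "z \<in> \<Omega>"
  shows "cov_curv \<Gamma> a k i j m z + cov_curv \<Gamma> k i a j m z + cov_curv \<Gamma> i a k j m z = 0"
proof -
  define A where "A = (\<lambda>b. \<chi> m j. \<Gamma> b j m z)"
  define B where "B = (\<lambda>a b. \<chi> m j. partial a (\<Gamma> b j m) z)"
  define S where "S = (\<lambda>a b c. \<chi> m j. partial a (partial b (\<Gamma> c j m)) z)"
  have S: "S a b c = S b a c" for a b c
    by (simp add: S_def partial_commute[OF open_dom z smooth_Gamma, of a b])
  define K where "K = (\<lambda>i j. B i j - B j i + A i ** A j - A j ** A i)"
  have K: "curv \<Gamma> k i j m z = K k i $ m $ j" for k i j m
    by (simp add: K_def A_def B_def curv_def matrix_matrix_mult_def)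
  define DK where "DK = (\<lambda>a k i. S a k i - S a i k + (B a k ** A i + A k ** B a i) - (B a i ** A k + A i ** B a k))"
  have DK: "partial a (curv \<Gamma> k i j m) z = DK a k i $ m $ j" for a k i j m
  proof -
    have "curv \<Gamma> k i j m = (\<lambda>z. partial k (\<Gamma> i j m) z - partial i (\<Gamma> k j m) z
     + (\<Sum>l\<in>UNIV. \<Gamma> k l m z * \<Gamma> i j l z) - (\<Sum>l\<in>UNIV. \<Gamma> i l m z * \<Gamma> k j l z))"
      by (simp add: curv_def fun_eq_iff)
    moreover have "partial a \<dots> z = partial a (partial k (\<Gamma> i j m)) z - partial a (partial i (\<Gamma> k j m)) z
       + (\<Sum>l\<in>UNIV. partial a (\<Gamma> k l m) z * \<Gamma> i j l z + \<Gamma> k l m z * partial a (\<Gamma> i j l) z)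
       - (\<Sum>l\<in>UNIV. partial a (\<Gamma> i l m) z * \<Gamma> k j l z + \<Gamma> i l m z * partial a (\<Gamma> k j l) z)"
      using z by (simp add: partial_add partial_diff partial_sum partial_mult diffs
          differentiable_add differentiable_diff differentiable_sum differentiable_mult)
    ultimately show ?thesis
      by (simp add: DK_def S_def A_def B_def matrix_matrix_mult_def sum.distrib)
  qed
  have cov: "cov_curv \<Gamma> a k i j m z = (DK a k i + A a ** K k i - K k i ** A a) $ m $ j
      - (\<Sum>n\<in>UNIV. \<Gamma> a k n z * curv \<Gamma> n i j m z) - (\<Sum>n\<in>UNIV. \<Gamma> a i n z * curv \<Gamma> k n j m z)" for a k i
    by (simp add: cov_curv_def DK K A_def matrix_matrix_mult_def mult.commute)
  have "(DK a k i + A a ** K k i - K k i ** A a) + (DK k i a + A k ** K i a - K i a ** A k)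
      + (DK i a k + A i ** K a k - K a k ** A i) = 0"
    unfolding DK_def K_def matrix_add_ldistrib matrix_add_rdistrib matrix_diff_ldistrib matrix_diff_rdistrib
      matrix_mul_assoc S[of k a] S[of i a] S[of i k]
    by (simp add: algebra_simps)
  then have "((DK a k i + A a ** K k i - K k i ** A a) + (DK k i a + A k ** K i a - K i a ** A k)
      + (DK i a k + A i ** K a k - K a k ** A i)) $ m $ j = 0" by simp
  \<comment> \<open>The corrections for the two form indices cancel in pairs: the connection is
    symmetric in its lower indices and the curvature antisymmetric.\<close>
  moreover have swap: "(\<Sum>n\<in>UNIV. \<Gamma> a k n z * curv \<Gamma> n i j m z) + (\<Sum>n\<in>UNIV. \<Gamma> k a n z * curv \<Gamma> i n j m z) = 0" for a k i
    by (simp add: sum.distrib[symmetric] Gamma_sym[OF z, of k a] curv_antisym[of _ i])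
  ultimately show ?thesis
    unfolding cov vector_add_component vector_minus_component
    using swap[of a k i] swap[of k i a] swap[of i a k] by linarith
qed

lemma sum3_swap: "(\<Sum>l\<in>A. \<Sum>b\<in>B. \<Sum>m\<in>C. F l b m) = (\<Sum>m\<in>C. \<Sum>b\<in>B. \<Sum>l\<in>A. F l b m)"
  by (subst sum.swap, subst (2) sum.swap, subst sum.swap) simp

text \<open>The metric is parallel, so lowering the last index commutes with covariant
  differentiation.\<close>

lemma cov4_riem:
  assumes z: "z \<in> \<Omega>"
  shows "cov4 \<Gamma> (riem g) b k i j l z = (\<Sum>m\<in>UNIV. cov_curv \<Gamma> b k i j m z * g z $ m $ l)"
proof -
  have r: "riem g k i j l = (\<lambda>z. \<Sum>m\<in>UNIV. curv \<Gamma> k i j m z * g z $ m $ l)" for k i j l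
    by (simp add: riem_curv fun_eq_iff)
  have "partial b (riem g k i j l) z = (\<Sum>m\<in>UNIV. partial b (curv \<Gamma> k i j m) z * g z $ m $ l +
      curv \<Gamma> k i j m z * partial b (\<lambda>w. g w $ m $ l) z)"
    unfolding r using z by (simp add: partial_sum partial_mult diffs differentiable_mult)
  also have "\<dots> = (\<Sum>m\<in>UNIV. partial b (curv \<Gamma> k i j m) z * g z $ m $ l)
      + (\<Sum>m\<in>UNIV. \<Sum>n\<in>UNIV. curv \<Gamma> k i j m z * \<Gamma> b m n z * g z $ n $ l)
      + (\<Sum>m\<in>UNIV. \<Sum>n\<in>UNIV. curv \<Gamma> k i j m z * \<Gamma> b l n z * g z $ m $ n)"
    by (simp add: metric_compat[OF z] sum.distrib sum_distrib_left distrib_left mult.assoc)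
  also have "(\<Sum>m\<in>UNIV. \<Sum>n\<in>UNIV. curv \<Gamma> k i j m z * \<Gamma> b m n z * g z $ n $ l)
      = (\<Sum>m\<in>UNIV. (\<Sum>n\<in>UNIV. \<Gamma> b n m z * curv \<Gamma> k i j n z) * g z $ m $ l)"
    by (subst sum.swap) (simp add: sum_distrib_left sum_distrib_right mult_ac)
  also have "(\<Sum>m\<in>UNIV. \<Sum>n\<in>UNIV. curv \<Gamma> k i j m z * \<Gamma> b l n z * g z $ m $ n)
      = (\<Sum>m\<in>UNIV. \<Gamma> b l m z * riem g k i j m z)"
    by (subst sum.swap) (simp add: riem_curv sum_distrib_left mult_ac)
  finally have d: "partial b (riem g k i j l) z = (\<Sum>m\<in>UNIV. partial b (curv \<Gamma> k i j m) z * g z $ m $ l)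
      + (\<Sum>m\<in>UNIV. (\<Sum>n\<in>UNIV. \<Gamma> b n m z * curv \<Gamma> k i j n z) * g z $ m $ l)
      + (\<Sum>m\<in>UNIV. \<Gamma> b l m z * riem g k i j m z)" .
  have sw: "(\<Sum>n\<in>UNIV. c n * (\<Sum>m\<in>UNIV. R n m * g z $ m $ l)) = (\<Sum>m\<in>UNIV. (\<Sum>n\<in>UNIV. c n * R n m) * g z $ m $ l)" for c R
    by (simp add: sum_distrib_left sum_distrib_right mult.assoc) (rule sum.swap)
  show ?thesis
    unfolding cov4_def d riem_curv[of g _ _ _ l] sw cov_curv_def
    by (simp only: sum.distrib sum_subtractf left_diff_distrib distrib_right)
qed

lemma contract_lowered:
  assumes z: "z \<in> \<Omega>"
  shows "(\<Sum>l\<in>UNIV. \<Sum>b\<in>UNIV. g_up g l b z * (\<Sum>m\<in>UNIV. X b m * g z $ m $ l)) = (\<Sum>b\<in>UNIV. X b b)"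
proof -
  have "(\<Sum>l\<in>UNIV. \<Sum>b\<in>UNIV. g_up g l b z * (\<Sum>m\<in>UNIV. X b m * g z $ m $ l))
      = (\<Sum>l\<in>UNIV. \<Sum>b\<in>UNIV. \<Sum>m\<in>UNIV. X b m * (g z $ m $ l * g_up g l b z))"
    by (simp add: sum_distrib_left mult_ac)
  also have "\<dots> = (\<Sum>m\<in>UNIV. \<Sum>b\<in>UNIV. X b m * (\<Sum>l\<in>UNIV. g z $ m $ l * g_up g l b z))"
    by (subst sum3_swap) (simp add: sum_distrib_left)
  also have "\<dots> = (\<Sum>b\<in>UNIV. X b b)"
    by (simp add: mult_up[OF z] if_distrib[of "\<lambda>c. _ * c"] cong: if_cong)
  finally show ?thesis .
qed

lemma contract_metric:
  assumes z: "z \<in> \<Omega>"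
  shows "(\<Sum>l\<in>UNIV. \<Sum>b\<in>UNIV. g_up g l b z * (X b * g z $ k $ l)) = X k"
proof -
  have "(\<Sum>l\<in>UNIV. \<Sum>b\<in>UNIV. g_up g l b z * (X b * g z $ k $ l))
      = (\<Sum>b\<in>UNIV. X b * (\<Sum>l\<in>UNIV. g z $ k $ l * g_up g l b z))"
    by (subst sum.swap) (simp add: sum_distrib_left mult_ac)
  then show ?thesis
    by (simp add: mult_up[OF z] if_distrib[of "\<lambda>c. _ * c"] cong: if_cong)
qed

text \<open>With the last curvature index raised, the divergence is a plain trace with the
  differentiation index. Tracing the second Bianchi identity there turns its two other terms into
  derivatives of the Ricci tensor.\<close>

lemma contracted_bianchi:
  assumes z: "z \<in> \<Omega>"
  shows "(\<Sum>l\<in>UNIV. \<Sum>b\<in>UNIV. g_up g l b z * cov4 \<Gamma> (riem g) b k i j l z)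
    = cov2 \<Gamma> (ricci g) k i j z - cov2 \<Gamma> (ricci g) i k j z"
proof -
  have ric: "(\<Sum>m\<in>UNIV. cov_curv \<Gamma> i m k j m z) = cov2 \<Gamma> (ricci g) i k j z" for i k j
  proof -
    have "partial i (ricci g k j) z = (\<Sum>m\<in>UNIV. partial i (curv \<Gamma> m k j m) z)"
    proof -
      have "ricci g k j = (\<lambda>z. \<Sum>m\<in>UNIV. curv \<Gamma> m k j m z)" by (simp add: ricci_curv fun_eq_iff)
      then show ?thesis using z by (simp add: partial_sum diffs)
    qed
    moreover have "(\<Sum>m\<in>UNIV. \<Sum>n\<in>UNIV. \<Gamma> i m n z * curv \<Gamma> n k j m z) = (\<Sum>m\<in>UNIV. \<Sum>n\<in>UNIV. \<Gamma> i n m z * curv \<Gamma> m k j n z)"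
      by (rule sum.swap)
    moreover have "(\<Sum>m\<in>UNIV. \<Sum>n\<in>UNIV. \<Gamma> i k n z * curv \<Gamma> m n j m z) = (\<Sum>n\<in>UNIV. \<Gamma> i k n z * ricci g n j z)"
      by (subst sum.swap) (simp add: ricci_curv sum_distrib_left)
    moreover have "(\<Sum>m\<in>UNIV. \<Sum>n\<in>UNIV. \<Gamma> i j n z * curv \<Gamma> m k n m z) = (\<Sum>n\<in>UNIV. \<Gamma> i j n z * ricci g k n z)"
      by (subst sum.swap) (simp add: ricci_curv sum_distrib_left)
    ultimately show ?thesis
      by (simp add: cov_curv_def cov2_def sum.distrib sum_subtractf)
  qed
  have anti: "cov_curv \<Gamma> k i m j m z = - cov_curv \<Gamma> k m i j m z" for m
  proof -
    have "curv \<Gamma> i m j m = (\<lambda>z. - curv \<Gamma> m i j m z)"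
      by (rule ext) (rule curv_antisym)
    then have 0: "partial k (curv \<Gamma> i m j m) z = - partial k (curv \<Gamma> m i j m) z"
      using partial_minus[OF diffs(4)[OF z], of k m i j m] by simp
    have 1: "(\<Sum>n\<in>UNIV. c n * curv \<Gamma> n m j m z) = - (\<Sum>n\<in>UNIV. c n * curv \<Gamma> m n j m z)"
      and 2: "(\<Sum>n\<in>UNIV. c n * curv \<Gamma> i n j m z) = - (\<Sum>n\<in>UNIV. c n * curv \<Gamma> n i j m z)"
      and 3: "(\<Sum>n\<in>UNIV. c n * curv \<Gamma> i m n m z) = - (\<Sum>n\<in>UNIV. c n * curv \<Gamma> m i n m z)"
      and 4: "(\<Sum>n\<in>UNIV. c n * curv \<Gamma> i m j n z) = - (\<Sum>n\<in>UNIV. c n * curv \<Gamma> m i j n z)" for c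
      unfolding sum_negf[symmetric] mult_minus_right[symmetric]
      by (rule sum.cong[OF refl], rule arg_cong[where f = "(*) _"], rule curv_antisym)+
    show ?thesis
      unfolding cov_curv_def 0 1 2 3 4 by simp
  qed
  have "(\<Sum>l\<in>UNIV. \<Sum>b\<in>UNIV. g_up g l b z * cov4 \<Gamma> (riem g) b k i j l z) = (\<Sum>m\<in>UNIV. cov_curv \<Gamma> m k i j m z)"
    by (simp add: cov4_riem[OF z] contract_lowered[OF z])
  also have "\<dots> = (\<Sum>m\<in>UNIV. cov_curv \<Gamma> k m i j m z - cov_curv \<Gamma> i m k j m z)"
  proof (rule sum.cong[OF refl])
    fix m
    show "cov_curv \<Gamma> m k i j m z = cov_curv \<Gamma> k m i j m z - cov_curv \<Gamma> i m k j m z"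
      using second_bianchi[OF z, of m k i j m] anti[of m] by linarith
  qed
  finally show ?thesis by (simp add: sum_subtractf ric)
qed

section \<open>Divergence of the Weyl tensor and the Bach tensor\<close>

text \<open>A parallel metric factor passes through the derivative. The four placements are those of
  the Ricci terms in the Weyl tensor.\<close>

lemma cov4_metric:
  assumes z: "z \<in> \<Omega>" and t: "\<And>i j. smooth_on \<Omega> (t i j)"
  shows "cov4 \<Gamma> (\<lambda>k i j l z. t i j z * g z $ k $ l) b k i j l z = cov2 \<Gamma> t b i j z * g z $ k $ l"
    and "cov4 \<Gamma> (\<lambda>k i j l z. t k j z * g z $ i $ l) b k i j l z = cov2 \<Gamma> t b k j z * g z $ i $ l"
    and "cov4 \<Gamma> (\<lambda>k i j l z. t k l z * g z $ i $ j) b k i j l z = cov2 \<Gamma> t b k l z * g z $ i $ j"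
    and "cov4 \<Gamma> (\<lambda>k i j l z. t i l z * g z $ k $ j) b k i j l z = cov2 \<Gamma> t b i l z * g z $ k $ j"
  using z by (simp_all add: cov4_def cov2_def partial_mult diffs smooth_on_differentiable[OF t]
      metric_compat sum_distrib_left sum_distrib_right algebra_simps)

lemma cov4_linear:
  assumes z: "z \<in> \<Omega>" and t: "\<And>k i j l. smooth_on \<Omega> (t k i j l)" and s: "\<And>k i j l. smooth_on \<Omega> (s k i j l)"
  shows "cov4 \<Gamma> (\<lambda>k i j l z. t k i j l z + s k i j l z) b k i j l z = cov4 \<Gamma> t b k i j l z + cov4 \<Gamma> s b k i j l z"
    and "cov4 \<Gamma> (\<lambda>k i j l z. t k i j l z - s k i j l z) b k i j l z = cov4 \<Gamma> t b k i j l z - cov4 \<Gamma> s b k i j l z"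
  using z by (simp_all add: cov4_def partial_mult partial_add partial_diff smooth_on_differentiable[OF t]
      smooth_on_differentiable[OF s] sum.distrib sum_subtractf sum_distrib_left algebra_simps)

lemma cov4_scale:
  assumes z: "z \<in> \<Omega>" and t: "\<And>k i j l. smooth_on \<Omega> (t k i j l)"
  shows "cov4 \<Gamma> (\<lambda>k i j l z. c * t k i j l z) b k i j l z = c * cov4 \<Gamma> t b k i j l z"
  using z by (simp add: cov4_def partial_mult smooth_on_differentiable[OF t] sum_distrib_left algebra_simps)

lemma cov4_cong:
  assumes z: "z \<in> \<Omega>" and ts: "\<And>k i j l z. z \<in> \<Omega> \<Longrightarrow> t k i j l z = s k i j l z"
  shows "cov4 \<Gamma> t b k i j l z = cov4 \<Gamma> s b k i j l z"
  using partial_cong[OF open_dom z, of "t k i j l" "s k i j l" b] ts z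
  by (simp add: cov4_def)

definition "div_weyl k i j z = (\<Sum>l\<in>UNIV. \<Sum>b\<in>UNIV. g_up g l b z * cov4 \<Gamma> (weyl g) b k i j l z)"

text \<open>Of the four Ricci-metric terms, two contract to derivatives of the Ricci tensor, with
  the same pattern as the contracted Bianchi identity; the other two contain its divergence and
  vanish. The scalar curvature term is absent.\<close>

lemma div_weyl_ricci:
  assumes z: "z \<in> \<Omega>" and scal: "\<And>z. z \<in> \<Omega> \<Longrightarrow> scal g z = 0"
    and div: "\<And>k. (\<Sum>l\<in>UNIV. \<Sum>b\<in>UNIV. g_up g l b z * cov2 \<Gamma> (ricci g) b k l z) = 0"
  shows "div_weyl k i j z =
    (1 - 1 / (real CARD('n) - 2)) * (cov2 \<Gamma> (ricci g) k i j z - cov2 \<Gamma> (ricci g) i k j z)"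
proof -
  let ?c = "1 / (real CARD('n) - 2)"
  let ?r = "ricci g" and ?D = "cov2 \<Gamma> (ricci g)"
  have W: "cov4 \<Gamma> (weyl g) b k i j l z = cov4 \<Gamma> (riem g) b k i j l z
      - ?c * (?D b i j z * g z $ k $ l - ?D b k j z * g z $ i $ l + ?D b k l z * g z $ i $ j - ?D b i l z * g z $ k $ j)" for b l
  proof -
    have "cov4 \<Gamma> (weyl g) b k i j l z = cov4 \<Gamma> (\<lambda>k i j l z. riem g k i j l z
        - ?c * (?r i j z * g z $ k $ l - ?r k j z * g z $ i $ l + ?r k l z * g z $ i $ j - ?r i l z * g z $ k $ j)) b k i j l z"
      by (rule cov4_cong[OF z]) (simp add: weyl_def scal Let_def)
    then show ?thesis
      by (simp only: cov4_linear[OF z] cov4_scale[OF z] cov4_metric[OF z] smooth_riem smooth_ricci smooth_intros smooth_g simp_thms True_implies_equals)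
  qed
  have 3: "(\<Sum>l\<in>UNIV. \<Sum>b\<in>UNIV. g_up g l b z * (?D b k l z * x)) = 0" for k x
    using div[of k] by (simp add: sum_distrib_right[symmetric] mult.assoc[symmetric])
  have "div_weyl k i j z = (?D k i j z - ?D i k j z) - ?c * (?D k i j z - ?D i k j z)"
    unfolding div_weyl_def W right_diff_distrib distrib_left sum_subtractf sum.distrib
      mult.left_commute[of _ ?c] sum_distrib_left[symmetric]
      contracted_bianchi[OF z] contract_metric[OF z] 3
    by (simp add: algebra_simps)
  then show ?thesis by (simp add: algebra_simps)
qed

text \<open>The inverse metric is parallel by \<open>partial_up\<close>, so the contraction in
  \<open>l\<close>, \<open>b\<close> can be performed inside the outer covariant derivative. This
  lowers the tensor rank from five to three.\<close>

lemma contract_cov_tensor: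
  assumes z: "z \<in> \<Omega>"
  shows "(\<Sum>l\<in>UNIV. \<Sum>b\<in>UNIV. g_up g l b z *
      cov_tensor \<Gamma> (cov_tensor \<Gamma> (weyl_tensor g)) [a, b, k, i, j, l] z) = cov3 \<Gamma> div_weyl a k i j z"
proof -
  let ?T = "cov4 \<Gamma> (weyl g)" and ?U = "g_up g"
  have T: "cov_tensor \<Gamma> (weyl_tensor g) [b, k, i, j, l] = ?T b k i j l" for b k i j l
    by (simp add: cov_tensor_weyl fun_eq_iff)
  have sT: "smooth_on \<Omega> (?T b k i j l)" for b k i j l by (intro smooth_cov4 smooth_weyl)
  have d: "partial a (div_weyl k i j) z = (\<Sum>l\<in>UNIV. \<Sum>b\<in>UNIV. ?U l b z * partial a (?T b k i j l) z)
      - (\<Sum>l\<in>UNIV. \<Sum>b\<in>UNIV. ?U l b z * (\<Sum>m\<in>UNIV. \<Gamma> a l m z * ?T b k i j m z))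
      - (\<Sum>l\<in>UNIV. \<Sum>b\<in>UNIV. ?U l b z * (\<Sum>m\<in>UNIV. \<Gamma> a b m z * ?T m k i j l z))"
  proof -
    have "div_weyl k i j = (\<lambda>z. \<Sum>l\<in>UNIV. \<Sum>b\<in>UNIV. ?U l b z * ?T b k i j l z)"
      by (simp add: div_weyl_def fun_eq_iff)
    moreover have "partial a \<dots> z = (\<Sum>l\<in>UNIV. \<Sum>b\<in>UNIV. partial a (?U l b) z * ?T b k i j l z + ?U l b z * partial a (?T b k i j l) z)"
      using z by (simp add: partial_sum partial_mult diffs smooth_on_differentiable[OF sT]
          differentiable_sum differentiable_mult)
    moreover have "(\<Sum>l\<in>UNIV. \<Sum>b\<in>UNIV. partial a (?U l b) z * ?T b k i j l z)
       = - (\<Sum>l\<in>UNIV. \<Sum>b\<in>UNIV. \<Sum>m\<in>UNIV. \<Gamma> a m l z * ?U m b z * ?T b k i j l z)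
         - (\<Sum>l\<in>UNIV. \<Sum>b\<in>UNIV. \<Sum>m\<in>UNIV. \<Gamma> a m b z * ?U l m z * ?T b k i j l z)"
      by (simp add: partial_up[OF z] sum_distrib_right left_diff_distrib sum_subtractf sum_negf)
    moreover have "(\<Sum>l\<in>UNIV. \<Sum>b\<in>UNIV. \<Sum>m\<in>UNIV. \<Gamma> a m l z * ?U m b z * ?T b k i j l z)
       = (\<Sum>l\<in>UNIV. \<Sum>b\<in>UNIV. ?U l b z * (\<Sum>m\<in>UNIV. \<Gamma> a l m z * ?T b k i j m z))"
      by (subst sum3_swap) (simp add: sum_distrib_left mult_ac)
    moreover have "(\<Sum>l\<in>UNIV. \<Sum>b\<in>UNIV. \<Sum>m\<in>UNIV. \<Gamma> a m b z * ?U l m z * ?T b k i j l z)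
       = (\<Sum>l\<in>UNIV. \<Sum>b\<in>UNIV. ?U l b z * (\<Sum>m\<in>UNIV. \<Gamma> a b m z * ?T m k i j l z))"
      by (rule sum.cong[OF refl], subst sum.swap) (simp add: sum_distrib_left mult_ac)
    ultimately show ?thesis by (simp add: sum.distrib)
  qed
  have sw: "(\<Sum>m\<in>UNIV. c m * (\<Sum>l\<in>UNIV. \<Sum>b\<in>UNIV. ?U l b z * X m l b))
     = (\<Sum>l\<in>UNIV. \<Sum>b\<in>UNIV. ?U l b z * (\<Sum>m\<in>UNIV. c m * X m l b))" for c X
    unfolding sum_distrib_left
    by (subst sum3_swap, subst sum.swap, rule sum.cong[OF refl], rule sum.cong[OF refl], rule sum.cong[OF refl]) (simp add: mult_ac)
  show ?thesis
    unfolding cov_tensor_5 T cov3_def d div_weyl_def sw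
    by (simp add: right_diff_distrib sum_subtractf)
qed

theorem bach_formula:
  assumes z: "z \<in> \<Omega>"
  shows "bach g i j z = (\<Sum>k\<in>UNIV. \<Sum>a\<in>UNIV. g_up g k a z * cov3 \<Gamma> div_weyl a k i j z)
    + 1/2 * (\<Sum>k\<in>UNIV. \<Sum>l\<in>UNIV. \<Sum>a\<in>UNIV. \<Sum>b\<in>UNIV. g_up g k a z * g_up g l b z * ricci g a b z * weyl g k i j l z)"
proof -
  have "(\<Sum>k\<in>UNIV. \<Sum>l\<in>UNIV. \<Sum>a\<in>UNIV. \<Sum>b\<in>UNIV. g_up g k a z * g_up g l b z *
       cov_tensor \<Gamma> (cov_tensor \<Gamma> (weyl_tensor g)) [a, b, k, i, j, l] z)
     = (\<Sum>k\<in>UNIV. \<Sum>a\<in>UNIV. g_up g k a z * cov3 \<Gamma> div_weyl a k i j z)"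
    unfolding contract_cov_tensor[OF z, symmetric] sum_distrib_left mult.assoc[symmetric]
    by (rule sum.cong[OF refl], rule sum.swap)
  then show ?thesis
    by (simp add: bach_def distrib_left sum.distrib sum_distrib_left mult.assoc)
qed

end

section \<open>Curvature of the modified Riemannian extension\<close>

lemma UNIV_sum_2_2: "(\<Sum>a\<in>UNIV. f a) = f (Inl 1) + f (Inl 2) + f (Inr 1) + f (Inr (2::2)) " for f :: "2 + 2 \<Rightarrow> real"
proof -
  have "(\<Sum>a\<in>UNIV. f a) = (\<Sum>a\<in>UNIV. f (Inl a)) + (\<Sum>a\<in>UNIV. f (Inr a))"
    unfolding UNIV_Plus_UNIV[symmetric] by (subst sum.Plus) auto
  then show ?thesis by (simp add: sum_2)
qed

lemma UNIV_sum_Inl_Inr: "(\<Sum>a\<in>UNIV. f a) = (\<Sum>i\<in>UNIV. f (Inl i)) + (\<Sum>i\<in>UNIV. f (Inr i))"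
  for f :: "2 + 2 \<Rightarrow> real"
  by (simp add: UNIV_sum_2_2 sum_2)

lemma continuous_base_pt: "continuous_on S base_pt"
  unfolding base_pt_def by (intro continuous_intros)

lemma open_cotangent: "open N \<Longrightarrow> open (cotangent N)"
  using open_vimage[OF _ continuous_base_pt, of N] by (simp add: cotangent_def vimage_def)

lemma smooth_on_lift:
  assumes "open N" "smooth_on N f"
  shows "smooth_on (cotangent N) (\<lambda>z. f (base_pt z))"
  by (rule smooth_on_compose[OF open_cotangent[OF assms(1)] _ assms(2)])
     (auto simp: cotangent_def base_pt_def smooth_on_nth)

lemma partial_lift:
  assumes "smooth_on N f" "base_pt z \<in> N"
  shows "partial (Inl i) (\<lambda>z. f (base_pt z)) z = partial i f (base_pt z)"
    and "partial (Inr i) (\<lambda>z. f (base_pt z)) z = 0"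
    and "(\<lambda>z. f (base_pt z)) differentiable (at z)"
proof -
  have d: "(\<lambda>z. base_pt z $ j) differentiable (at z)" for j
    by (simp add: base_pt_def differentiable_nth)
  note f = smooth_on_differentiable[OF assms]
  note ch = partial_chain[OF f d]
  show "(\<lambda>z. f (base_pt z)) differentiable (at z)" by (rule ch(1))
  show "partial (Inl i) (\<lambda>z. f (base_pt z)) z = partial i f (base_pt z)"
    "partial (Inr i) (\<lambda>z. f (base_pt z)) z = 0"
    unfolding ch(2) by (simp_all add: base_pt_def partial_nth if_distrib[of "\<lambda>c. _ * c"] cong: if_cong)
qed

lemma matrix_inv_eqI: "(A::real^'n^'n) ** B = mat 1 \<Longrightarrow> matrix_inv A = B"
proof -
  assume AB: "A ** B = mat 1"
  then have "B ** A = mat 1" by (simp add: matrix_left_right_inverse)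
  with AB have "A ** matrix_inv A = mat 1 \<and> matrix_inv A ** A = mat 1"
    unfolding matrix_inv_def by (intro someI[of "\<lambda>A'. A ** A' = mat 1 \<and> A' ** A = mat 1" B]) simp
  then show "matrix_inv A = B" using AB by (metis matrix_mul_assoc matrix_mul_lid matrix_mul_rid)
qed

lemma partial_divide:
  "f differentiable (at x) \<Longrightarrow> partial i (\<lambda>x. f x / c) x = partial i f x / c"
  using partial_mult[of f x "\<lambda>x. inverse c" i] by (simp add: divide_inverse)

locale nilpotent_extension =
  fixes N :: "(real ^ 2) set" and \<gamma> :: "2 \<Rightarrow> 2 \<Rightarrow> 2 \<Rightarrow> real ^ 2 \<Rightarrow> real"
    and \<xi> \<alpha> :: "real ^ 2 \<Rightarrow> real" and \<Phi> :: "real ^ 2 \<Rightarrow> real ^ 2 ^ 2"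
  assumes open_base: "open N"
    and smooth_gamma: "\<And>i j k. smooth_on N (\<gamma> i j k)"
    and gamma_sym: "\<And>i j k x. x \<in> N \<Longrightarrow> \<gamma> i j k x = \<gamma> j i k x"
    and smooth_xi: "smooth_on N \<xi>" and smooth_alpha: "smooth_on N \<alpha>"
    and P1_eq: "\<And>x. x \<in> N \<Longrightarrow> P1 \<gamma> \<xi> x = 0"
    and P2_eq: "\<And>x. x \<in> N \<Longrightarrow> P2 \<gamma> \<xi> \<alpha> x = 0"
    and sym2: "smooth_sym2_on N \<Phi>"
begin

definition "u x = (\<alpha> x)\<^sup>2"

text \<open>\<open>T = \<alpha> v \<otimes> w\<close> with \<open>w(v) = 0\<close>; only \<open>u = \<alpha>\<^sup>2\<close> enters the metric.\<close>

definition "w i x = (if i = (1::2) then \<xi> x else 1)"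
definition "v i x = (if i = (1::2) then 1 else - \<xi> x)"
text \<open>The fibre coordinate y(v). Since the 1-form y composed with T is \<alpha> y(v) w, the
  quadratic part of the metric is the square of this form.\<close>

definition "p z = z $ Inr 1 - \<xi> (base_pt z) * z $ Inr (2::2)" for z :: "real ^ (2 + 2)"

definition "G i j z = u (base_pt z) * (p z)\<^sup>2 * w i (base_pt z) * w j (base_pt z)
    - 2 * (z $ Inr 1 * \<gamma> i j 1 (base_pt z) + z $ Inr 2 * \<gamma> i j 2 (base_pt z)) + \<Phi> (base_pt z) $ i $ j"

text \<open>Minus one half of the derivative of \<open>G\<close> along \<open>y\<^sub>k\<close>;
  this is the base part of the Levi-Civita connection.\<close>

definition "L i j k z = \<gamma> i j k (base_pt z)
    - u (base_pt z) * p z * v k (base_pt z) * w i (base_pt z) * w j (base_pt z)"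

abbreviation "\<Omega> \<equiv> cotangent N"
abbreviation "g \<equiv> mod_riem_ext (T_of \<xi> \<alpha>) \<gamma> \<Phi>"

lemmas open_total = open_cotangent[OF open_base]

lemma base_in: "z \<in> \<Omega> \<Longrightarrow> base_pt z \<in> N" by (simp add: cotangent_def)

lemma smooth_Phi: "smooth_on N (\<lambda>x. \<Phi> x $ i $ j)"
  using sym2 by (simp add: smooth_sym2_on_def)

lemma Phi_sym: "x \<in> N \<Longrightarrow> \<Phi> x $ i $ j = \<Phi> x $ j $ i"
  using sym2 by (auto simp: smooth_sym2_on_def transpose_def vec_eq_iff)

lemma smooth_u: "smooth_on N u"
  unfolding u_def[abs_def] by (intro smooth_on_power open_base smooth_alpha)

lemma smooth_w: "smooth_on N (w i)"
  unfolding w_def[abs_def] by (cases "i = 1") (auto simp: smooth_xi smooth_on_const)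

lemma smooth_v: "smooth_on N (v i)"
  unfolding v_def[abs_def] by (cases "i = 1") (auto simp: smooth_xi smooth_on_const smooth_on_minus open_base)

lemmas base_smooth = smooth_gamma smooth_xi smooth_alpha smooth_Phi smooth_u smooth_w smooth_v

lemmas total_smooth_intros = open_total smooth_on_const smooth_on_add smooth_on_diff smooth_on_minus
  smooth_on_mult smooth_on_power smooth_on_divide smooth_on_sum smooth_on_nth smooth_on_partial
  smooth_on_lift[OF open_base]

lemma smooth_p: "smooth_on \<Omega> p"
  unfolding p_def[abs_def] by (intro total_smooth_intros base_smooth)

lemma smooth_G: "smooth_on \<Omega> (G i j)"
  unfolding G_def[abs_def] by (intro total_smooth_intros base_smooth smooth_p)

lemma smooth_L: "smooth_on \<Omega> (L i j k)"
  unfolding L_def[abs_def] by (intro total_smooth_intros base_smooth smooth_p)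

lemma G_sym: "z \<in> \<Omega> \<Longrightarrow> G i j z = G j i z"
  using gamma_sym[OF base_in] Phi_sym[OF base_in] by (simp add: G_def)

lemma L_sym: "z \<in> \<Omega> \<Longrightarrow> L i j k z = L j i k z"
  using gamma_sym[OF base_in] by (simp add: L_def)

lemma metric_components:
  "g z $ Inl i $ Inl j = G i j z" "g z $ Inl i $ Inr j = (if i = j then 1 else 0)"
  "g z $ Inr i $ Inl j = (if i = j then 1 else 0)" "g z $ Inr i $ Inr j = 0"
proof -
  have "i = 1 \<or> i = 2" "j = 1 \<or> j = 2" using exhaust_2 by auto
  then show "g z $ Inl i $ Inl j = G i j z"
    by (elim disjE; simp add: mod_riem_ext_def Let_def G_def sum_2 T_of_def u_def w_def p_def)
       (simp_all add: power2_eq_square power4_eq_xxxx algebra_simps)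
qed (simp_all add: mod_riem_ext_def Let_def)

text \<open>Raising an index exchanges base and fibre directions, up to the block
  \<open>- G\<close>, which acts on fibre slots only. A symmetric tensor with base-base components
  alone is therefore trace free.\<close>

lemma up_components:
  assumes z: "z \<in> \<Omega>"
  shows "g_up g (Inl i) (Inl j) z = 0" "g_up g (Inl i) (Inr j) z = (if i = j then 1 else 0)"
    "g_up g (Inr i) (Inl j) z = (if i = j then 1 else 0)" "g_up g (Inr i) (Inr j) z = - G i j z"
    "matrix_inv (g z) ** g z = mat 1"
proof -
  define H :: "real ^ (2 + 2) ^ (2 + 2)" where "H = (\<chi> a b. case (a, b) of (Inl i, Inl j) \<Rightarrow> 0
    | (Inl i, Inr j) \<Rightarrow> (if i = j then 1 else 0) | (Inr i, Inl j) \<Rightarrow> (if i = j then 1 else 0)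
    | (Inr i, Inr j) \<Rightarrow> - G i j z)"
  have "(g z ** H) $ a $ b = mat 1 $ a $ b" for a b
    by (cases a; cases b; simp add: matrix_matrix_mult_def UNIV_sum_Inl_Inr metric_components H_def mat_def
        if_distrib[of "\<lambda>c. c * _"] if_distrib[of "\<lambda>c. _ * c"] cong: if_cong)
  then have "g z ** H = mat 1" by (simp add: vec_eq_iff)
  then have "matrix_inv (g z) = H" and "H ** g z = mat 1"
    by (simp_all add: matrix_inv_eqI matrix_left_right_inverse)
  then show "g_up g (Inl i) (Inl j) z = 0" "g_up g (Inl i) (Inr j) z = (if i = j then 1 else 0)"
    "g_up g (Inr i) (Inl j) z = (if i = j then 1 else 0)" "g_up g (Inr i) (Inr j) z = - G i j z"
    "matrix_inv (g z) ** g z = mat 1"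
    by (simp_all add: g_up_def H_def)
qed

lemma metric_fun:
  "(\<lambda>z. g z $ Inl i $ Inl j) = G i j" "(\<lambda>z. g z $ Inl i $ Inr j) = (\<lambda>z. if i = j then 1 else 0)"
  "(\<lambda>z. g z $ Inr i $ Inl j) = (\<lambda>z. if i = j then 1 else 0)" "(\<lambda>z. g z $ Inr i $ Inr j) = (\<lambda>z. 0)"
  by (simp_all add: metric_components fun_eq_iff)

sublocale smooth_metric \<Omega> g
proof
  show "open \<Omega>" by (rule open_total)
  show "smooth_on \<Omega> (\<lambda>z. g z $ a $ b)" for a b
    by (cases a; cases b) (simp_all add: metric_fun smooth_G smooth_on_const)
  show "smooth_on \<Omega> (g_up g a b)" for a b
  proof (cases a; cases b)
    fix i j assume "a = Inr i" "b = Inr j"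
    then show ?thesis
      using smooth_on_cong[OF open_total, of "g_up g a b" "\<lambda>z. - G i j z"]
      by (simp add: up_components smooth_on_minus open_total smooth_G)
  qed (simp_all add: smooth_on_cong[OF open_total, of _ "\<lambda>z. 0"] smooth_on_cong[OF open_total, of _ "\<lambda>z. if _ then 1 else 0"]
      up_components smooth_on_const)
  show "g z $ a $ b = g z $ b $ a" if "z \<in> \<Omega>" for z a b
    using G_sym[OF that] by (cases a; cases b) (simp_all add: metric_components)
  show "matrix_inv (g z) ** g z = mat 1" if "z \<in> \<Omega>" for z
    by (rule up_components(5)[OF that])
qed

lemmas pdiff = partial_divide partial_add partial_diff partial_minus partial_mult partial_power partial_sum partial_nth
  differentiable_add differentiable_diff differentiable_minus differentiable_mult differentiable_power
  differentiable_nth differentiable_const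

lemmas lift_rules = base_smooth[THEN partial_lift(1), OF base_in] base_smooth[THEN partial_lift(2), OF base_in]
  base_smooth[THEN partial_lift(3), OF base_in]

lemma differentiable_p: "z \<in> \<Omega> \<Longrightarrow> p differentiable (at z)"
  by (rule smooth_on_differentiable[OF smooth_p])

lemma partial_p:
  assumes "z \<in> \<Omega>"
  shows "partial (Inr k) p z = v k (base_pt z)"
    and "partial (Inl k) p z = - partial k \<xi> (base_pt z) * z $ Inr 2"
proof -
  have "k = 1 \<or> k = 2" using exhaust_2 by auto
  then show "partial (Inr k) p z = v k (base_pt z)"
    unfolding p_def[abs_def] using assms by (auto simp: pdiff lift_rules v_def)
  show "partial (Inl k) p z = - partial k \<xi> (base_pt z) * z $ Inr 2"
    unfolding p_def[abs_def] using assms by (simp add: pdiff lift_rules)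
qed

section \<open>Christoffel symbols of the extension\<close>

lemma partial_G_fibre:
  assumes z: "z \<in> \<Omega>"
  shows "partial (Inr k) (G i j) z = - 2 * L i j k z"
proof -
  have "k = 1 \<or> k = 2" using exhaust_2 by auto
  then show ?thesis
    unfolding G_def[abs_def] L_def using z
    by (elim disjE; simp add: pdiff lift_rules differentiable_p partial_p)
qed

lemma partial_L_fibre:
  assumes z: "z \<in> \<Omega>"
  shows "partial (Inr m) (L i j k) z = - u (base_pt z) * v m (base_pt z) * v k (base_pt z) * w i (base_pt z) * w j (base_pt z)"
  unfolding L_def[abs_def] using z
  by (simp add: pdiff lift_rules differentiable_p partial_p)

text \<open>The fibre components of the connection on base directions, the only ones that involve
  base derivatives of the metric.\<close>

definition "M i j k z = 1/2 * (partial (Inl i) (G j k) z + partial (Inl j) (G i k) z - partial (Inl k) (G i j) z)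
    - (\<Sum>l\<in>UNIV. G k l z * L i j l z)"

lemma christoffel_components:
  assumes z: "z \<in> \<Omega>"
  shows "levi_civita g (Inl i) (Inl j) (Inl k) z = L i j k z"
    "levi_civita g (Inl i) (Inr j) (Inl k) z = 0"
    "levi_civita g (Inr i) (Inl j) (Inl k) z = 0"
    "levi_civita g (Inr i) (Inr j) c z = 0"
    "levi_civita g (Inl i) (Inr j) (Inr k) z = - L i k j z"
    "levi_civita g (Inr j) (Inl i) (Inr k) z = - L i k j z"
    "levi_civita g (Inl i) (Inl j) (Inr k) z = M i j k z"
proof -
  show "levi_civita g (Inl i) (Inl j) (Inl k) z = L i j k z"
    "levi_civita g (Inl i) (Inr j) (Inl k) z = 0"
    "levi_civita g (Inr i) (Inl j) (Inl k) z = 0"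
    "levi_civita g (Inl i) (Inr j) (Inr k) z = - L i k j z"
    "levi_civita g (Inr j) (Inl i) (Inr k) z = - L i k j z"
    "levi_civita g (Inl i) (Inl j) (Inr k) z = M i j k z"
    by (simp_all add: levi_civita_def UNIV_sum_Inl_Inr up_components[OF z] metric_fun partial_G_fibre[OF z]
        M_def if_distrib[of "\<lambda>c. c * _"] sum_negf sum_distrib_left mult_ac cong: if_cong)
  show "levi_civita g (Inr i) (Inr j) c z = 0"
    by (cases c) (simp_all add: levi_civita_def UNIV_sum_Inl_Inr up_components[OF z] metric_fun)
qed

lemma partial_christoffel:
  assumes z: "z \<in> \<Omega>"
  shows "partial c (levi_civita g (Inl i) (Inl j) (Inl k)) z = partial c (L i j k) z"
    "partial c (levi_civita g (Inl i) (Inr j) (Inl k)) z = 0"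
    "partial c (levi_civita g (Inr i) (Inl j) (Inl k)) z = 0"
    "partial c (levi_civita g (Inr i) (Inr j) d) z = 0"
    "partial c (levi_civita g (Inl i) (Inr j) (Inr k)) z = - partial c (L i k j) z"
    "partial c (levi_civita g (Inr j) (Inl i) (Inr k)) z = - partial c (L i k j) z"
    "partial c (levi_civita g (Inl i) (Inl j) (Inr k)) z = partial c (M i j k) z"
  using partial_cong[OF open_total z, of "levi_civita g _ _ _" "\<lambda>z. 0"]
    partial_cong[OF open_total z, of "levi_civita g _ _ _" "\<lambda>z. - L _ _ _ z"]
    partial_cong[OF open_total z, of "levi_civita g _ _ _" "M _ _ _"]
    partial_cong[OF open_total z, of "levi_civita g _ _ _" "L _ _ _"]
    partial_minus[OF smooth_on_differentiable[OF smooth_L z]]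
  by (simp_all add: christoffel_components)

lemma partial_L_sym: "z \<in> \<Omega> \<Longrightarrow> partial c (L i j k) z = partial c (L j i k) z"
  by (rule partial_cong[OF open_total]) (auto simp: L_sym)

text \<open>The index \<open>k\<close> is repeated but not summed: this is the form in which
  \<open>M\<close> enters the trace defining the Ricci tensor.\<close>

lemma partial_M:
  assumes z: "z \<in> \<Omega>"
  shows "partial (Inr k) (M i j k) z = partial (Inl k) (L i j k) z - partial (Inl i) (L j k k) z
    - partial (Inl j) (L i k k) z + 2 * (\<Sum>l\<in>UNIV. L k l k z * L i j l z)
    + (\<Sum>l\<in>UNIV. G k l z * u (base_pt z) * v k (base_pt z) * v l (base_pt z) * w i (base_pt z) * w j (base_pt z))"
proof -
  \<comment> \<open>Exchanging the derivatives lets the fibre derivative act first, where it turns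
    \<open>G\<close> into \<open>- 2 * L\<close>.\<close>
  have mixed: "partial (Inr k) (partial (Inl i) (G j l)) z = - 2 * partial (Inl i) (L j l k) z" for i j l
  proof -
    have "partial (Inr k) (partial (Inl i) (G j l)) z = partial (Inl i) (partial (Inr k) (G j l)) z"
      by (rule partial_commute[OF open_total z smooth_G])
    also have "\<dots> = partial (Inl i) (\<lambda>z. - 2 * L j l k z) z"
      by (rule partial_cong[OF open_total z]) (simp add: partial_G_fibre)
    also have "\<dots> = - 2 * partial (Inl i) (L j l k) z"
      using smooth_on_differentiable[OF smooth_L z] by (simp add: pdiff)
    finally show ?thesis .
  qed
  note d = smooth_on_differentiable[OF smooth_L z] smooth_on_differentiable[OF smooth_G z]
    smooth_on_differentiable[OF smooth_on_partial[OF smooth_G] z]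
  show ?thesis
    unfolding M_def[abs_def]
    by (simp add: pdiff d mixed partial_G_fibre[OF z] partial_L_fibre[OF z] sum_2 algebra_simps)
qed

section \<open>The Ricci tensor of the extension\<close>

lemma w_v: "w 1 x * v 1 x + w 2 x * v 2 x = 0"
  by (simp add: w_def v_def)

lemma ricci_base:
  assumes z: "z \<in> \<Omega>"
  shows "ricci g (Inl i) (Inl j) z = (\<Sum>k\<in>UNIV. 2 * partial (Inl k) (L i j k) z - partial (Inl i) (L j k k) z
      - partial (Inl j) (L i k k) z + (\<Sum>l\<in>UNIV. 2 * L k l k z * L i j l z - 2 * L i l k z * L j k l z
      + G k l z * u (base_pt z) * v k (base_pt z) * v l (base_pt z) * w i (base_pt z) * w j (base_pt z)))"
  using partial_L_sym[OF z, of _ 2 1] L_sym[OF z, of 2 1]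
    partial_L_sym[OF z, of _ 1 j] L_sym[OF z, of 1 j] partial_L_sym[OF z, of _ 2 j] L_sym[OF z, of 2 j]
  by (simp add: ricci_curv curv_def UNIV_sum_2_2 sum_2 partial_christoffel[OF z] christoffel_components[OF z]
      partial_M[OF z])

text \<open>What remains in the mixed components is a trace of the fibre derivative of
  \<open>L\<close>, which contracts w with v. The three auxiliary facts state its vanishing for
  different orders of the factors.\<close>

lemma ricci_fibre:
  assumes z: "z \<in> \<Omega>"
  shows "ricci g (Inl i) (Inr j) z = 0" "ricci g (Inr j) (Inl i) z = 0" "ricci g (Inr i) (Inr j) z = 0"
proof -
  have 1: "u x * v 1 x * v k x * w a x * w 1 x + u x * v 2 x * v k x * w a x * w 2 x = 0" for a k x
    using w_v[of x] by algebra
  have 2: "u x * v 1 x * v k x * w 1 x * w a x + u x * v 2 x * v k x * w 2 x * w a x = 0" for a k x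
    using w_v[of x] by algebra
  have 3: "u x * v k x * v 1 x * w a x * w 1 x + u x * v k x * v 2 x * w a x * w 2 x = 0" for a k x
    using w_v[of x] by algebra
  show "ricci g (Inl i) (Inr j) z = 0" "ricci g (Inr j) (Inl i) z = 0" "ricci g (Inr i) (Inr j) z = 0"
    using 1[of "base_pt z" j i] 2[of "base_pt z" j i] 3[of "base_pt z" j i] L_sym[OF z, of 2 1]  L_sym[OF z, of _ i]
    by (simp_all add: ricci_curv curv_def UNIV_sum_2_2 sum_2 partial_christoffel[OF z] christoffel_components[OF z]
      partial_L_fibre[OF z] algebra_simps)
qed

text \<open>The coefficient function of \<open>p\<close> in the Ricci tensor: the derivative of
  \<open>u\<close> along v plus a multiple of \<open>u\<close>.\<close>

definition "E x = partial 1 u x - \<xi> x * partial 2 u x + u x * (- partial 2 \<xi> x + 3 * \<gamma> 2 2 1 x * (\<xi> x)\<^sup>2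
    - 5 * \<gamma> 1 2 1 x * \<xi> x + \<gamma> 2 2 2 x * \<xi> x + 2 * \<gamma> 1 1 1 x - \<gamma> 1 2 2 x)"

text \<open>Twice the symmetrized Ricci tensor of the affine connection.\<close>

definition "affine_ricci i j x = (\<Sum>k\<in>UNIV. 2 * partial k (\<gamma> i j k) x - partial i (\<gamma> j k k) x
    - partial j (\<gamma> i k k) x + (\<Sum>l\<in>UNIV. 2 * \<gamma> k l k x * \<gamma> i j l x - 2 * \<gamma> i l k x * \<gamma> j k l x))"

text \<open>The part of the Ricci tensor that is constant on fibres. The deformation tensor occurs
  only as \<Phi>(v,v).\<close>

definition "R0 i j x = u x * (\<Phi> x $ 1 $ 1 - 2 * \<xi> x * \<Phi> x $ 1 $ 2 + (\<xi> x)\<^sup>2 * \<Phi> x $ 2 $ 2) * w i x * w j x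
    + affine_ricci i j x"

lemma partial_xi:
  assumes "x \<in> N"
  shows "partial 1 \<xi> x = \<xi> x * partial 2 \<xi> x + \<gamma> 2 2 1 x * (\<xi> x) ^ 3 - (2 * \<gamma> 1 2 1 x - \<gamma> 2 2 2 x) * (\<xi> x)\<^sup>2
    + (\<gamma> 1 1 1 x - 2 * \<gamma> 1 2 2 x) * \<xi> x + \<gamma> 1 1 2 x"
  using P1_eq[OF assms] by (simp add: P1_def Let_def D_def)

lemma partial_w: "partial m (w 1) x = partial m \<xi> x" "partial m (w 2) x = 0"
  by (simp_all add: w_def[abs_def])

lemma partial_v: "partial m (v 1) x = 0" "x \<in> N \<Longrightarrow> partial m (v 2) x = - partial m \<xi> x"
  using smooth_on_differentiable[OF smooth_xi] by (simp_all add: v_def[abs_def] partial_minus)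

lemma partial_L_base:
  assumes z: "z \<in> \<Omega>"
  shows "partial (Inl m) (L i j k) z = partial m (\<gamma> i j k) (base_pt z)
    - partial m u (base_pt z) * p z * v k (base_pt z) * w i (base_pt z) * w j (base_pt z)
    + u (base_pt z) * (partial m \<xi> (base_pt z) * z $ Inr 2) * v k (base_pt z) * w i (base_pt z) * w j (base_pt z)
    - u (base_pt z) * p z * partial m (v k) (base_pt z) * w i (base_pt z) * w j (base_pt z)
    - u (base_pt z) * p z * v k (base_pt z) * partial m (w i) (base_pt z) * w j (base_pt z)
    - u (base_pt z) * p z * v k (base_pt z) * w i (base_pt z) * partial m (w j) (base_pt z)"
  unfolding L_def[abs_def] using z
  by (simp add: pdiff lift_rules differentiable_p partial_p) (simp add: algebra_simps)

lemma partial_gamma_sym: "x \<in> N \<Longrightarrow> partial m (\<gamma> i j k) x = partial m (\<gamma> j i k) x"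
  by (rule partial_cong[OF open_base]) (auto simp: gamma_sym)

text \<open>Terms quadratic in \<open>p\<close> contain w(v). The remaining fibre terms outside
  \<open>p\<close> are y2 v(\<xi>) - y(\<gamma>(v,v)), up to a common factor; the first equation
  says v(\<xi>) = w(\<gamma>(v,v)), which makes this a multiple of \<open>p\<close>.\<close>

lemma ricci_formula:
  assumes z: "z \<in> \<Omega>"
  shows "ricci g (Inl i) (Inl j) z
    = - 2 * p z * E (base_pt z) * w i (base_pt z) * w j (base_pt z) + R0 i j (base_pt z)"
proof -
  note x = base_in[OF z]
  have "i = 1 \<or> i = 2" "j = 1 \<or> j = 2" using exhaust_2 by auto
  then show ?thesis
    unfolding ricci_base[OF z] partial_L_base[OF z] R0_def affine_ricci_def sum_2 E_def
    by (elim disjE; simp only: partial_w partial_v(2)[OF x] partial_v(1)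
        partial_gamma_sym[OF x, of _ 2 1] gamma_sym[OF x, of 2 1] Phi_sym[OF x, of 2 1] G_def L_def w_def v_def p_def
        partial_xi[OF x] if_True if_False simp_thms one_neq_zero zero_neq_one; simp add: algebra_simps power2_eq_square power3_eq_cube)
qed

lemmas base_smooth_intros = open_base smooth_on_const smooth_on_add smooth_on_diff smooth_on_minus
  smooth_on_mult smooth_on_power smooth_on_divide smooth_on_sum smooth_on_partial base_smooth

lemma smooth_E: "smooth_on N E"
  unfolding E_def[abs_def] by (intro base_smooth_intros)

lemma smooth_R0: "smooth_on N (R0 i j)"
  unfolding R0_def[abs_def] affine_ricci_def by (intro base_smooth_intros)

text \<open>Minus one half of the fibre derivative of the Ricci tensor. It lives on the base because
  the Ricci tensor is affine in y, and it becomes zero when its index \<open>m\<close> is traced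
  with \<open>i\<close> or \<open>j\<close>.\<close>

definition "F m i j x = E x * v m x * w i x * w j x"

lemma smooth_F: "smooth_on N (F m i j)"
  unfolding F_def[abs_def] by (intro base_smooth_intros smooth_E)

definition "rho i j z = - 2 * p z * E (base_pt z) * w i (base_pt z) * w j (base_pt z) + R0 i j (base_pt z)"

lemma smooth_rho: "smooth_on \<Omega> (rho i j)"
  unfolding rho_def[abs_def] by (intro total_smooth_intros base_smooth smooth_p smooth_E smooth_R0)

lemma ricci_rho: "z \<in> \<Omega> \<Longrightarrow> ricci g (Inl i) (Inl j) z = rho i j z"
  by (simp add: ricci_formula rho_def)

lemma partial_ricci:
  assumes z: "z \<in> \<Omega>"
  shows "partial c (ricci g (Inl i) (Inl j)) z = partial c (rho i j) z"
    "partial c (ricci g (Inl i) (Inr j)) z = 0" "partial c (ricci g (Inr i) (Inl j)) z = 0"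
    "partial c (ricci g (Inr i) (Inr j)) z = 0"
  using partial_cong[OF open_total z, of "ricci g _ _" "\<lambda>z. 0"] partial_cong[OF open_total z, of "ricci g _ _" "rho _ _"]
  by (simp_all add: ricci_rho ricci_fibre)

lemma partial_rho_fibre:
  assumes z: "z \<in> \<Omega>"
  shows "partial (Inr k) (rho i j) z = - 2 * F k i j (base_pt z)"
  unfolding rho_def[abs_def] F_def using z
  by (simp add: pdiff lift_rules differentiable_p partial_p partial_lift[OF smooth_E base_in]
      partial_lift[OF smooth_R0 base_in])

lemma F_trace: "F 1 i 1 x + F 2 i 2 x = 0" "F 1 1 i x + F 2 2 i x = 0"
  using w_v[of x] by (simp add: F_def; algebra)+

text \<open>The fibre directions form a parallel distribution that the Ricci tensor annihilates, so
  a fibre index in either Ricci slot still gives zero after differentiation.\<close>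

lemma cov_ricci_components:
  assumes z: "z \<in> \<Omega>"
  shows "cov2 (levi_civita g) (ricci g) (Inl a) (Inl b) (Inl c) z = partial (Inl a) (rho b c) z
      - (\<Sum>m\<in>UNIV. L a b m z * rho m c z) - (\<Sum>m\<in>UNIV. L a c m z * rho b m z)"
    "cov2 (levi_civita g) (ricci g) (Inr a) (Inl b) (Inl c) z = - 2 * F a b c (base_pt z)"
    "cov2 (levi_civita g) (ricci g) d (Inr b) e z = 0"
    "cov2 (levi_civita g) (ricci g) d e (Inr b) z = 0"
  by (cases d; cases e; simp add: cov2_def UNIV_sum_Inl_Inr christoffel_components[OF z] ricci_rho[OF z] ricci_fibre[OF z]
      partial_ricci[OF z] partial_rho_fibre[OF z])+

lemma scal_zero: "z \<in> \<Omega> \<Longrightarrow> scal g z = 0"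
  by (simp add: scal_def UNIV_sum_Inl_Inr up_components ricci_fibre)

text \<open>Raising the differentiation index pairs a base direction with a fibre direction; the
  only surviving contribution is a trace of \<open>F\<close>.\<close>

lemma div_ricci_zero:
  assumes z: "z \<in> \<Omega>"
  shows "(\<Sum>l\<in>UNIV. \<Sum>b\<in>UNIV. g_up g l b z * cov2 (levi_civita g) (ricci g) b k l z) = 0"
proof (cases k)
  case (Inl i)
  have "F 2 i 2 (base_pt z) = - F 1 i 1 (base_pt z)" using F_trace(1)[of i "base_pt z"] by linarith
  with Inl show ?thesis
    by (simp add: UNIV_sum_Inl_Inr up_components[OF z] cov_ricci_components[OF z] sum_2)
next
  case (Inr i)
  then show ?thesis
    by (simp add: UNIV_sum_Inl_Inr up_components[OF z] cov_ricci_components[OF z] sum_2)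
qed

section \<open>Divergence of the Weyl tensor on the extension\<close>

text \<open>One half of the antisymmetrized derivative of the Ricci tensor in base directions; 1/2
  is 1 - 1/(n - 2) for n = 4, and the connection terms symmetric in \<open>k\<close>,
  \<open>i\<close> have cancelled.\<close>

definition "C k i j z = 1/2 * (partial (Inl k) (rho i j) z - partial (Inl i) (rho k j) z
    - (\<Sum>m\<in>UNIV. L k j m z * rho i m z) + (\<Sum>m\<in>UNIV. L i j m z * rho k m z))"

lemma div_weyl_components:
  assumes z: "z \<in> \<Omega>"
  shows "div_weyl (Inl k) (Inl i) (Inl j) z = C k i j z"
    "div_weyl (Inr k) (Inl i) (Inl j) z = - F k i j (base_pt z)"
    "div_weyl (Inl i) (Inr k) (Inl j) z = F k i j (base_pt z)"
    "div_weyl (Inr k) (Inr i) d z = 0"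
    "div_weyl d e (Inr j) z = 0"
proof -
  have D: "div_weyl a b c z = 1/2 * (cov2 (levi_civita g) (ricci g) a b c z - cov2 (levi_civita g) (ricci g) b a c z)" for a b c
    using div_weyl_ricci[OF z scal_zero div_ricci_zero[OF z], of a b c] by simp
  show "div_weyl (Inl k) (Inl i) (Inl j) z = C k i j z"
    "div_weyl (Inr k) (Inl i) (Inl j) z = - F k i j (base_pt z)"
    "div_weyl (Inl i) (Inr k) (Inl j) z = F k i j (base_pt z)"
    "div_weyl (Inr k) (Inr i) d z = 0"
    "div_weyl d e (Inr j) z = 0"
    unfolding D by (simp_all add: cov_ricci_components[OF z] C_def L_sym[OF z, of i k])
qed

lemma partial_div_weyl:
  assumes z: "z \<in> \<Omega>"
  shows "partial c (div_weyl (Inl k) (Inl i) (Inl j)) z = partial c (C k i j) z"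
    "partial (Inl m) (div_weyl (Inr k) (Inl i) (Inl j)) z = - partial m (F k i j) (base_pt z)"
    "partial (Inr m) (div_weyl (Inr k) (Inl i) (Inl j)) z = 0"
    "partial (Inl m) (div_weyl (Inl i) (Inr k) (Inl j)) z = partial m (F k i j) (base_pt z)"
    "partial (Inr m) (div_weyl (Inl i) (Inr k) (Inl j)) z = 0"
    "partial c (div_weyl (Inr k) (Inr i) d) z = 0"
    "partial c (div_weyl d e (Inr j)) z = 0"
  using partial_cong[OF open_total z, of "div_weyl _ _ _" "\<lambda>z. 0"] partial_cong[OF open_total z, of "div_weyl _ _ _" "C _ _ _"]
    partial_cong[OF open_total z, of "div_weyl _ _ _" "\<lambda>z. F _ _ _ (base_pt z)"]
    partial_cong[OF open_total z, of "div_weyl _ _ _" "\<lambda>z. - F _ _ _ (base_pt z)"]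
    partial_lift[OF smooth_F base_in[OF z]]
  by (simp_all add: div_weyl_components partial_minus)

text \<open>The Ricci tensor with raised indices has fibre-fibre components only, so these Weyl
  components, with fibre indices outside, are all that the algebraic term of the Bach tensor
  sees.\<close>

lemma weyl_fibre:
  assumes z: "z \<in> \<Omega>"
  shows "weyl g (Inr k) (Inl i) (Inl j) (Inr l) z
      = - u (base_pt z) * v k (base_pt z) * v l (base_pt z) * w i (base_pt z) * w j (base_pt z)"
    "weyl g (Inr k) (Inr i) d (Inr l) z = 0" "weyl g (Inr k) d (Inr j) (Inr l) z = 0"
  by (cases d; simp add: weyl_def Let_def scal_zero[OF z] metric_components ricci_fibre[OF z] riem_curv UNIV_sum_Inl_Inr
      curv_def partial_christoffel[OF z] christoffel_components[OF z] partial_L_fibre[OF z]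
      if_distrib[of "\<lambda>c. _ * c"] cong: if_cong)+

lemma partial_C:
  assumes z: "z \<in> \<Omega>"
  shows "partial (Inr m) (C k i j) z = - partial k (F m i j) (base_pt z) + partial i (F m k j) (base_pt z)
    + (\<Sum>n\<in>UNIV. L k j n z * F m i n (base_pt z) - L i j n z * F m k n (base_pt z)
      + 1/2 * u (base_pt z) * v m (base_pt z) * v n (base_pt z) * w j (base_pt z) *
          (w k (base_pt z) * rho i n z - w i (base_pt z) * rho k n z))"
proof -
  have mixed: "partial (Inr m) (partial (Inl k) (rho i j)) z = - 2 * partial k (F m i j) (base_pt z)" for i j k
  proof -
    have "partial (Inr m) (partial (Inl k) (rho i j)) z = partial (Inl k) (partial (Inr m) (rho i j)) z"
      by (rule partial_commute[OF open_total z smooth_rho])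
    also have "\<dots> = partial (Inl k) (\<lambda>z. - 2 * F m i j (base_pt z)) z"
      by (rule partial_cong[OF open_total z]) (simp add: partial_rho_fibre)
    also have "\<dots> = - 2 * partial k (F m i j) (base_pt z)"
      using partial_lift[OF smooth_F base_in[OF z]] by (simp add: pdiff)
    finally show ?thesis .
  qed
  note d = smooth_on_differentiable[OF smooth_L z] smooth_on_differentiable[OF smooth_rho z]
    smooth_on_differentiable[OF smooth_on_partial[OF smooth_rho] z]
  show ?thesis
    unfolding C_def[abs_def]
    by (simp add: pdiff d mixed partial_L_fibre[OF z] partial_rho_fibre[OF z] sum_2) (simp add: algebra_simps)
qed

section \<open>The Bach tensor of the extension\<close>

lemma bach_fibre:
  assumes z: "z \<in> \<Omega>"
  shows "bach g (Inr i) d z = 0" "bach g d (Inr j) z = 0"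
  by (cases d; simp add: bach_formula[OF z] cov3_def UNIV_sum_Inl_Inr up_components[OF z] ricci_fibre[OF z]
      weyl_fibre[OF z] div_weyl_components[OF z] partial_div_weyl[OF z] christoffel_components[OF z] sum_2)+

text \<open>The divergence of Weyl vanishes with fibre indices in its first two slots or in its
  last. Hence \<open>M\<close> always meets a zero, and so does the block \<open>- G\<close> of the
  inverse metric.\<close>

lemma bach_base:
  assumes z: "z \<in> \<Omega>"
  shows "bach g (Inl i) (Inl j) z = (\<Sum>k\<in>UNIV. partial (Inr k) (C k i j) z - partial k (F k i j) (base_pt z)
    + (\<Sum>m\<in>UNIV. - 2 * L k m k z * F m i j (base_pt z) + L i m k z * F m k j (base_pt z)
      + L k i m z * F k m j (base_pt z) + L k j m z * F k i m (base_pt z)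
      - 1/2 * rho k m z * u (base_pt z) * v k (base_pt z) * v m (base_pt z) * w i (base_pt z) * w j (base_pt z)))"
  by (simp add: bach_formula[OF z] cov3_def UNIV_sum_Inl_Inr up_components[OF z] ricci_fibre[OF z] ricci_rho[OF z]
      weyl_fibre[OF z] div_weyl_components[OF z] partial_div_weyl[OF z] christoffel_components[OF z] sum_2)

text \<open>In terms of \<open>u = \<alpha>\<^sup>2\<close>, the second equation is linear.\<close>

lemma P2_u:
  assumes x: "x \<in> N"
  shows "partial 1 (partial 1 u) x + (\<xi> x)\<^sup>2 * partial 2 (partial 2 u) x - 2 * \<xi> x * partial 1 (partial 2 u) x
    = partial 1 u x * (2 * partial 2 \<xi> x - 5 * \<gamma> 2 2 1 x * (\<xi> x)\<^sup>2 + 2 * (4 * \<gamma> 1 2 1 x - \<gamma> 2 2 2 x) * \<xi> x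
                     - 3 * \<gamma> 1 1 1 x + 2 * \<gamma> 1 2 2 x)
     - partial 2 u x * (2 * \<xi> x * partial 2 \<xi> x - 6 * \<gamma> 2 2 1 x * \<xi> x ^ 3 + (10 * \<gamma> 1 2 1 x - 3 * \<gamma> 2 2 2 x) * (\<xi> x)\<^sup>2
                     - 4 * (\<gamma> 1 1 1 x - \<gamma> 1 2 2 x) * \<xi> x - \<gamma> 1 1 2 x)
     - 2 * u x * (6 * \<xi> x ^ 4 * (\<gamma> 2 2 1 x) ^ 2
       - 2 * \<xi> x ^ 3 * (partial 2 (\<gamma> 2 2 1) x + 9 * \<gamma> 1 2 1 x * \<gamma> 2 2 1 x - 3 * \<gamma> 2 2 1 x * \<gamma> 2 2 2 x)
       - \<xi> x ^ 2 * (4 * \<gamma> 2 2 1 x * partial 2 \<xi> x - 3 * partial 2 (\<gamma> 1 2 1) x - 2 * partial 1 (\<gamma> 2 2 1) x + partial 2 (\<gamma> 2 2 2) x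
                        - 12 * (\<gamma> 1 2 1 x) ^ 2 - (\<gamma> 2 2 2 x) ^ 2 - 7 * \<gamma> 1 1 1 x * \<gamma> 2 2 1 x
                        + 7 * \<gamma> 1 2 1 x * \<gamma> 2 2 2 x + 9 * \<gamma> 1 2 2 x * \<gamma> 2 2 1 x)
       + \<xi> x * (2 * (3 * \<gamma> 1 2 1 x - \<gamma> 2 2 2 x) * partial 2 \<xi> x - partial 2 (\<gamma> 1 1 1) x - 3 * partial 1 (\<gamma> 1 2 1) x
                    + partial 2 (\<gamma> 1 2 2) x + partial 1 (\<gamma> 2 2 2) x
                    - 2 * (\<gamma> 1 1 1 x - \<gamma> 1 2 2 x) * (4 * \<gamma> 1 2 1 x - \<gamma> 2 2 2 x) + 4 * \<gamma> 1 1 2 x * \<gamma> 2 2 1 x)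
       - (2 * (\<gamma> 1 1 1 x - \<gamma> 1 2 2 x) * partial 2 \<xi> x - partial 1 (\<gamma> 1 1 1) x + partial 1 (\<gamma> 1 2 2) x
                - (\<gamma> 1 1 1 x) ^ 2 + \<gamma> 1 1 1 x * \<gamma> 1 2 2 x + 3 * \<gamma> 1 1 2 x * \<gamma> 1 2 1 x - \<gamma> 1 1 2 x * \<gamma> 2 2 2 x))"
proof -
  have 1: "partial i u y = 2 * \<alpha> y * partial i \<alpha> y" if "y \<in> N" for i y
    unfolding u_def[abs_def] using smooth_on_differentiable[OF smooth_alpha that] by (simp add: partial_power)
  have 2: "partial j (partial i u) x = 2 * (partial j \<alpha> x * partial i \<alpha> x + \<alpha> x * partial j (partial i \<alpha>) x)" for i j
  proof -
    have "partial j (partial i u) x = partial j (\<lambda>y. 2 * \<alpha> y * partial i \<alpha> y) x"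
      by (rule partial_cong[OF open_base x]) (rule 1)
    then show ?thesis
      using smooth_on_differentiable[OF smooth_alpha x] smooth_on_differentiable[OF smooth_on_partial[OF smooth_alpha] x]
      by (simp add: partial_mult differentiable_mult algebra_simps)
  qed
  show ?thesis
    using P2_eq[OF x] unfolding P2_def Let_def D_def 1[OF x] 2 u_def
    by (simp add: eval_nat_numeral algebra_simps)
qed

text \<open>The solved first equation differentiated in \<open>x\<^sup>2\<close>. It eliminates the
  mixed derivative of \<xi> that arises when \<open>E\<close> is differentiated.\<close>

lemma partial_xi_mixed:
  assumes x: "x \<in> N"
  shows "partial 1 (partial 2 \<xi>) x = (partial 2 \<xi> x)\<^sup>2 + \<xi> x * partial 2 (partial 2 \<xi>) x
    + partial 2 (\<gamma> 2 2 1) x * (\<xi> x) ^ 3 + 3 * \<gamma> 2 2 1 x * (\<xi> x)\<^sup>2 * partial 2 \<xi> x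
    - (2 * partial 2 (\<gamma> 1 2 1) x - partial 2 (\<gamma> 2 2 2) x) * (\<xi> x)\<^sup>2
    - 2 * (2 * \<gamma> 1 2 1 x - \<gamma> 2 2 2 x) * \<xi> x * partial 2 \<xi> x
    + (partial 2 (\<gamma> 1 1 1) x - 2 * partial 2 (\<gamma> 1 2 2) x) * \<xi> x
    + (\<gamma> 1 1 1 x - 2 * \<gamma> 1 2 2 x) * partial 2 \<xi> x + partial 2 (\<gamma> 1 1 2) x"
proof -
  note d = smooth_on_differentiable[OF smooth_xi x] smooth_on_differentiable[OF smooth_gamma x]
    smooth_on_differentiable[OF smooth_on_partial[OF smooth_xi] x]
  have "partial 1 (partial 2 \<xi>) x = partial 2 (partial 1 \<xi>) x"
    by (rule partial_commute[OF open_base x smooth_xi])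
  also have "\<dots> = partial 2 (\<lambda>x. \<xi> x * partial 2 \<xi> x + \<gamma> 2 2 1 x * (\<xi> x) ^ 3 - (2 * \<gamma> 1 2 1 x - \<gamma> 2 2 2 x) * (\<xi> x)\<^sup>2
    + (\<gamma> 1 1 1 x - 2 * \<gamma> 1 2 2 x) * \<xi> x + \<gamma> 1 1 2 x) x"
    by (rule partial_cong[OF open_base x]) (rule partial_xi)
  finally show ?thesis by (simp add: pdiff d power2_eq_square algebra_simps)
qed

lemma partial_E:
  assumes x: "x \<in> N"
  shows "partial m E x = partial m (partial 1 u) x - partial m \<xi> x * partial 2 u x - \<xi> x * partial m (partial 2 u) x
    + partial m u x * (- partial 2 \<xi> x + 3 * \<gamma> 2 2 1 x * (\<xi> x)\<^sup>2
      - 5 * \<gamma> 1 2 1 x * \<xi> x + \<gamma> 2 2 2 x * \<xi> x + 2 * \<gamma> 1 1 1 x - \<gamma> 1 2 2 x)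
    + u x * (- partial m (partial 2 \<xi>) x + 3 * partial m (\<gamma> 2 2 1) x * (\<xi> x)\<^sup>2
      + 6 * \<gamma> 2 2 1 x * \<xi> x * partial m \<xi> x
      - 5 * partial m (\<gamma> 1 2 1) x * \<xi> x - 5 * \<gamma> 1 2 1 x * partial m \<xi> x
      + partial m (\<gamma> 2 2 2) x * \<xi> x + \<gamma> 2 2 2 x * partial m \<xi> x + 2 * partial m (\<gamma> 1 1 1) x - partial m (\<gamma> 1 2 2) x)"
proof -
  note d = smooth_on_differentiable[OF smooth_xi x] smooth_on_differentiable[OF smooth_gamma x]
    smooth_on_differentiable[OF smooth_u x] smooth_on_differentiable[OF smooth_on_partial[OF smooth_u] x]
    smooth_on_differentiable[OF smooth_on_partial[OF smooth_xi] x]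
  show ?thesis
    unfolding E_def[abs_def] by (simp add: pdiff d)
qed

lemma partial_F:
  assumes x: "x \<in> N"
  shows "partial m (F k i j) x = partial m E x * v k x * w i x * w j x
    + E x * (partial m (v k) x * w i x * w j x + v k x * partial m (w i) x * w j x + v k x * w i x * partial m (w j) x)"
proof -
  note d = smooth_on_differentiable[OF smooth_E x] smooth_on_differentiable[OF smooth_v x]
    smooth_on_differentiable[OF smooth_w x]
  show ?thesis
    unfolding F_def[abs_def] by (simp add: pdiff d) (simp add: algebra_simps)
qed

lemma partial_F_trace: "partial m (F 2 2 i) x = - partial m (F 1 1 i) x" if "x \<in> N"
proof -
  have "F 2 2 i = (\<lambda>x. - F 1 1 i x)"
    using F_trace(2)[of i] by (simp add: fun_eq_iff eq_neg_iff_add_eq_0 add.commute)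
  then show ?thesis
    using partial_minus[OF smooth_on_differentiable[OF smooth_F that], of m 1 1 i] by simp
qed

text \<open>All dependence on the fibre and on \<Phi> cancels: in \<open>L\<close> and
  \<open>rho\<close> these parts carry factors v or w that meet w(v) = 0 in each contraction. The
  two remaining Ricci terms add up to the affine Ricci tensor on (v, v).\<close>

lemma bach_contracted:
  assumes z: "z \<in> \<Omega>"
  defines "x \<equiv> base_pt z"
  shows "bach g (Inl i) (Inl j) z = (\<Sum>k\<in>UNIV. - 2 * partial k (F k i j) x
    + (\<Sum>m\<in>UNIV. 2 * E x * v k x * w m x * (\<gamma> k j m x * w i x + \<gamma> k i m x * w j x)
      - 2 * E x * w i x * w j x * \<gamma> k m k x * v m x - u x * w i x * w j x * affine_ricci k m x * v k x * v m x))"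
proof -
  note x = base_in[OF z]
  have ij: "i = 1 \<or> i = 2" "j = 1 \<or> j = 2" using exhaust_2 by auto
  then show ?thesis
    unfolding bach_base[OF z] partial_C[OF z] sum_2 partial_F_trace[OF x] x_def rho_def R0_def
      L_sym[OF z, of 2 1] L_def gamma_sym[OF x, of 2 1]
    by (elim disjE; simp only: F_def w_def v_def if_True if_False simp_thms one_neq_zero zero_neq_one
        gamma_sym[OF x, of 2 1]; simp add: algebra_simps power2_eq_square)
qed

text \<open>The first equation in dual form: \<nabla>_v w is a multiple of w. The factor is read off
  from the second component, where w is the constant 1.\<close>

lemma w_parallel:
  assumes x: "x \<in> N"
  shows "(\<Sum>k\<in>UNIV. v k x * partial k (w i) x - (\<Sum>m\<in>UNIV. \<gamma> k i m x * v k x * w m x))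
    = - (\<Sum>k\<in>UNIV. \<Sum>m\<in>UNIV. \<gamma> k 2 m x * v k x * w m x) * w i x"
proof -
  have "i = 1 \<or> i = 2" using exhaust_2 by auto
  then show ?thesis
    unfolding sum_2 gamma_sym[OF x, of 2 1]
    by (elim disjE; simp only: partial_w partial_xi[OF x] w_def v_def if_True if_False simp_thms one_neq_zero zero_neq_one
       gamma_sym[OF x, of 2 1]; simp add: algebra_simps power2_eq_square power3_eq_cube)
qed

text \<open>The scalar left in the Bach tensor after w_i w_j is split off. It is the derivative of
  \<open>E\<close> along v with lower-order corrections, that is, a second-order operator in
  \<open>u\<close> along v; it equals twice P2.\<close>

lemma P2_E:
  assumes x: "x \<in> N"
  shows "(\<Sum>k\<in>UNIV. v k x * partial k E x + E x * partial k (v k) x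
    + (\<Sum>m\<in>UNIV. E x * \<gamma> k m k x * v m x - 2 * E x * \<gamma> k 2 m x * v k x * w m x
      + 1/2 * u x * affine_ricci k m x * v k x * v m x)) = 0"
proof -
  \<comment> \<open>Rearranged to express the second \<partial>_1-derivative of \<open>u\<close>,
    for use as a rewrite rule.\<close>
  note P2 = P2_u[OF x, unfolded diff_eq_eq, THEN eq_diff_eq[THEN iffD2]]
  show ?thesis
    unfolding sum_2 affine_ricci_def gamma_sym[OF x, of 2 1] partial_gamma_sym[OF x, of _ 2 1]
    by (simp only: partial_v(2)[OF x] partial_v(1) partial_E[OF x]
        partial_gamma_sym[OF x, of _ 2 1] gamma_sym[OF x, of 2 1] w_def v_def E_def
        partial_commute[OF open_base x smooth_u, of 2 1] P2
        partial_xi[OF x] partial_xi_mixed[OF x] if_True if_False simp_thms one_neq_zero zero_neq_one)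
     (simp add: algebra_simps power2_eq_square power3_eq_cube power4_eq_xxxx)
qed

lemma bach_zero:
  assumes z: "z \<in> \<Omega>"
  shows "bach g (Inl i) (Inl j) z = 0"
proof -
  define x where "x = base_pt z"
  have x: "x \<in> N" using base_in[OF z] by (simp add: x_def)
  show ?thesis
    \<comment> \<open>The derivatives of w_i and w_j along v are eliminated by the dual first
      equation; what is left is -2 w_i w_j times the expression in \<open>P2_E\<close>.\<close>
    using w_parallel[OF x, of i] w_parallel[OF x, of j] P2_E[OF x]
    unfolding bach_contracted[OF z] x_def[symmetric] partial_F[OF x] sum_2
    by algebra
qed

theorem bach_flat: "bach_flat_on \<Omega> g"
  unfolding bach_flat_on_def pseudo_riemannian_on_def
proof (intro conjI ballI allI)
  show "open \<Omega>" by (rule open_total)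
  show "smooth_on \<Omega> (\<lambda>z. g z $ i $ j)" for i j by (rule smooth_g)
  fix z assume z: "z \<in> \<Omega>"
  show "transpose (g z) = g z" using sym[OF z] by (simp add: transpose_def vec_eq_iff)
  show "invertible (g z)" using inv[OF z] inv'[OF z] by (auto simp: invertible_def)
  show "bach g i j z = 0" for i j
    by (cases i; cases j) (simp_all add: bach_zero[OF z] bach_fibre[OF z])
qed

end

section \<open>Charts and Christoffel symbols\<close>

lemma chart_facts:
  assumes c: "is_chart X c"
  shows "inj_on (snd c) (fst c)" and "open (snd c ` fst c)"
    and "\<And>W. openin X W \<Longrightarrow> open (snd c ` (fst c \<inter> W))"
    and "\<And>p. p \<in> fst c \<Longrightarrow> chart_inv c (snd c p) = p"
proof -
  have o: "openin X (fst c)" and os: "open (snd c ` fst c)"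
    and h: "homeomorphic_map (subtopology X (fst c)) (top_of_set (snd c ` fst c)) (snd c)"
    using c by (auto simp: is_chart_def)
  have t: "topspace (subtopology X (fst c)) = fst c"
    using openin_subset[OF o] by auto
  show inj: "inj_on (snd c) (fst c)" using homeomorphic_imp_injective_map[OF h] unfolding t .
  show "open (snd c ` fst c)" by (rule os)
  show "open (snd c ` (fst c \<inter> W))" if "openin X W" for W
  proof -
    have "openin (subtopology X (fst c)) (fst c \<inter> W)"
      using that by (simp add: openin_subtopology_Int2)
    then have "openin (top_of_set (snd c ` fst c)) (snd c ` (fst c \<inter> W))"
      using homeomorphic_imp_open_map[OF h] unfolding open_map_def by blast
    then show ?thesis using os by (simp add: openin_open_eq)
  qed
  show "chart_inv c (snd c p) = p" if "p \<in> fst c" for p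
    unfolding chart_inv_def by (rule the_inv_into_f_f[OF inj that])
qed

lemma real_analytic_at_has_derivative:
  fixes f :: "real ^ 2 \<Rightarrow> real ^ 'n::finite"
  assumes "real_analytic_at f a"
  shows "f differentiable (at a)"
    and "frechet_derivative f (at a) (axis i 1) $ k = partial i (\<lambda>x. f x $ k) a"
proof -
  have "real_analytic_at (\<lambda>x. f x $ k) a" for k
    by (rule real_analytic_at_bounded_linear[OF bounded_linear_vec_nth assms])
  then have d: "(\<lambda>x. f x $ k) differentiable (at a)" for k
    unfolding real_analytic_at_iff by (auto simp: differentiable_def dest: has_fps2_has_derivative(2))
  define f' where "f' h = (\<chi> k. frechet_derivative (\<lambda>x. f x $ k) (at a) h)" for h
  have f': "(f has_derivative f') (at a)"
    unfolding has_derivative_componentwise_within[of f]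
    using d[unfolded frechet_derivative_works] by (auto simp: Basis_vec_def inner_axis f'_def)
  then show "f differentiable (at a)" by (auto simp: differentiable_def)
  show "frechet_derivative f (at a) (axis i 1) $ k = partial i (\<lambda>x. f x $ k) a"
    unfolding frechet_derivative_at[OF f', symmetric] by (simp add: f'_def partial_frechet[OF d])
qed

context
  fixes X :: "'p topology" and A :: "'p chart set"
  assumes surface: "real_analytic_surface X A"
begin

lemma atlas_chart: "c \<in> A \<Longrightarrow> is_chart X c"
  using surface by (auto simp: real_analytic_surface_def)

lemma atlas_open: "c \<in> A \<Longrightarrow> openin X (fst c)"
  using atlas_chart by (auto simp: is_chart_def)

lemma coord_change_eq: "c \<in> A \<Longrightarrow> p \<in> fst c \<Longrightarrow> coord_change c c' (snd c p) = snd c' p"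
  using chart_facts(4)[OF atlas_chart] by (simp add: coord_change_def)

lemma coord_change_analytic:
  assumes "c \<in> A" "c' \<in> A" "p \<in> fst c" "p \<in> fst c'"
  shows "real_analytic_at (coord_change c c') (snd c p)"
  using surface assms unfolding real_analytic_surface_def analytically_compatible_def real_analytic_on_def by blast

lemma coord_vfield_component:
  assumes "c \<in> A" "c' \<in> A" "p \<in> fst c" "p \<in> fst c'"
  shows "coord_vfield c i c' (snd c' p) $ k = partial i (\<lambda>x. coord_change c c' x $ k) (snd c p)"
  using assms real_analytic_at_has_derivative(2)[OF coord_change_analytic[OF assms]]
  by (simp add: coord_vfield_def coord_change_eq)

text \<open>Components in another chart are derivatives of an analytic coordinate change, composed
  with the reverse change. The transformation law is the chain rule on the triple overlap.\<close>

lemma smooth_coord_vfield: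
  assumes c: "c \<in> A"
  shows "smooth_vfield_on A (fst c) (coord_vfield c i)"
  unfolding smooth_vfield_on_def
proof (intro conjI ballI allI)
  fix c' k assume c': "c' \<in> A"
  let ?S' = "snd c' ` (fst c' \<inter> fst c)" and ?S = "snd c ` (fst c \<inter> fst c')"
  have oS': "open ?S'" by (rule chart_facts(3)[OF atlas_chart[OF c'] atlas_open[OF c]])
  have "real_analytic_on (\<lambda>x. coord_change c c' x $ k) ?S"
    unfolding real_analytic_on_def
    using coord_change_analytic[OF c c'] real_analytic_at_bounded_linear[OF bounded_linear_vec_nth] by blast
  then have 1: "smooth_on ?S (partial i (\<lambda>x. coord_change c c' x $ k))"
    by (intro smooth_on_partial real_analytic_on_imp_smooth_on)
  have "real_analytic_on (\<lambda>x. coord_change c' c x $ j) ?S'" for j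
    unfolding real_analytic_on_def
    using coord_change_analytic[OF c' c] real_analytic_at_bounded_linear[OF bounded_linear_vec_nth] by blast
  then have 2: "smooth_on ?S' (\<lambda>x. coord_change c' c x $ j)" for j by (rule real_analytic_on_imp_smooth_on)
  have "smooth_on ?S' (\<lambda>x'. partial i (\<lambda>x. coord_change c c' x $ k) (coord_change c' c x'))"
    by (rule smooth_on_compose[OF oS' _ 1 2]) (auto simp: coord_change_eq[OF c'])
  then show "smooth_on ?S' (\<lambda>x. coord_vfield c i c' x $ k)"
    by (subst smooth_on_cong[OF oS', of _ "\<lambda>x'. partial i (\<lambda>x. coord_change c c' x $ k) (coord_change c' c x')"])
       (auto simp: coord_vfield_component[OF c c'] coord_change_eq[OF c'])
next
  fix c1 c2 x assume c1: "c1 \<in> A" and c2: "c2 \<in> A" and "x \<in> snd c1 ` (fst c1 \<inter> fst c2 \<inter> fst c)"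
  then obtain p where p: "p \<in> fst c1" "p \<in> fst c2" "p \<in> fst c" and x: "x = snd c1 p" by auto
  let ?y = "snd c p"
  have e: "coord_change c1 c2 x = snd c2 p" "coord_change c2 c (snd c2 p) = ?y" "coord_change c1 c x = ?y"
    "coord_change c c1 ?y = x"
    using p c1 c2 c by (simp_all add: x coord_change_eq)
  have d1: "(coord_change c c1 has_derivative frechet_derivative (coord_change c c1) (at ?y)) (at ?y)"
    using real_analytic_at_has_derivative(1)[OF coord_change_analytic[OF c c1 p(3,1)]] by (simp add: frechet_derivative_works)
  have d2: "(coord_change c1 c2 has_derivative frechet_derivative (coord_change c1 c2) (at x)) (at (coord_change c c1 ?y))"
    using real_analytic_at_has_derivative(1)[OF coord_change_analytic[OF c1 c2 p(1,2)]] unfolding e(4) x[symmetric]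
    by (simp add: frechet_derivative_works)
  have "(coord_change c c2 has_derivative
      frechet_derivative (coord_change c1 c2) (at x) \<circ> frechet_derivative (coord_change c c1) (at ?y)) (at ?y)"
  proof (rule has_derivative_transform_within_open[OF diff_chain_at[OF d1 d2]])
    show "open (snd c ` (fst c \<inter> (fst c1 \<inter> fst c2)))"
      by (intro chart_facts(3)[OF atlas_chart[OF c]] openin_Int atlas_open c1 c2)
    show "?y \<in> snd c ` (fst c \<inter> (fst c1 \<inter> fst c2))" using p by blast
    show "(coord_change c1 c2 \<circ> coord_change c c1) y = coord_change c c2 y" if "y \<in> snd c ` (fst c \<inter> (fst c1 \<inter> fst c2))" for y
      using that c c1 by (auto simp: coord_change_eq)
  qed
  from frechet_derivative_at[OF this]
  show "coord_vfield c i c2 (coord_change c1 c2 x) = frechet_derivative (coord_change c1 c2) (at x) (coord_vfield c i c1 x)"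
    unfolding coord_vfield_def e by (simp add: fun_eq_iff)
qed

lemma coord_vfield_self:
  assumes c: "c \<in> A" and x: "x \<in> snd c ` fst c"
  shows "coord_vfield c i c x = axis i 1"
proof -
  obtain p where p: "p \<in> fst c" "x = snd c p" using x by blast
  have "((\<lambda>x. x) has_derivative (\<lambda>h. h)) (at x)" by (rule has_derivative_ident)
  then have "(coord_change c c has_derivative (\<lambda>h. h)) (at x)"
    by (rule has_derivative_transform_within_open[OF _ chart_facts(2)[OF atlas_chart[OF c]] x])
       (use c in \<open>auto simp: coord_change_eq\<close>)
  from frechet_derivative_at[OF this] show ?thesis
    using p c by (simp add: coord_vfield_def coord_change_eq fun_eq_iff)
qed

text \<open>In its own chart a coordinate field has constant components, so brackets of coordinate
  fields vanish there and torsion freeness gives the symmetry.\<close>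

lemma christoffel_sym:
  assumes c: "c \<in> A" and tf: "torsion_free X A nabla" and x: "x \<in> snd c ` fst c"
  shows "christoffel nabla c i j k x = christoffel nabla c j i k x"
proof -
  let ?V = "coord_vfield c"
  have "vfield_eq_on A (fst c) (\<lambda>c' x. nabla (fst c) (?V i) (?V j) c' x - nabla (fst c) (?V j) (?V i) c' x)
      (\<lambda>c'. lie_bracket (?V i c') (?V j c'))"
    using tf smooth_coord_vfield[OF c] atlas_open[OF c] unfolding torsion_free_def by blast
  then have "nabla (fst c) (?V i) (?V j) c x - nabla (fst c) (?V j) (?V i) c x = lie_bracket (?V i c) (?V j c) x"
    using c x unfolding vfield_eq_on_def by auto
  moreover have "partial m (\<lambda>y. ?V l c y $ k) x = 0" for m l k
  proof -
    have "partial m (\<lambda>y. ?V l c y $ k) x = partial m (\<lambda>y. axis l 1 $ k) x"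
      by (rule partial_cong[OF chart_facts(2)[OF atlas_chart[OF c]] x]) (simp add: coord_vfield_self[OF c])
    then show ?thesis by simp
  qed
  then have "lie_bracket (?V i c) (?V j c) x = 0"
    by (simp add: lie_bracket_def vf_apply_def vec_eq_iff)
  ultimately have "nabla (fst c) (?V i) (?V j) c x = nabla (fst c) (?V j) (?V i) c x" by simp
  then show ?thesis by (simp add: christoffel_def)
qed

end

section \<open>Bach flat extensions from local solutions\<close>

lemma nilpotent_T_of: "nilpotent (T_of \<xi> \<alpha> x)"
proof -
  have "T_of \<xi> \<alpha> x ** T_of \<xi> \<alpha> x = 0"
    by (simp add: T_of_def vec_eq_iff forall_2 matrix_matrix_mult_def sum_2 power2_eq_square algebra_simps)
  then show ?thesis
    unfolding nilpotent_def by (intro exI[of _ 2]) (simp add: numeral_2_eq_2)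
qed

text \<open>T is a sum of three constant matrices with scalar analytic coefficients, which reduces
  the matrix-valued statement to scalar ones.\<close>

lemma real_analytic_at_T_of:
  assumes \<xi>: "real_analytic_at \<xi> a" and \<alpha>: "real_analytic_at \<alpha> a"
  shows "real_analytic_at (T_of \<xi> \<alpha>) a"
proof -
  have T: "T_of \<xi> \<alpha> = (\<lambda>x. (\<alpha> x * \<xi> x) *\<^sub>R vector [vector [1, 0], vector [0, -1]] + \<alpha> x *\<^sub>R vector [vector [0, 1], vector [0, 0]]
      + (\<alpha> x * \<xi> x ^ 2) *\<^sub>R vector [vector [0, 0], vector [-1, 0]])"
    by (simp add: T_of_def vec_eq_iff forall_2 fun_eq_iff)
  show ?thesis
    unfolding T
    by (intro real_analytic_at_add real_analytic_at_bounded_linear[OF bounded_linear_scaleR_left]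
        real_analytic_intros \<xi> \<alpha>)
qed

lemma bach_flat_on_extension:
  assumes N: "open N" and \<Gamma>: "\<And>i j k. real_analytic_on (\<Gamma> i j k) N"
    and sym: "\<And>i j k x. x \<in> N \<Longrightarrow> \<Gamma> i j k x = \<Gamma> j i k x"
    and \<xi>: "real_analytic_on \<xi> N" and \<alpha>: "real_analytic_on \<alpha> N"
    and P: "\<And>x. x \<in> N \<Longrightarrow> P1 \<Gamma> \<xi> x = 0" "\<And>x. x \<in> N \<Longrightarrow> P2 \<Gamma> \<xi> \<alpha> x = 0"
    and \<Phi>: "smooth_sym2_on N \<Phi>"
  shows "bach_flat_on (cotangent N) (mod_riem_ext (T_of \<xi> \<alpha>) \<Gamma> \<Phi>)"
proof -
  interpret nilpotent_extension N \<Gamma> \<xi> \<alpha> \<Phi>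
    using assms by unfold_locales (auto intro: real_analytic_on_imp_smooth_on)
  show ?thesis by (rule bach_flat)
qed

lemma on_initial_line: "(x :: real ^ 2) $ 1 = 0 \<Longrightarrow> x = vector [0, x $ 2]"
  by (simp add: vec_eq_iff forall_2)

lemma eventually_coordinate_in_open:
  fixes a :: "real ^ 2"
  assumes "open I" "a $ k \<in> I"
  shows "\<forall>\<^sub>F x in nhds a. x $ k \<in> I"
proof -
  have "((\<lambda>x. x $ k) \<longlongrightarrow> a $ k) (nhds a)" by (rule tendsto_vec_nth[OF filterlim_ident])
  from topological_tendstoD[OF this assms] show ?thesis .
qed

text \<open>Near the origin the restrictions to \<open>I\<close> and \<open>U\<close> hold
  automatically, so the initial condition becomes one on germs along the line
  \<open>x\<^sup>1 = 0\<close>.\<close>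

lemma P1_solution_germ:
  assumes sol: "P1_solution S \<Gamma> I \<xi>0 U \<xi>" and I: "open I" "0 \<in> I"
  shows "real_analytic_at \<xi> 0" "\<forall>\<^sub>F x in nhds 0. P1 \<Gamma> \<xi> x = 0"
    "\<forall>\<^sub>F x in nhds 0. x $ 1 = (0 :: real ^ 2) $ 1 \<longrightarrow> \<xi> x = \<xi>0 (x $ 2)"
proof -
  have U: "\<forall>\<^sub>F x in nhds 0. x \<in> U" using sol by (auto simp: P1_solution_def intro: eventually_nhds_in_open)
  have "\<forall>\<^sub>F x in nhds (0 :: real ^ 2). x $ 2 \<in> I"
    using I by (intro eventually_coordinate_in_open) auto
  with U show "\<forall>\<^sub>F x in nhds 0. x $ 1 = (0 :: real ^ 2) $ 1 \<longrightarrow> \<xi> x = \<xi>0 (x $ 2)"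
    by eventually_elim (use sol on_initial_line in \<open>auto simp: P1_solution_def\<close>)
  show "\<forall>\<^sub>F x in nhds 0. P1 \<Gamma> \<xi> x = 0"
    using U by eventually_elim (use sol in \<open>auto simp: P1_solution_def\<close>)
  show "real_analytic_at \<xi> 0" using sol by (auto simp: P1_solution_def real_analytic_on_def)
qed

lemma P2_solution_germ:
  assumes sol: "P2_solution S \<Gamma> \<xi> J \<alpha>0 \<alpha>1 V \<alpha>" and J: "open J" "0 \<in> J"
  shows "real_analytic_at \<alpha> 0" "\<forall>\<^sub>F x in nhds 0. P2 \<Gamma> \<xi> \<alpha> x = 0"
    "\<forall>\<^sub>F x in nhds 0. x $ 1 = (0 :: real ^ 2) $ 1 \<longrightarrow> \<alpha> x = \<alpha>0 (x $ 2)"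
    "\<forall>\<^sub>F x in nhds 0. x $ 1 = (0 :: real ^ 2) $ 1 \<longrightarrow> partial 1 \<alpha> x = \<alpha>1 (x $ 2)"
proof -
  have U: "\<forall>\<^sub>F x in nhds 0. x \<in> V" using sol by (auto simp: P2_solution_def intro: eventually_nhds_in_open)
  have J': "\<forall>\<^sub>F x in nhds (0 :: real ^ 2). x $ 2 \<in> J"
    using J by (intro eventually_coordinate_in_open) auto
  from U J' show "\<forall>\<^sub>F x in nhds 0. x $ 1 = (0 :: real ^ 2) $ 1 \<longrightarrow> \<alpha> x = \<alpha>0 (x $ 2)"
    by eventually_elim (use sol on_initial_line in \<open>auto simp: P2_solution_def\<close>)
  from U J' show "\<forall>\<^sub>F x in nhds 0. x $ 1 = (0 :: real ^ 2) $ 1 \<longrightarrow> partial 1 \<alpha> x = \<alpha>1 (x $ 2)"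
    by eventually_elim (use sol on_initial_line in \<open>auto simp: P2_solution_def D_def\<close>)
  show "\<forall>\<^sub>F x in nhds 0. P2 \<Gamma> \<xi> \<alpha> x = 0"
    using U by eventually_elim (use sol in \<open>auto simp: P2_solution_def\<close>)
  show "real_analytic_at \<alpha> 0" using sol by (auto simp: P2_solution_def real_analytic_on_def)
qed

lemma P1_solution_exists:
  assumes S: "open S" "0 \<in> S" and \<Gamma>: "\<And>i j k. real_analytic_on (\<Gamma> i j k) S"
    and \<xi>0: "real_analytic_on \<xi>0 I" "0 \<in> I"
  shows "\<exists>U \<xi>. P1_solution S \<Gamma> I \<xi>0 U \<xi>"
proof -
  have "real_analytic_at (\<Gamma> i j k) 0" "real_analytic_at \<xi>0 ((0 :: real ^ 2) $ 2)" for i j k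
    using \<Gamma> S \<xi>0 by (auto simp: real_analytic_on_def)
  then obtain \<xi> where \<xi>: "real_analytic_at \<xi> 0" "\<forall>\<^sub>F x in nhds 0. P1 \<Gamma> \<xi> x = 0"
    "\<forall>\<^sub>F x in nhds 0. x $ 1 = (0 :: real ^ 2) $ 1 \<longrightarrow> \<xi> x = \<xi>0 (x $ 2)"
    by (rule P1_exists[where p = 0 and \<Gamma> = \<Gamma>]) blast
  have "\<forall>\<^sub>F x in nhds 0. x \<in> S \<and> real_analytic_at \<xi> x \<and> P1 \<Gamma> \<xi> x = 0 \<and> (x $ 1 = 0 \<longrightarrow> \<xi> x = \<xi>0 (x $ 2))"
    using real_analytic_at_eventually[OF \<xi>(1)] \<xi>(2,3) eventually_nhds_in_open[OF S]
    by eventually_elim auto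
  then obtain U where U: "open U" "0 \<in> U"
    "\<And>x. x \<in> U \<Longrightarrow> x \<in> S \<and> real_analytic_at \<xi> x \<and> P1 \<Gamma> \<xi> x = 0 \<and> (x $ 1 = 0 \<longrightarrow> \<xi> x = \<xi>0 (x $ 2))"
    unfolding eventually_nhds by blast
  then have "P1_solution S \<Gamma> I \<xi>0 U \<xi>"
    unfolding P1_solution_def by (auto simp: real_analytic_on_def)
  then show ?thesis by blast
qed

lemma P1_solution_unique:
  assumes "0 \<in> S" and \<Gamma>: "\<And>i j k. real_analytic_on (\<Gamma> i j k) S"
    and I: "real_analytic_on \<xi>0 I" "open I" "0 \<in> I"
    and sol: "P1_solution S \<Gamma> I \<xi>0 U \<xi>" "P1_solution S \<Gamma> I \<xi>0 U' \<xi>'"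
  shows "\<forall>\<^sub>F x in nhds 0. \<xi> x = \<xi>' x"
proof -
  have an: "real_analytic_at (\<Gamma> i j k) 0" "real_analytic_at \<xi>0 ((0 :: real ^ 2) $ 2)" for i j k
    using assms by (auto simp: real_analytic_on_def)
  note germ = P1_solution_germ[OF sol(1) I(2,3)] P1_solution_germ[OF sol(2) I(2,3)]
  show ?thesis by (rule P1_unique[where \<Gamma> = \<Gamma> and ?\<xi>0.0 = \<xi>0, OF an germ(1,4) germ(2,5) germ(3,6)])
qed

lemma P2_solution_exists:
  assumes U: "open U" "0 \<in> U" and \<Gamma>: "\<And>i j k. real_analytic_at (\<Gamma> i j k) 0" and \<xi>: "real_analytic_at \<xi> 0"
    and J: "real_analytic_on \<alpha>0 J" "real_analytic_on \<alpha>1 J" "0 \<in> J" and ne: "\<alpha>0 0 \<noteq> 0"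
  shows "\<exists>V \<alpha>. P2_solution U \<Gamma> \<xi> J \<alpha>0 \<alpha>1 V \<alpha>"
proof -
  have "real_analytic_at \<alpha>0 ((0 :: real ^ 2) $ 2)" "\<alpha>0 ((0 :: real ^ 2) $ 2) \<noteq> 0"
    "real_analytic_at \<alpha>1 ((0 :: real ^ 2) $ 2)"
    using J ne by (auto simp: real_analytic_on_def)
  with \<Gamma> \<xi> obtain \<alpha> where \<alpha>: "real_analytic_at \<alpha> 0" "\<forall>\<^sub>F x in nhds 0. P2 \<Gamma> \<xi> \<alpha> x = 0"
    "\<forall>\<^sub>F x in nhds 0. x $ 1 = (0 :: real ^ 2) $ 1 \<longrightarrow> \<alpha> x = \<alpha>0 (x $ 2)"
    "\<forall>\<^sub>F x in nhds 0. x $ 1 = (0 :: real ^ 2) $ 1 \<longrightarrow> partial 1 \<alpha> x = \<alpha>1 (x $ 2)"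
    by (rule P2_exists[where p = 0 and \<Gamma> = \<Gamma>]) blast
  have "\<forall>\<^sub>F x in nhds 0. x \<in> U \<and> real_analytic_at \<alpha> x \<and> P2 \<Gamma> \<xi> \<alpha> x = 0
      \<and> (x $ 1 = 0 \<longrightarrow> \<alpha> x = \<alpha>0 (x $ 2) \<and> D 1 0 \<alpha> x = \<alpha>1 (x $ 2))"
    using real_analytic_at_eventually[OF \<alpha>(1)] \<alpha>(2-) eventually_nhds_in_open[OF U]
    by eventually_elim (auto simp: D_def)
  then obtain V where V: "open V" "0 \<in> V"
    "\<And>x. x \<in> V \<Longrightarrow> x \<in> U \<and> real_analytic_at \<alpha> x \<and> P2 \<Gamma> \<xi> \<alpha> x = 0
      \<and> (x $ 1 = 0 \<longrightarrow> \<alpha> x = \<alpha>0 (x $ 2) \<and> D 1 0 \<alpha> x = \<alpha>1 (x $ 2))"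
    unfolding eventually_nhds by blast
  then have "P2_solution U \<Gamma> \<xi> J \<alpha>0 \<alpha>1 V \<alpha>"
    unfolding P2_solution_def by (auto simp: real_analytic_on_def)
  then show ?thesis by blast
qed

lemma P2_solution_unique:
  assumes \<Gamma>: "\<And>i j k. real_analytic_at (\<Gamma> i j k) 0" and \<xi>: "real_analytic_at \<xi> 0"
    and J: "real_analytic_on \<alpha>0 J" "real_analytic_on \<alpha>1 J" "open J" "0 \<in> J" and ne: "\<alpha>0 0 \<noteq> 0"
    and sol: "P2_solution U \<Gamma> \<xi> J \<alpha>0 \<alpha>1 V \<alpha>" "P2_solution U \<Gamma> \<xi> J \<alpha>0 \<alpha>1 V' \<alpha>'"
  shows "\<forall>\<^sub>F x in nhds 0. \<alpha> x = \<alpha>' x"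
proof -
  have an: "real_analytic_at \<alpha>0 ((0 :: real ^ 2) $ 2)" "\<alpha>0 ((0 :: real ^ 2) $ 2) \<noteq> 0"
    "real_analytic_at \<alpha>1 ((0 :: real ^ 2) $ 2)"
    using J ne by (auto simp: real_analytic_on_def)
  note germ = P2_solution_germ[OF sol(1) J(3,4)] P2_solution_germ[OF sol(2) J(3,4)]
  show ?thesis
    by (rule P2_unique[where \<Gamma> = \<Gamma> and \<xi> = \<xi> and ?\<alpha>0.0 = \<alpha>0 and ?\<alpha>1.0 = \<alpha>1,
        OF \<Gamma> \<xi> an germ(1,5) germ(2,6) germ(3,7) germ(4,8)])
qed

text \<open>The germ results are available at an arbitrary point, so any chart around
  \<open>a\<close> serves without recentring. The data are \<xi> = 0, \<alpha> = 1 and vanishing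
  \<partial>_1-derivative of \<alpha> on the initial line; continuity keeps \<alpha> nonzero
  nearby.\<close>

lemma bach_flat_extension_exists:
  assumes S: "open S" "a \<in> S" and \<Gamma>: "\<And>i j k. real_analytic_on (\<Gamma> i j k) S"
    and sym: "\<And>i j k x. x \<in> S \<Longrightarrow> \<Gamma> i j k x = \<Gamma> j i k x"
  shows "\<exists>N T. open N \<and> a \<in> N \<and> N \<subseteq> S \<and> real_analytic_on T N \<and> (\<forall>x\<in>N. nilpotent (T x) \<and> T x \<noteq> 0) \<and>
    (\<forall>\<Phi>. smooth_sym2_on N \<Phi> \<longrightarrow> bach_flat_on (cotangent N) (mod_riem_ext T \<Gamma> \<Phi>))"
proof -
  have \<Gamma>a: "real_analytic_at (\<Gamma> i j k) a" for i j k using \<Gamma> S by (auto simp: real_analytic_on_def)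
  obtain \<xi> where \<xi>: "real_analytic_at \<xi> a" "\<forall>\<^sub>F x in nhds a. P1 \<Gamma> \<xi> x = 0"
    by (rule P1_exists[where \<Gamma> = \<Gamma>, OF \<Gamma>a real_analytic_at_const[of 0]]) blast
  obtain \<alpha> where \<alpha>: "real_analytic_at \<alpha> a" "\<forall>\<^sub>F x in nhds a. P2 \<Gamma> \<xi> \<alpha> x = 0"
    "\<forall>\<^sub>F x in nhds a. x $ 1 = a $ 1 \<longrightarrow> \<alpha> x = 1"
    by (rule P2_exists[where \<Gamma> = \<Gamma>, OF \<Gamma>a \<xi>(1) real_analytic_at_const[of 1] _ real_analytic_at_const[of 0]]) auto
  have "\<alpha> a = 1" using eventually_nhds_x_imp_x[OF \<alpha>(3)] by simp
  moreover have "isCont \<alpha> a"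
    using \<alpha>(1) unfolding real_analytic_at_iff
    by (auto dest: has_fps2_has_derivative(2) intro: has_derivative_continuous)
  then have "(\<alpha> \<longlongrightarrow> \<alpha> a) (nhds a)" by (simp add: isCont_def tendsto_at_iff_tendsto_nhds)
  ultimately have "\<forall>\<^sub>F x in nhds a. \<alpha> x \<noteq> 0"
    by (intro tendsto_imp_eventually_ne[of \<alpha> "\<alpha> a"]) auto
  then have "\<forall>\<^sub>F x in nhds a. x \<in> S \<and> real_analytic_at \<xi> x \<and> real_analytic_at \<alpha> x \<and>
      P1 \<Gamma> \<xi> x = 0 \<and> P2 \<Gamma> \<xi> \<alpha> x = 0 \<and> \<alpha> x \<noteq> 0"
    using real_analytic_at_eventually[OF \<xi>(1)] real_analytic_at_eventually[OF \<alpha>(1)] \<xi>(2) \<alpha>(2)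
      eventually_nhds_in_open[OF S] by eventually_elim auto
  then obtain N where N: "open N" "a \<in> N" "\<And>x. x \<in> N \<Longrightarrow> x \<in> S \<and> real_analytic_at \<xi> x \<and> real_analytic_at \<alpha> x \<and>
      P1 \<Gamma> \<xi> x = 0 \<and> P2 \<Gamma> \<xi> \<alpha> x = 0 \<and> \<alpha> x \<noteq> 0"
    unfolding eventually_nhds by blast
  have "T_of \<xi> \<alpha> x \<noteq> 0" if "x \<in> N" for x
  proof -
    \<comment> \<open>This entry of T is \<alpha> itself.\<close>
    have "T_of \<xi> \<alpha> x $ 1 $ 2 \<noteq> 0" using N(3)[OF that] by (simp add: T_of_def)
    then show ?thesis by auto
  qed
  moreover have "bach_flat_on (cotangent N) (mod_riem_ext (T_of \<xi> \<alpha>) \<Gamma> \<Phi>)" if "smooth_sym2_on N \<Phi>" for \<Phi>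
    using N \<Gamma> by (intro bach_flat_on_extension that sym) (auto simp: real_analytic_on_def)
  moreover have "real_analytic_on (T_of \<xi> \<alpha>) N"
    using N(3) real_analytic_at_T_of by (auto simp: real_analytic_on_def)
  ultimately show ?thesis
    using N nilpotent_T_of by (intro exI[of _ N] exI[of _ "T_of \<xi> \<alpha>"]) auto
qed

theorem mainTheorem3:
  fixes X :: "'p topology" and A :: "'p chart set"
    and nabla :: "'p set \<Rightarrow> 'p vfield \<Rightarrow> 'p vfield \<Rightarrow> 'p vfield"
    and P :: 'p and c :: "'p chart"
    and S :: "(real ^ 2) set" and \<Gamma> :: "2 \<Rightarrow> 2 \<Rightarrow> 2 \<Rightarrow> real ^ 2 \<Rightarrow> real"
  assumes "real_analytic_affine_surface X A nabla"
    and "P \<in> topspace X"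
    and "c \<in> A" and "P \<in> fst c" and "snd c P = 0"
    and "S = snd c ` fst c" and "\<Gamma> = christoffel nabla c"
  shows "(\<forall>I (\<xi>0 :: real \<Rightarrow> real). open I \<and> 0 \<in> I \<and> real_analytic_on \<xi>0 I \<longrightarrow>
           (\<exists>U \<xi>. P1_solution S \<Gamma> I \<xi>0 U \<xi>) \<and>
           (\<forall>U \<xi> U' \<xi>'. P1_solution S \<Gamma> I \<xi>0 U \<xi> \<and> P1_solution S \<Gamma> I \<xi>0 U' \<xi>' \<longrightarrow>
              (\<forall>\<^sub>F x in nhds 0. \<xi> x = \<xi>' x)) \<and>
           (\<forall>U \<xi>. P1_solution S \<Gamma> I \<xi>0 U \<xi> \<longrightarrow>
              (\<forall>J (\<alpha>0 :: real \<Rightarrow> real) (\<alpha>1 :: real \<Rightarrow> real).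
                 open J \<and> 0 \<in> J \<and> real_analytic_on \<alpha>0 J \<and> real_analytic_on \<alpha>1 J \<and> \<alpha>0 0 \<noteq> 0 \<longrightarrow>
                 (\<exists>V \<alpha>. P2_solution U \<Gamma> \<xi> J \<alpha>0 \<alpha>1 V \<alpha>) \<and>
                 (\<forall>V \<alpha> V' \<alpha>'. P2_solution U \<Gamma> \<xi> J \<alpha>0 \<alpha>1 V \<alpha> \<and>
                    P2_solution U \<Gamma> \<xi> J \<alpha>0 \<alpha>1 V' \<alpha>' \<longrightarrow>
                    (\<forall>\<^sub>F x in nhds 0. \<alpha> x = \<alpha>' x)) \<and>
                 (\<forall>V \<alpha>. P2_solution U \<Gamma> \<xi> J \<alpha>0 \<alpha>1 V \<alpha> \<longrightarrow>
                    (\<exists>N. open N \<and> 0 \<in> N \<and> N \<subseteq> V \<and>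
                       (\<forall>x\<in>N. nilpotent (T_of \<xi> \<alpha> x)) \<and>
                       (\<forall>\<Phi>. smooth_sym2_on N \<Phi> \<longrightarrow>
                          bach_flat_on (cotangent N) (mod_riem_ext (T_of \<xi> \<alpha>) \<Gamma> \<Phi>)))))))
       \<and> (\<forall>Q\<in>topspace X. \<exists>c'\<in>A. \<exists>N T. Q \<in> fst c' \<and> open N \<and> snd c' Q \<in> N \<and> N \<subseteq> snd c' ` fst c' \<and>
            real_analytic_on T N \<and> (\<forall>x\<in>N. nilpotent (T x) \<and> T x \<noteq> 0) \<and>
            (\<forall>\<Phi>. smooth_sym2_on N \<Phi> \<longrightarrow>
               bach_flat_on (cotangent N) (mod_riem_ext T (christoffel nabla c') \<Phi>)))"
proof -
  have surf: "real_analytic_surface X A" and tf: "torsion_free X A nabla"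
    using assms(1) by (auto simp: real_analytic_affine_surface_def)
  have chart: "open (snd c' ` fst c')" "real_analytic_on (christoffel nabla c' i j k) (snd c' ` fst c')"
    "x \<in> snd c' ` fst c' \<Longrightarrow> christoffel nabla c' i j k x = christoffel nabla c' j i k x"
    if "c' \<in> A" for c' i j k x
    using that assms(1) chart_facts(2)[OF atlas_chart[OF surf that]] christoffel_sym[OF surf that tf]
    by (auto simp: real_analytic_affine_surface_def)
  have S: "open S" "0 \<in> S" and \<Gamma>: "\<And>i j k. real_analytic_on (\<Gamma> i j k) S"
    and sym: "\<And>i j k x. x \<in> S \<Longrightarrow> \<Gamma> i j k x = \<Gamma> j i k x"
    using chart[OF assms(3)] assms(4-7) by (auto intro: rev_image_eqI)
  then have \<Gamma>0: "\<And>i j k. real_analytic_at (\<Gamma> i j k) 0" by (auto simp: real_analytic_on_def)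
  show ?thesis
  proof (intro conjI ballI allI impI; (elim conjE)?)
    fix I and \<xi>0 :: "real \<Rightarrow> real" assume I: "open I" "0 \<in> I" "real_analytic_on \<xi>0 I"
    show "\<exists>U \<xi>. P1_solution S \<Gamma> I \<xi>0 U \<xi>"
      by (rule P1_solution_exists[OF S \<Gamma> I(3,2)])
    show "\<forall>\<^sub>F x in nhds 0. \<xi> x = \<xi>' x"
      if "P1_solution S \<Gamma> I \<xi>0 U \<xi>" "P1_solution S \<Gamma> I \<xi>0 U' \<xi>'" for U \<xi> U' \<xi>'
      by (rule P1_solution_unique[OF S(2) \<Gamma> I(3,1,2) that])
    fix U \<xi> assume sol: "P1_solution S \<Gamma> I \<xi>0 U \<xi>"
    then have U: "open U" "0 \<in> U" "U \<subseteq> S" "real_analytic_on \<xi> U" "\<And>x. x \<in> U \<Longrightarrow> P1 \<Gamma> \<xi> x = 0"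
      by (auto simp: P1_solution_def)
    then have \<xi>: "real_analytic_at \<xi> 0" by (auto simp: real_analytic_on_def)
    fix J and \<alpha>0 \<alpha>1 :: "real \<Rightarrow> real"
    assume J: "open J" "0 \<in> J" "real_analytic_on \<alpha>0 J" "real_analytic_on \<alpha>1 J" "\<alpha>0 0 \<noteq> 0"
    show "\<exists>V \<alpha>. P2_solution U \<Gamma> \<xi> J \<alpha>0 \<alpha>1 V \<alpha>"
      by (rule P2_solution_exists[OF U(1,2) \<Gamma>0 \<xi> J(3,4,2,5)])
    show "\<forall>\<^sub>F x in nhds 0. \<alpha> x = \<alpha>' x"
      if "P2_solution U \<Gamma> \<xi> J \<alpha>0 \<alpha>1 V \<alpha>" "P2_solution U \<Gamma> \<xi> J \<alpha>0 \<alpha>1 V' \<alpha>'" for V \<alpha> V' \<alpha>'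
      by (rule P2_solution_unique[OF \<Gamma>0 \<xi> J(3,4,1,2,5) that])
    fix V \<alpha> assume sol2: "P2_solution U \<Gamma> \<xi> J \<alpha>0 \<alpha>1 V \<alpha>"
    then have V: "open V" "0 \<in> V" "V \<subseteq> U" "real_analytic_on \<alpha> V" "\<And>x. x \<in> V \<Longrightarrow> P2 \<Gamma> \<xi> \<alpha> x = 0"
      by (auto simp: P2_solution_def)
    \<comment> \<open>Both equations hold on all of \<open>V\<close>, since \<open>V\<close> lies in
      \<open>U\<close>; the whole of \<open>V\<close> can serve as \<open>N\<close>.\<close>
    have "bach_flat_on (cotangent V) (mod_riem_ext (T_of \<xi> \<alpha>) \<Gamma> \<Phi>)" if "smooth_sym2_on V \<Phi>" for \<Phi>
      using U V \<Gamma> by (intro bach_flat_on_extension that sym) (auto simp: real_analytic_on_def)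
    then show "\<exists>N. open N \<and> 0 \<in> N \<and> N \<subseteq> V \<and> (\<forall>x\<in>N. nilpotent (T_of \<xi> \<alpha> x)) \<and>
        (\<forall>\<Phi>. smooth_sym2_on N \<Phi> \<longrightarrow> bach_flat_on (cotangent N) (mod_riem_ext (T_of \<xi> \<alpha>) \<Gamma> \<Phi>))"
      using V nilpotent_T_of by (intro exI[of _ V]) auto
  next
    fix Q assume "Q \<in> topspace X"
    moreover have "topspace X = (\<Union>c\<in>A. fst c)" using surf unfolding real_analytic_surface_def by blast
    ultimately obtain c' where c': "c' \<in> A" "Q \<in> fst c'" by blast
    then have "snd c' Q \<in> snd c' ` fst c'" by blast
    from bach_flat_extension_exists[where \<Gamma> = "christoffel nabla c'", OF chart(1)[OF c'(1)] this chart(2)[OF c'(1)] chart(3)[OF c'(1)]]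
    obtain N T where "open N" "snd c' Q \<in> N" "N \<subseteq> snd c' ` fst c'" "real_analytic_on T N"
      "\<forall>x\<in>N. nilpotent (T x) \<and> T x \<noteq> 0"
      "\<forall>\<Phi>. smooth_sym2_on N \<Phi> \<longrightarrow> bach_flat_on (cotangent N) (mod_riem_ext T (christoffel nabla c') \<Phi>)"
      by blast
    with c' show "\<exists>c'\<in>A. \<exists>N T. Q \<in> fst c' \<and> open N \<and> snd c' Q \<in> N \<and> N \<subseteq> snd c' ` fst c' \<and>
            real_analytic_on T N \<and> (\<forall>x\<in>N. nilpotent (T x) \<and> T x \<noteq> 0) \<and>
            (\<forall>\<Phi>. smooth_sym2_on N \<Phi> \<longrightarrow>
               bach_flat_on (cotangent N) (mod_riem_ext T (christoffel nabla c') \<Phi>))"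
      by (intro bexI[of _ c'] exI[of _ N] exI[of _ T] conjI)
  qed
qed

end
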